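(* Let $\mu$ be a doubling Radon measure on $\mathbb{R}^n$, $\gamma\ne0$, $1\le p<\infty$, and $f\in L^1_{\rm loc}(\mathbb{R}^n,\mu)$. (i) Let $f$ be nonnegative and set $a(f)(x,t)=t^{\gamma/p}\frac1{\mu(B(x,t))}\int_{B(x,t)}f\,d\mu$ for $(x,t)\in\mathbb{R}^{n+1}_+$. If $\gamma<0$, or $\gamma>d>0$ and $\mu(Q)\approx\ell(Q)^d$ for all $Q\in\mathcal{D}$, or $\gamma>0$ and $p>1$, then $$\|a(f)\|_{L^{p,\infty}(\mathbb{R}^{n+1}_+,\nu_\gamma)}\lesssim\|f\|_{L^p(\mathbb{R}^n,\mu)}.$$ Conversely, if $\gamma>0$ or $\gamma<0$, then $$\|f\|_{L^p(\mathbb{R}^n,\mu)}\lesssim[a(f)]_{L^{p,\infty}(\mathbb{R}^{n+1}_+,\nu_\gamma)}.$$ (ii) Assume $\mu$ is Lebesgue measure and $\gamma\notin[0,n]$, and set $b(f)(x,t)=t^{\gamma/p}O(f,B(x,t))$. Then $$\|b(f)\|_{L^{p,\infty}(\mathbb{R}^{n+1}_+,\nu_\gamma)}\lesssim\|f\|_{\mathrm{JN}_p(\mathbb{R}^n)}.$$ (iii) Assume $\mu$ is Lebesgue measure. If $f\in\dot W^{1,p}(\mathbb{R}^n)$, $1<p<\infty$, and $m(f)(x,r)=O(f,B(x,r))$, then $$\|m(f)\|_{L^{p,\infty}(\mathbb{R}^{n+1}_+,\nu_p)}\lesssim\|\nabla f\|_{L^p(\mathbb{R}^n)}.$$ All implied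 constants are independent of $f$.
   Context: $\mathcal{D}$ is the collection of half-open dyadic cubes $[j_12^k,(j_1+1)2^k)\times\cdots\times[j_n2^k,(j_n+1)2^k)$, $k\in\mathbb{Z}$, $j\in\mathbb{Z}^n$; $\ell(Q)$ is the sidelength of a cube $Q$, $B(x,t)$ the ball with center $x$ and radius $t$, $\mathbb{R}^{n+1}_+=\mathbb{R}^n\times(0,\infty)$. $\mu$ is doubling if there is $C_D$ with $0<\mu(2B)\le C_D\,\mu(B)$ for all balls $B$, where $2B$ is the concentric ball of twice the radius. $A\lesssim B$ means $A\le cB$ for a constant $c$; $A\approx B$ means $A\lesssim B\lesssim A$. The measure $\nu_\gamma$ on $\mathbb{R}^{n+1}_+$ is $d\nu_\gamma(x,t)=\frac{d\mu(x)\,dt}{t^{1+\gamma}}$ (and $\nu_p$ is the case $\gamma=p$). For a measurable function $F$ on $\mathbb{R}^{n+1}_+$, $\|F\|_{L^{p,\infty}(\mathbb{R}^{n+1}_+,\nu_\gamma)}=(\sup_{\lambda>0}\lambda^p\nu_\gamma(\{|F|>\lambda\}))^{1/p}$, and $[F]_{L^{p,\infty}(\mathbb{R}^{n+1}_+,\nu_\gamma)}$ is the same expression with $\sup_{\lambda>0}$ replaced by $\liminf_{\lambda\to0^+}$ if $\gamma>0$ and by $\limsup_{\lambda\to\infty}$ if $\gamma<0$. For Lebesgue measure, $O(f,E)=\frac1{|E|}\int_E|f-f_E|$ with $f_E=\frac1{|E|}\int_Ef$, and $$\|f\|_{\mathrm{JN}_p(\mathbb{R}^n)}=\Big(\sup_{\mathcal{P}}\sum_{Q\in\mathcal{P}}|Q|\,O(f,Q)^p\Big)^{1/p},$$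 the supremum over all collections $\mathcal{P}$ of pairwise disjoint (axis-parallel) cubes in $\mathbb{R}^n$. $\dot W^{1,p}(\mathbb{R}^n)$ is the homogeneous Sobolev space of locally integrable functions whose weak gradient is in $L^p(\mathbb{R}^n)$. *)

theory Defs
  imports "HOL-Analysis.Analysis"
begin

text \<open>Powers of extended nonnegative reals; only meant for exponents \<open>a > 0\<close>.\<close>

definition enn_powr :: "ennreal \<Rightarrow> real \<Rightarrow> ennreal" where
  "enn_powr x a = (if x = \<infinity> then \<infinity> else ennreal (enn2real x powr a))"


section \<open>Measures on Euclidean space\<close>

definition radon_measure :: "(real ^ 'n) measure \<Rightarrow> bool" where
  "radon_measure \<mu> \<longleftrightarrow>
     sets \<mu> = sets borel \<and>
     (\<forall>K. compact K \<longrightarrow> emeasure \<mu> K < \<infinity>) \<and>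
     (\<forall>A \<in> sets borel. emeasure \<mu> A = (INF U\<in>{U. open U \<and> A \<subseteq> U}. emeasure \<mu> U)) \<and>
     (\<forall>U. open U \<longrightarrow> emeasure \<mu> U = (SUP K\<in>{K. compact K \<and> K \<subseteq> U}. emeasure \<mu> K))"

definition doubling :: "(real ^ 'n) measure \<Rightarrow> bool" where
  "doubling \<mu> \<longleftrightarrow> (\<exists>C::real. \<forall>x r. r > 0 \<longrightarrow>
     0 < emeasure \<mu> (ball x (2 * r)) \<and>
     emeasure \<mu> (ball x (2 * r)) \<le> ennreal C * emeasure \<mu> (ball x r))"

definition half_open_cube :: "real ^ 'n \<Rightarrow> real \<Rightarrow> (real ^ 'n) set" where
  "half_open_cube a l = {x. \<forall>i. a $ i \<le> x $ i \<and> x $ i < a $ i + l}"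

definition dyadic_cube :: "int \<Rightarrow> ('n \<Rightarrow> int) \<Rightarrow> (real ^ 'n) set" where
  "dyadic_cube k j = half_open_cube (\<chi> i. of_int (j i) * 2 powi k) (2 powi k)"

text \<open>\<open>\<mu>(Q) \<approx> \<ell>(Q)\<^sup>d\<close>, uniformly over all dyadic cubes \<open>Q\<close>.\<close>

definition dyadic_regular :: "(real ^ 'n) measure \<Rightarrow> real \<Rightarrow> bool" where
  "dyadic_regular \<mu> d \<longleftrightarrow> (\<exists>c1 c2 :: real. 0 < c1 \<and> 0 < c2 \<and> (\<forall>k j.
     ennreal (c1 * (2 powi k) powr d) \<le> emeasure \<mu> (dyadic_cube k j) \<and>
     emeasure \<mu> (dyadic_cube k j) \<le> ennreal (c2 * (2 powi k) powr d)))"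

text \<open>The measure \<open>d\<mu>(x) dt / t\<^bsup>1+\<gamma>\<^esup>\<close> on the upper half-space, as a measure on the
  whole of \<open>\<real>\<^sup>n \<times> \<real>\<close> that vanishes where \<open>t \<le> 0\<close>.\<close>

definition nu_measure :: "(real ^ 'n) measure \<Rightarrow> real \<Rightarrow> ((real ^ 'n) \<times> real) measure" where
  "nu_measure \<mu> \<gamma> = density (\<mu> \<Otimes>\<^sub>M lborel)
     (\<lambda>(x, t). ennreal (t powr - (1 + \<gamma>)) * indicator {0<..} t)"


section \<open>Norms\<close>

text \<open>Integrals of functions on \<open>\<real>\<^sup>n\<close> are taken with respect to \<open>completion \<mu>\<close>, so that
  \<open>f\<close> need only be measurable up to null sets of \<open>\<mu>\<close>; for \<open>\<mu> = lborel\<close> this is \<open>lebesgue\<close>.\<close>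

definition locally_integrable ::
    "(real ^ 'n) measure \<Rightarrow> (real ^ 'n \<Rightarrow> 'b::{banach, second_countable_topology}) \<Rightarrow> bool" where
  "locally_integrable M f \<longleftrightarrow>
     f \<in> borel_measurable M \<and> (\<forall>K. compact K \<longrightarrow> set_integrable M K f)"

definition Lp_norm :: "'a measure \<Rightarrow> real \<Rightarrow> ('a \<Rightarrow> 'b::real_normed_vector) \<Rightarrow> ennreal" where
  "Lp_norm M p f = enn_powr (\<integral>\<^sup>+ x. ennreal (norm (f x) powr p) \<partial>M) (1 / p)"

definition distr_term ::
    "(real ^ 'n) measure \<Rightarrow> real \<Rightarrow> real \<Rightarrow> ((real ^ 'n) \<times> real \<Rightarrow> real) \<Rightarrow> real \<Rightarrow> ennreal" where
  "distr_term \<mu> \<gamma> p F s =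
     ennreal (s powr p) * emeasure (nu_measure \<mu> \<gamma>) {z. 0 < snd z \<and> s < \<bar>F z\<bar>}"

definition weak_Lp_norm ::
    "(real ^ 'n) measure \<Rightarrow> real \<Rightarrow> real \<Rightarrow> ((real ^ 'n) \<times> real \<Rightarrow> real) \<Rightarrow> ennreal" where
  "weak_Lp_norm \<mu> \<gamma> p F = enn_powr (SUP s\<in>{0<..}. distr_term \<mu> \<gamma> p F s) (1 / p)"

text \<open>The quantity \<open>[F]\<close>; only meant for \<open>\<gamma> \<noteq> 0\<close>.\<close>

definition weak_Lp_limit ::
    "(real ^ 'n) measure \<Rightarrow> real \<Rightarrow> real \<Rightarrow> ((real ^ 'n) \<times> real \<Rightarrow> real) \<Rightarrow> ennreal" where
  "weak_Lp_limit \<mu> \<gamma> p F =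
     enn_powr (if 0 < \<gamma> then Liminf (at_right 0) (distr_term \<mu> \<gamma> p F)
               else Limsup at_top (distr_term \<mu> \<gamma> p F)) (1 / p)"


section \<open>Averages and oscillations\<close>

definition mean :: "(real ^ 'n) measure \<Rightarrow> (real ^ 'n \<Rightarrow> real) \<Rightarrow> (real ^ 'n) set \<Rightarrow> real" where
  "mean M f E = (1 / measure M E) * (LINT y:E|M. f y)"

definition mean_osc :: "(real ^ 'n \<Rightarrow> real) \<Rightarrow> (real ^ 'n) set \<Rightarrow> real" where
  "mean_osc f E = mean lebesgue (\<lambda>y. \<bar>f y - mean lebesgue f E\<bar>) E"

definition a_fun ::
    "(real ^ 'n) measure \<Rightarrow> real \<Rightarrow> real \<Rightarrow> (real ^ 'n \<Rightarrow> real) \<Rightarrow> (real ^ 'n) \<times> real \<Rightarrow> real" where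
  "a_fun \<mu> \<gamma> p f = (\<lambda>(x, t). t powr (\<gamma> / p) * mean (completion \<mu>) f (ball x t))"

definition b_fun :: "real \<Rightarrow> real \<Rightarrow> (real ^ 'n \<Rightarrow> real) \<Rightarrow> (real ^ 'n) \<times> real \<Rightarrow> real" where
  "b_fun \<gamma> p f = (\<lambda>(x, t). t powr (\<gamma> / p) * mean_osc f (ball x t))"

definition m_fun :: "(real ^ 'n \<Rightarrow> real) \<Rightarrow> (real ^ 'n) \<times> real \<Rightarrow> real" where
  "m_fun f = (\<lambda>(x, r). mean_osc f (ball x r))"

definition JN_norm :: "real \<Rightarrow> (real ^ 'n \<Rightarrow> real) \<Rightarrow> ennreal" where
  "JN_norm p f = enn_powr
     (SUP P\<in>{P. P \<subseteq> {half_open_cube a l | a l. 0 < l} \<and> pairwise disjnt P}.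
        \<Sum>\<^sub>\<infinity>Q\<in>P. emeasure lebesgue Q * ennreal (mean_osc f Q powr p)) (1 / p)"


section \<open>Weak gradients\<close>

definition partial_deriv :: "'n \<Rightarrow> (real ^ 'n \<Rightarrow> real) \<Rightarrow> real ^ 'n \<Rightarrow> real" where
  "partial_deriv i \<phi> x = frechet_derivative \<phi> (at x) (axis i 1)"

text \<open>Compactly supported \<open>C\<^sup>\<infinity>\<close> functions: all iterated partial derivatives, of every order
  and including \<open>\<phi>\<close> itself (the empty list), are differentiable everywhere, hence continuous.\<close>

definition test_function :: "(real ^ 'n \<Rightarrow> real) \<Rightarrow> bool" where
  "test_function \<phi> \<longleftrightarrow>
     (\<forall>is :: 'n list. \<forall>x. foldr partial_deriv is \<phi> differentiable (at x)) \<and>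
     compact (closure {x. \<phi> x \<noteq> 0})"

definition weak_gradient :: "(real ^ 'n \<Rightarrow> real) \<Rightarrow> (real ^ 'n \<Rightarrow> real ^ 'n) \<Rightarrow> bool" where
  "weak_gradient f g \<longleftrightarrow>
     locally_integrable lebesgue f \<and> locally_integrable lebesgue g \<and>
     (\<forall>\<phi> i. test_function \<phi> \<longrightarrow>
        (LINT x|lebesgue. f x * partial_deriv i \<phi> x) = - (LINT x|lebesgue. g x $ i * \<phi> x))"

definition homogeneous_Sobolev :: "real \<Rightarrow> (real ^ 'n \<Rightarrow> real) set" where
  "homogeneous_Sobolev p =
     {f. locally_integrable lebesgue f \<and> (\<exists>g. weak_gradient f g \<and> Lp_norm lebesgue p g < \<infinity>)}"

end

theory Submission
  imports Defs
begin

text \<open>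
  Let \<open>S\<close> be the superlevel set at height \<open>s\<close>. If \<open>\<gamma> < 0\<close>, the \<open>5r\<close>-covering lemma selects disjoint
  balls \<open>B(x\<^sub>i, t\<^sub>i)\<close> with \<open>(x\<^sub>i, t\<^sub>i) \<in> S\<close> such that \<open>S\<close> is covered by the sets
  \<open>B(x\<^sub>i, 5t\<^sub>i) \<times> (0, 6t\<^sub>i)\<close>, of \<open>\<nu>\<close>-measure comparable to \<open>\<mu>(B(x\<^sub>i, t\<^sub>i)) t\<^sub>i\<^bsup>-\<gamma>\<^esup>\<close>. If \<open>\<gamma> > d\<close> and \<open>\<mu>\<close> is
  \<open>d\<close>-regular, the selection runs from the smallest radii upwards, and \<open>S\<close> is covered by cones
  \<open>{(x, t). t > t\<^sub>i / 3, |x - x\<^sub>i| < 4t}\<close> of measure comparable to \<open>t\<^sub>i\<^bsup>d-\<gamma>\<^esup>\<close>. In both cases the defining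
  inequality of \<open>S\<close> bounds the total measure by a sum over disjoint balls or cubes, that is by
  \<open>\<integral>f\<close> when \<open>p = 1\<close> or by the \<open>JN\<^sub>p\<close> norm.

  If \<open>p > 1\<close>, no maximal function is needed: truncating \<open>f\<close> at height \<open>s t\<^bsup>-\<gamma>/p\<^esup> / 2\<close>, each slice of \<open>S\<close> at
  fixed \<open>t\<close> is estimated by Chebyshev's inequality and the boundedness on \<open>L\<^sup>1\<close> of averaging at
  scale \<open>t\<close>, and integration in \<open>t\<close> gives \<open>\<integral>f\<^sup>p\<close>.

  The converse follows by Fatou's lemma from a lower bound \<open>liminf A\<^sub>t f \<ge> c f\<close> almost everywhere for
  the averages \<open>A\<^sub>t f\<close> as \<open>t \<rightarrow> 0\<close>.

  For Sobolev functions, testing the weak gradient on tensor products whose \<open>i\<close>-th factor is an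
  antiderivative of \<open>h(u) - h(u - s)\<close> yields \<open>f(x + s e\<^sub>i) - f(x) = \<integral>\<^sub>0\<^sup>s \<partial>\<^sub>i f(x + \<theta> e\<^sub>i) d\<theta>\<close> almost everywhere.
  Moving one coordinate at a time gives a Poincare inequality
  \<open>O(f, B(x, r)) \<le> C r A\<^bsub>5r\<^esub> |\<nabla>f|(x)\<close>, which reduces the claim to the estimate for \<open>p > 1\<close>, \<open>\<gamma> = p\<close>.
\<close>

section \<open>Doubling Radon measures\<close>

text \<open>Superlevel sets of \<open>b_fun\<close> and \<open>m_fun\<close> are never shown to be
  measurable. The upper bounds do without: a set is enclosed in a measurable one, or it is not
  measurable and has \<open>emeasure\<close> 0.

  The sign of \<gamma> decides the covering. For \<gamma> < 0 the weight
  \<open>t powr - (1 + \<gamma>)\<close> is integrable at 0, regions below a ball are cheap, and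
  large balls are selected. For \<gamma> > 0 it is integrable only at infinity; the region above a
  ball widens like t^d, so its measure is finite only if \<gamma> > d, and small balls must be
  selected. Both covering estimates see a set only through sums over its finite disjoint families,
  so they serve averages on balls and oscillations on cubes alike; only the dilation
  \<open>\<kappa>\<close> and the bound \<open>M\<close> change.

  For p > 1 truncation replaces covering, since the extra decay in t makes the weight integrable on
  the side that matters for either sign of \<gamma>. Its constant contains 1 / (1 - 1/p), which is
  why p = 1 has to come from the coverings. The same estimate with balls enlarged by 5 absorbs the
  loss of radius in the Poincare inequality. All constants are obtained before the function is
  fixed.\<close>

lemma enn_powr_mono:
  assumes "x \<le> y" "0 < a"
  shows "enn_powr x a \<le> enn_powr y a"
proof (cases "y = \<infinity>")
  case False
  then have "x \<noteq> \<infinity>" using assms(1) by (auto simp: top_unique)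
  moreover have "enn2real x \<le> enn2real y"
    using assms(1) False by (intro enn2real_mono) (auto simp: less_top)
  ultimately show ?thesis using False assms
    by (auto simp: enn_powr_def intro!: ennreal_leI powr_mono2)
qed (simp add: enn_powr_def)

lemma enn_powr_cmult:
  assumes "0 < c" "0 < a"
  shows "enn_powr (ennreal c * x) a = ennreal (c powr a) * enn_powr x a"
  using assms
  by (auto simp: enn_powr_def ennreal_mult_eq_top_iff ennreal_mult_top enn2real_mult powr_mult
      ennreal_mult')

lemma weak_Lp_norm_le:
  assumes "0 < C" "0 < p" and le: "\<And>s. 0 < s \<Longrightarrow> distr_term \<mu> \<gamma> p F s \<le> ennreal C * X"
  shows "weak_Lp_norm \<mu> \<gamma> p F \<le> ennreal (C powr (1/p)) * enn_powr X (1/p)"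
proof -
  have "weak_Lp_norm \<mu> \<gamma> p F \<le> enn_powr (ennreal C * X) (1/p)"
    unfolding weak_Lp_norm_def using assms(2) by (intro enn_powr_mono SUP_least le) auto
  then show ?thesis using assms by (simp add: enn_powr_cmult)
qed

section \<open>Power weights on half-lines and a countable union bound\<close>

lemma nn_integral_powr_less:
  assumes "0 < a" "0 \<le> T"
  shows "(\<integral>\<^sup>+t. ennreal (t powr (a - 1)) * indicator {0<..<T} t \<partial>lborel) = ennreal (T powr a / a)"
proof -
  have h: "((\<lambda>t. t powr (a - 1)) has_integral (T powr a / a)) {0..T}"
    using has_integral_powr_from_0[of "a - 1" T] assms by simp
  have "(\<integral>\<^sup>+t. ennreal (t powr (a - 1)) * indicator {0<..<T} t \<partial>lborel)
      = (\<integral>\<^sup>+t. ennreal (indicator {0..T} t * t powr (a - 1)) \<partial>lborel)"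
  proof (rule nn_integral_cong_AE)
    show "AE t in lborel. ennreal (t powr (a - 1)) * indicator {0<..<T} t
      = ennreal (indicator {0..T} t * t powr (a - 1))"
      using AE_lborel_singleton[of 0] AE_lborel_singleton[of T]
      by eventually_elim (auto simp: indicator_def)
  qed
  also have "\<dots> = ennreal (T powr a / a)"
  proof (rule nn_integral_has_integral_lborel)
    show "((\<lambda>t. indicator {0..T} t * t powr (a - 1)) has_integral (T powr a / a)) UNIV"
      using h by (subst (asm) has_integral_restrict_UNIV[symmetric])
        (erule has_integral_cong[THEN iffD1, rotated], simp)
  qed auto
  finally show ?thesis .
qed

lemma nn_integral_powr_greater:
  assumes "0 < a" "0 < T"
  shows "(\<integral>\<^sup>+t. ennreal (t powr (- a - 1)) * indicator {T<..} t \<partial>lborel) = ennreal (T powr (- a) / a)"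
proof -
  have "(\<integral>\<^sup>+t. ennreal (t powr (- a - 1)) * indicator {T<..} t \<partial>lborel)
      = (\<integral>\<^sup>+t. ennreal (t powr (- a - 1)) * indicator {T..} t \<partial>lborel)"
    by (rule nn_integral_cong_AE, use AE_lborel_singleton[of T] in eventually_elim)
      (auto simp: indicator_def)
  also have "\<dots> = ennreal (0 - (- (T powr (- a) / a)))"
  proof (rule nn_integral_FTC_atLeast)
    show "((\<lambda>t. - (t powr (- a) / a)) has_field_derivative t powr (- a - 1)) (at t)" if "T \<le> t" for t
      using that assms by (auto intro!: derivative_eq_intros)
    have "((\<lambda>t. t powr (- a)) \<longlongrightarrow> 0) at_top"
      using assms by (intro tendsto_neg_powr filterlim_ident) auto
    then have "((\<lambda>t. - (t powr (- a) / a)) \<longlongrightarrow> - (0 / a)) at_top"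
      using assms by (intro tendsto_intros) auto
    then show "((\<lambda>t. - (t powr (- a) / a)) \<longlongrightarrow> 0) at_top" by simp
  qed auto
  finally show ?thesis by simp
qed

text \<open>The partial unions increase to the whole union, so finite subfamilies suffice. Hence the
  disjointness arguments below are only needed for finite sums.\<close>

lemma countable_UN_emeasure_le:
  assumes "countable C" "\<And>j. j \<in> C \<Longrightarrow> A j \<in> sets M"
    and fin: "\<And>F. finite F \<Longrightarrow> F \<subseteq> C \<Longrightarrow> (\<Sum>j\<in>F. emeasure M (A j)) \<le> B"
  shows "emeasure M (\<Union>j\<in>C. A j) \<le> B"
proof (cases "C = {}")
  case False
  let ?U = "\<lambda>n. \<Union>j\<in>from_nat_into C ` {..<n}. A j"
  have sub: "from_nat_into C ` X \<subseteq> C" for X using from_nat_into[OF False] by auto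
  have "(\<Union>n. ?U n) = (\<Union>j\<in>C. A j)"
  proof (intro equalityI subsetI)
    fix z assume "z \<in> (\<Union>j\<in>C. A j)"
    then obtain j where j: "j \<in> C" "z \<in> A j" by auto
    then obtain n where "from_nat_into C n = j" using from_nat_into_surj[OF assms(1)] by metis
    with j show "z \<in> (\<Union>n. ?U n)" by (intro UN_I[of "Suc n"]) auto
  qed (use sub in blast)
  moreover have "(SUP n. emeasure M (?U n)) = emeasure M (\<Union>n. ?U n)"
  proof (rule SUP_emeasure_incseq)
    show "range ?U \<subseteq> sets M" using sub assms(2) by (blast intro!: sets.finite_UN)
    show "incseq ?U" unfolding incseq_def by (intro allI impI UN_mono image_mono) auto
  qed
  moreover have "emeasure M (?U n) \<le> B" for n
  proof -
    have "emeasure M (?U n) \<le> (\<Sum>j\<in>from_nat_into C ` {..<n}. emeasure M (A j))"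
      using sub[of "{..<n}"] assms(2) by (intro emeasure_subadditive_finite) auto
    also have "\<dots> \<le> B" by (intro fin sub) auto
    finally show ?thesis .
  qed
  ultimately show ?thesis by (metis SUP_least)
qed simp

locale doubling_radon =
  fixes \<mu> :: "(real ^ 'n) measure"
  assumes radon: "radon_measure \<mu>" and dbl: "doubling \<mu>"
begin

lemma sets_mu [measurable_cong, simp]: "sets \<mu> = sets borel"
  using radon by (simp add: radon_measure_def)

lemma measurable_mu [simp]: "measurable \<mu> N = measurable borel N"
  by (intro measurable_cong_sets) auto

lemma space_mu [simp]: "space \<mu> = UNIV"
  using sets_eq_imp_space_eq[OF sets_mu] by simp

lemma compact_finite: "compact K \<Longrightarrow> emeasure \<mu> K < \<infinity>"
  using radon by (simp add: radon_measure_def)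

lemma bounded_finite:
  assumes "bounded A" shows "emeasure \<mu> A < \<infinity>"
proof -
  have "emeasure \<mu> A \<le> emeasure \<mu> (closure A)"
    by (intro emeasure_mono closure_subset) auto
  also have "\<dots> < \<infinity>" using assms by (intro compact_finite) (simp add: compact_closure)
  finally show ?thesis .
qed

lemma ball_finite: "emeasure \<mu> (ball x r) < \<infinity>"
  by (intro bounded_finite) auto

sublocale sigma_finite_measure \<mu>
proof
  show "\<exists>A. countable A \<and> A \<subseteq> sets \<mu> \<and> \<Union>A = space \<mu> \<and> (\<forall>a\<in>A. emeasure \<mu> a \<noteq> \<infinity>)"
  proof (intro exI conjI ballI)
    show "\<Union>(range (\<lambda>n::nat. ball 0 (real n))) = space \<mu>"
      using reals_Archimedean2 by force
    fix a assume "a \<in> range (\<lambda>n::nat. ball (0::real^'n) (real n))"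
    then show "emeasure \<mu> a \<noteq> \<infinity>" using ball_finite[of 0] by (auto simp: less_top)
  qed (auto intro!: countable_image)
qed

sublocale pair_sigma_finite \<mu> lborel ..

lemma outer_regular:
  assumes "A \<in> sets borel" "emeasure \<mu> A < c"
  obtains U where "open U" "A \<subseteq> U" "emeasure \<mu> U < c"
proof -
  have "emeasure \<mu> A = (INF U\<in>{U. open U \<and> A \<subseteq> U}. emeasure \<mu> U)"
    using assms(1) radon by (simp add: radon_measure_def)
  then show ?thesis using assms(2) that by (auto simp: INF_less_iff)
qed

definition doubling_const :: real where
  "doubling_const = (SOME C. \<forall>x r. r > 0 \<longrightarrow> 0 < emeasure \<mu> (ball x (2 * r)) \<and>
     emeasure \<mu> (ball x (2 * r)) \<le> ennreal C * emeasure \<mu> (ball x r))"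

lemma doubling_const_props:
  assumes "r > 0"
  shows "0 < emeasure \<mu> (ball x r)"
    "emeasure \<mu> (ball x (2 * r)) \<le> ennreal doubling_const * emeasure \<mu> (ball x r)"
proof -
  have *: "\<forall>x r. r > 0 \<longrightarrow> 0 < emeasure \<mu> (ball x (2 * r)) \<and>
     emeasure \<mu> (ball x (2 * r)) \<le> ennreal doubling_const * emeasure \<mu> (ball x r)"
    unfolding doubling_const_def by (rule someI_ex) (use dbl in \<open>simp add: doubling_def\<close>)
  from *[rule_format, of "r/2" x] *[rule_format, of r x] assms
  show "0 < emeasure \<mu> (ball x r)"
    "emeasure \<mu> (ball x (2 * r)) \<le> ennreal doubling_const * emeasure \<mu> (ball x r)" by auto
qed

lemma doubling_const_ge_1: "1 \<le> doubling_const"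
proof -
  let ?b = "\<lambda>r. emeasure \<mu> (ball 0 r)"
  have "?b 1 * ennreal 1 \<le> ?b 2" by (auto intro!: emeasure_mono)
  also have "\<dots> \<le> ?b 1 * ennreal doubling_const" using doubling_const_props(2)[of 1 0] by (simp add: mult.commute)
  finally have "?b 1 * ennreal 1 \<le> ?b 1 * ennreal doubling_const" .
  moreover have "?b 1 \<noteq> 0" "?b 1 \<noteq> top"
    using doubling_const_props(1)[of 1 0] ball_finite[of 0 1] by auto
  ultimately have "ennreal 1 \<le> ennreal doubling_const" using ennreal_mult_le_mult_iff by blast
  then show ?thesis by (simp add: ennreal_le_iff2)
qed

lemma emeasure_ball_power:
  assumes "r > 0"
  shows "emeasure \<mu> (ball x (2 ^ m * r)) \<le> ennreal (doubling_const ^ m) * emeasure \<mu> (ball x r)"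
proof (induction m)
  case (Suc m)
  have "emeasure \<mu> (ball x (2 ^ Suc m * r)) \<le> ennreal doubling_const * emeasure \<mu> (ball x (2 ^ m * r))"
    using doubling_const_props(2)[of "2 ^ m * r" x] assms by (simp add: mult_ac)
  also have "\<dots> \<le> ennreal doubling_const * (ennreal (doubling_const ^ m) * emeasure \<mu> (ball x r))"
    by (intro mult_left_mono Suc) auto
  finally show ?case using doubling_const_ge_1 by (simp add: ennreal_mult mult_ac)
qed simp

text \<open>Doubling enters the later estimates in this form, with radius and centre changed at
  once. The constant depends on \<open>\<kappa>\<close> only.\<close>

lemma ball_growth:
  obtains A where "A \<ge> 1" "\<And>x y r. 0 < r \<Longrightarrow> dist x y \<le> \<kappa> * r \<Longrightarrow>
    emeasure \<mu> (ball x (\<kappa> * r)) \<le> ennreal A * emeasure \<mu> (ball y r)"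
proof -
  \<comment> \<open>The factor 2 leaves room for the dilation by \<open>\<kappa>\<close> and for a
    shift of the centre by up to \<open>\<kappa> * r\<close>.\<close>
  obtain m where m: "2 * \<kappa> \<le> 2 ^ m"
    using real_arch_pow[of 2 "2 * \<kappa>"] by (auto intro: less_imp_le)
  show ?thesis
  proof (rule that)
    show "doubling_const ^ m \<ge> 1" using doubling_const_ge_1 by simp
    fix x y :: "real ^ 'n" and r :: real assume r: "0 < r" "dist x y \<le> \<kappa> * r"
    have "\<kappa> * r + dist x y \<le> 2 ^ m * r"
    proof -
      have "2 * \<kappa> * r \<le> 2 ^ m * r" using m r(1) by (intro mult_right_mono) auto
      then show ?thesis using r(2) by linarith
    qed
    then have "ball x (\<kappa> * r) \<subseteq> ball y (2 ^ m * r)"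
      by (simp add: ball_subset_ball_iff add.commute)
    then have "emeasure \<mu> (ball x (\<kappa> * r)) \<le> emeasure \<mu> (ball y (2 ^ m * r))"
      by (intro emeasure_mono) auto
    also have "\<dots> \<le> ennreal (doubling_const ^ m) * emeasure \<mu> (ball y r)" using r by (intro emeasure_ball_power)
    finally show "emeasure \<mu> (ball x (\<kappa> * r)) \<le> ennreal (doubling_const ^ m) * emeasure \<mu> (ball y r)" .
  qed
qed

end

section \<open>Covering lemmas\<close>

text \<open>The wellorder refines \<open>k\<close>, so every discarded element conflicts with a kept one of
  smaller or equal key.\<close>
lemma greedy_selection:
  fixes k :: "'a \<Rightarrow> nat"
  assumes sym: "\<And>z w. R z w \<Longrightarrow> R w z"
  obtains C where "C \<subseteq> K" "pairwise (\<lambda>z w. \<not> R z w) C"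
    "\<And>z. z \<in> K \<Longrightarrow> \<exists>w\<in>C. (w = z \<or> R w z) \<and> k w \<le> k z"
proof -
  obtain W :: "'a rel" where W: "Well_order W" "Field W = UNIV"
    using well_ordering[where 'a = 'a] by blast
  define L where "L = inv_image (less_than <*lex*> (W - Id)) (\<lambda>z. (k z, z))"
  have wf: "wf L" unfolding L_def
    using W by (intro wf_inv_image wf_lex_prod) (auto simp: well_order_on_def)
  have total: "(z, w) \<in> L \<or> (w, z) \<in> L" if "z \<noteq> w" for z w
    using W that by (auto simp: L_def well_order_on_def linear_order_on_def total_on_def)
  have key: "k w \<le> k z" if "(w, z) \<in> L" for w z
    using that by (auto simp: L_def)
  \<comment> \<open>Transfinite greedy choice: an element is kept unless it conflicts with an
    earlier kept one. Recursion along \<open>L\<close> makes this legitimate without any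
    countability of \<open>K\<close>.\<close>
  define P where "P = wfrec L (\<lambda>p z. z \<in> K \<and> (\<forall>w. (w, z) \<in> L \<longrightarrow> p w \<longrightarrow> \<not> R w z))"
  have P: "P z \<longleftrightarrow> z \<in> K \<and> (\<forall>w. (w, z) \<in> L \<longrightarrow> P w \<longrightarrow> \<not> R w z)" for z
    unfolding P_def by (subst wfrec[OF wf]) (auto simp: cut_apply)
  show ?thesis
  proof (rule that)
    show "Collect P \<subseteq> K" using P by auto
    show "pairwise (\<lambda>z w. \<not> R z w) (Collect P)"
    proof (rule pairwiseI)
      fix z w assume zw: "z \<in> Collect P" "w \<in> Collect P" "z \<noteq> w"
      then consider "(z, w) \<in> L" | "(w, z) \<in> L" using total by blast
      then show "\<not> R z w" using zw P[of z] P[of w] sym by cases auto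
    qed
    show "\<exists>w\<in>Collect P. (w = z \<or> R w z) \<and> k w \<le> k z" if "z \<in> K" for z
      using that P[of z] key by (cases "P z") blast+
  qed
qed

text \<open>A mirror image of Vitali's lemma for radii bounded below but perhaps not above: smaller
  scales are chosen first, so a discarded ball meets a kept ball of at most twice its own radius. No
  enlargement of the kept ball covers the discarded one; the half-space estimate uses cones
  instead.\<close>

lemma disjoint_cballs_from_small:
  fixes a :: "'a \<Rightarrow> 'b::euclidean_space"
  assumes "0 < T" and r: "\<And>z. z \<in> K \<Longrightarrow> T \<le> r z"
  obtains C where "countable C" "C \<subseteq> K"
    "pairwise (\<lambda>z w. disjnt (cball (a z) (r z)) (cball (a w) (r w))) C"
    "\<And>z. z \<in> K \<Longrightarrow> \<exists>w\<in>C. \<not> disjnt (cball (a z) (r z)) (cball (a w) (r w)) \<and> r w \<le> 2 * r z"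
proof -
  let ?B = "\<lambda>z. cball (a z) (r z)"
  \<comment> \<open>The dyadic scale of the radius in units of \<open>T\<close>. Natural numbers are
    well-founded, which real radii are not; rounding costs the factor 2.\<close>
  define k where "k z = nat \<lfloor>log 2 (r z / T)\<rfloor>" for z
  have k: "r w \<le> 2 * r z" if "z \<in> K" "w \<in> K" "k w \<le> k z" for z w
  proof -
    have pos: "1 \<le> r z / T" "1 \<le> r w / T" "0 < r z" "0 < r w"
      using r[OF that(1)] r[OF that(2)] assms(1) by (auto simp: field_simps)
    then have "0 \<le> log 2 (r z / T)" "0 \<le> log 2 (r w / T)" by auto
    then have "\<lfloor>log 2 (r w / T)\<rfloor> \<le> \<lfloor>log 2 (r z / T)\<rfloor>"
      using that(3) unfolding k_def by (simp add: nat_le_eq_zle)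
    then have "log 2 (r w / T) \<le> log 2 (r z / T) + 1" by linarith
    also have "\<dots> = log 2 (2 * (r z / T))" using pos by (subst log_mult) auto
    finally have "r w / T \<le> 2 * (r z / T)" using pos assms by (subst (asm) log_le_cancel_iff) auto
    then show ?thesis using assms by (simp add: field_simps)
  qed
  obtain C where C: "C \<subseteq> K" "pairwise (\<lambda>z w. \<not> \<not> disjnt (?B z) (?B w)) C"
    "\<And>z. z \<in> K \<Longrightarrow> \<exists>w\<in>C. (w = z \<or> \<not> disjnt (?B w) (?B z)) \<and> k w \<le> k z"
    by (rule greedy_selection[of "\<lambda>z w. \<not> disjnt (?B z) (?B w)" K k]) (auto simp: disjnt_sym)
  have rpos: "0 < r z" if "z \<in> C" for z using that C(1) r assms(1) by force
  have "disjoint (?B ` C)" using C(2) by (auto simp: pairwise_def)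
  then have "countable (?B ` C)"
  proof (rule countable_disjoint_nonempty_interior_subsets)
    fix S assume "S \<in> ?B ` C" "interior S = {}"
    then obtain z where "z \<in> C" "r z \<le> 0" by auto
    then show "S = {}" using rpos[of z] by linarith
  qed
  \<comment> \<open>Two kept elements with the same ball would conflict, the ball being nonempty; so
    countability of the balls passes to \<open>C\<close>.\<close>
  moreover have "inj_on ?B C"
  proof (rule inj_onI, rule ccontr)
    fix z w assume "z \<in> C" "w \<in> C" "?B z = ?B w" "z \<noteq> w"
    with C(2) have "disjnt (?B z) (?B z)" unfolding pairwise_def by metis
    with rpos[OF \<open>z \<in> C\<close>] show False by (auto simp: disjnt_def)
  qed
  ultimately have "countable C" by (rule countable_image_inj_on)
  moreover have "\<exists>w\<in>C. \<not> disjnt (?B z) (?B w) \<and> r w \<le> 2 * r z" if z: "z \<in> K" for z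
  proof -
    obtain w where w: "w \<in> C" "w = z \<or> \<not> disjnt (?B w) (?B z)" "k w \<le> k z" using C(3)[OF z] by auto
    have "\<not> disjnt (?B z) (?B w)"
    proof (cases "w = z")
      case True then show ?thesis using rpos[OF w(1)] by (auto simp: disjnt_def)
    qed (use w(2) in \<open>auto simp: disjnt_sym\<close>)
    with w k[OF z _ w(3)] C(1) show ?thesis by auto
  qed
  ultimately show ?thesis using C by (intro that) auto
qed

text \<open>The dilation \<open>\<kappa>\<close> is 1 for averages. For oscillations it is the
  dimension, because then the cubes circumscribed about the balls are disjoint as well.\<close>

abbreviation disjoint_cballs :: "real \<Rightarrow> ('b::metric_space \<times> real) set \<Rightarrow> bool" where
  "disjoint_cballs \<kappa> \<equiv> pairwise (\<lambda>z w. disjnt (cball (fst z) (\<kappa> * snd z)) (cball (fst w) (\<kappa> * snd w)))"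

section \<open>The measure on the half-space and its covering estimates\<close>

context doubling_radon
begin

lemma sets_nu [simp, measurable_cong]: "sets (nu_measure \<mu> \<gamma>) = sets (borel \<Otimes>\<^sub>M borel)"
  unfolding nu_measure_def by (simp cong: sets_pair_measure_cong)

text \<open>Tonelli in both orders: heights first suits products and the converse inequality, slices
  of constant height suit cones and the truncation.\<close>

lemma emeasure_nu:
  assumes [measurable]: "S \<in> sets (borel \<Otimes>\<^sub>M borel)"
  shows "emeasure (nu_measure \<mu> \<gamma>) S =
      (\<integral>\<^sup>+x. (\<integral>\<^sup>+t. ennreal (t powr - (1 + \<gamma>)) * indicator {0<..} t * indicator S (x, t) \<partial>lborel) \<partial>\<mu>)"
    "emeasure (nu_measure \<mu> \<gamma>) S =
      (\<integral>\<^sup>+t. ennreal (t powr - (1 + \<gamma>)) * indicator {0<..} t * emeasure \<mu> {x. (x, t) \<in> S} \<partial>lborel)"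
proof -
  have S: "S \<in> sets (\<mu> \<Otimes>\<^sub>M lborel)" using assms by (simp cong: sets_pair_measure_cong)
  let ?g = "\<lambda>z. (case z of (x, t) \<Rightarrow> ennreal (t powr - (1 + \<gamma>)) * indicator {0<..} t * indicator S (x, t))"
  have g [measurable]: "?g \<in> borel_measurable (\<mu> \<Otimes>\<^sub>M lborel)" using S by measurable
  have eq: "emeasure (nu_measure \<mu> \<gamma>) S = (\<integral>\<^sup>+z. ?g z \<partial>(\<mu> \<Otimes>\<^sub>M lborel))"
    unfolding nu_measure_def using S
    by (subst emeasure_density) (auto intro!: nn_integral_cong simp: case_prod_beta)
  show "emeasure (nu_measure \<mu> \<gamma>) S =
      (\<integral>\<^sup>+x. (\<integral>\<^sup>+t. ennreal (t powr - (1 + \<gamma>)) * indicator {0<..} t * indicator S (x, t) \<partial>lborel) \<partial>\<mu>)"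
    unfolding eq using g by (subst lborel.nn_integral_fst[symmetric]) auto
  have sec: "{x. (x, t) \<in> S} \<in> sets \<mu>" for t using sets_Pair2[OF S, of t] by (simp add: vimage_def)
  have "emeasure (nu_measure \<mu> \<gamma>) S = (\<integral>\<^sup>+t. \<integral>\<^sup>+x. ?g (x, t) \<partial>\<mu> \<partial>lborel)"
    unfolding eq using g by (subst nn_integral_snd[symmetric]) auto
  also have "\<dots> = (\<integral>\<^sup>+t. ennreal (t powr - (1 + \<gamma>)) * indicator {0<..} t * emeasure \<mu> {x. (x, t) \<in> S} \<partial>lborel)"
  proof (rule nn_integral_cong)
    fix t :: real
    have "(\<integral>\<^sup>+x. ?g (x, t) \<partial>\<mu>) = (\<integral>\<^sup>+x. ennreal (t powr - (1 + \<gamma>)) * indicator {0<..} t * indicator {x. (x, t) \<in> S} x \<partial>\<mu>)"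
      by (intro nn_integral_cong) (auto simp: indicator_def)
    then show "(\<integral>\<^sup>+x. ?g (x, t) \<partial>\<mu>) = ennreal (t powr - (1 + \<gamma>)) * indicator {0<..} t * emeasure \<mu> {x. (x, t) \<in> S}"
      using sec by (simp add: nn_integral_cmult_indicator)
  qed
  finally show "emeasure (nu_measure \<mu> \<gamma>) S =
      (\<integral>\<^sup>+t. ennreal (t powr - (1 + \<gamma>)) * indicator {0<..} t * emeasure \<mu> {x. (x, t) \<in> S} \<partial>lborel)" .
qed

text \<open>Only the covering sets \<open>R z\<close> have to be measurable; \<open>S\<close> is
  arbitrary.\<close>

lemma emeasure_nu_le:
  assumes "\<And>F. finite F \<Longrightarrow> F \<subseteq> C \<Longrightarrow> (\<Sum>z\<in>F. c z) \<le> M" "countable C" "0 \<le> A"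
    and "\<And>z. z \<in> C \<Longrightarrow> R z \<in> sets (borel \<Otimes>\<^sub>M borel)"
    and "\<And>z. z \<in> C \<Longrightarrow> emeasure (nu_measure \<mu> \<gamma>) (R z) \<le> ennreal A * c z"
    and "S \<subseteq> (\<Union>z\<in>C. R z)"
  shows "emeasure (nu_measure \<mu> \<gamma>) S \<le> ennreal A * M"
proof -
  have "emeasure (nu_measure \<mu> \<gamma>) S \<le> emeasure (nu_measure \<mu> \<gamma>) (\<Union>z\<in>C. R z)"
    using assms by (intro emeasure_mono sets.countable_UN') auto
  also have "\<dots> \<le> ennreal A * M"
  proof (rule countable_UN_emeasure_le[OF assms(2)])
    fix F assume F: "finite F" "F \<subseteq> C"
    then have "(\<Sum>z\<in>F. emeasure (nu_measure \<mu> \<gamma>) (R z)) \<le> (\<Sum>z\<in>F. ennreal A * c z)"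
      using assms by (intro sum_mono) auto
    also have "\<dots> \<le> ennreal A * M"
      unfolding sum_distrib_left[symmetric] using assms(1) F by (intro mult_left_mono) auto
    finally show "(\<Sum>z\<in>F. emeasure (nu_measure \<mu> \<gamma>) (R z)) \<le> ennreal A * M" .
  qed (use assms in auto)
  finally show ?thesis .
qed

text \<open>Vitali's lemma asks for bounded radii, so \<open>S\<close> is first cut at heights at
  most N. The constant does not depend on N, and continuity from below removes the cut. Leaving
  \<open>M\<close> abstract lets the caller decide what the sums over disjoint balls are compared
  with.\<close>

lemma nu_le_neg:
  assumes "\<gamma> < 0" "0 < \<kappa>"
  obtains A where "0 < A" "\<And>S M. (\<And>z. z \<in> S \<Longrightarrow> 0 < snd z) \<Longrightarrow>
     (\<And>F. finite F \<Longrightarrow> F \<subseteq> S \<Longrightarrow> disjoint_cballs \<kappa> F \<Longrightarrow>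
        (\<Sum>z\<in>F. emeasure \<mu> (ball (fst z) (snd z)) * ennreal (snd z powr - \<gamma>)) \<le> M) \<Longrightarrow>
     emeasure (nu_measure \<mu> \<gamma>) S \<le> ennreal A * M"
proof -
  obtain A where A: "A \<ge> 1" "\<And>x y r. 0 < r \<Longrightarrow> dist x y \<le> (5 * \<kappa>) * r \<Longrightarrow>
    emeasure \<mu> (ball x ((5 * \<kappa>) * r)) \<le> ennreal A * emeasure \<mu> (ball y r)"
    using ball_growth[of "5 * \<kappa>"] by blast
  define A' where "A' = A * (6 powr (- \<gamma>) / (- \<gamma>))"
  have b: "0 < 6 powr (- \<gamma>) / (- \<gamma>)" using assms by (intro divide_pos_pos) auto
  \<comment> \<open>Vitali's factor 5 acts on the radii \<open>\<kappa> * snd w\<close>. Dividing by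
    \<open>\<kappa>\<close> it also bounds the heights, where 6 leaves some room.\<close>
  let ?R = "\<lambda>z. ball (fst z) (5 * \<kappa> * snd z) \<times> {0<..<6 * snd z}"
  have meas: "?R z \<in> sets (borel \<Otimes>\<^sub>M borel)" for z :: "(real ^ 'n) \<times> real" by auto
  have R: "emeasure (nu_measure \<mu> \<gamma>) (?R z) \<le> ennreal A' * (emeasure \<mu> (ball (fst z) (snd z)) * ennreal (snd z powr - \<gamma>))"
    if z: "0 < snd z" for z :: "(real ^ 'n) \<times> real"
  proof -
    have "emeasure (nu_measure \<mu> \<gamma>) (?R z) = (\<integral>\<^sup>+x. (\<integral>\<^sup>+t. ennreal (t powr - (1 + \<gamma>)) * indicator {0<..} t * indicator (?R z) (x, t) \<partial>lborel) \<partial>\<mu>)"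
      by (rule emeasure_nu[OF meas])
    also have "\<dots> = (\<integral>\<^sup>+x. indicator (ball (fst z) (5 * \<kappa> * snd z)) x * (\<integral>\<^sup>+t. ennreal (t powr (- \<gamma> - 1)) * indicator {0<..<6 * snd z} t \<partial>lborel) \<partial>\<mu>)"
    proof (rule nn_integral_cong)
      fix x
      show "(\<integral>\<^sup>+t. ennreal (t powr - (1 + \<gamma>)) * indicator {0<..} t * indicator (?R z) (x, t) \<partial>lborel)
        = indicator (ball (fst z) (5 * \<kappa> * snd z)) x * (\<integral>\<^sup>+t. ennreal (t powr (- \<gamma> - 1)) * indicator {0<..<6 * snd z} t \<partial>lborel)"
        using arg_cong[of "- (1 + \<gamma>)" "- \<gamma> - 1"]
        by (subst nn_integral_cmult[symmetric]) (auto intro!: nn_integral_cong simp: indicator_def mult.commute)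
    qed
    also have "\<dots> = emeasure \<mu> (ball (fst z) (5 * \<kappa> * snd z)) * ennreal ((6 * snd z) powr (- \<gamma>) / (- \<gamma>))"
      using assms z by (subst nn_integral_powr_less, simp, simp, subst nn_integral_multc, measurable) auto
    also have "\<dots> \<le> (ennreal A * emeasure \<mu> (ball (fst z) (snd z))) * ennreal ((6 * snd z) powr (- \<gamma>) / (- \<gamma>))"
      using A(2)[of "snd z" "fst z" "fst z"] z assms by (intro mult_right_mono) auto
    also have "ennreal ((6 * snd z) powr (- \<gamma>) / (- \<gamma>)) = ennreal (6 powr (- \<gamma>) / (- \<gamma>)) * ennreal (snd z powr - \<gamma>)"
      using z b by (subst ennreal_mult[symmetric]) (auto simp: powr_mult)
    also have "ennreal A * emeasure \<mu> (ball (fst z) (snd z)) * (ennreal (6 powr (- \<gamma>) / (- \<gamma>)) * ennreal (snd z powr - \<gamma>))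
      = ennreal A * ennreal (6 powr (- \<gamma>) / (- \<gamma>)) * (emeasure \<mu> (ball (fst z) (snd z)) * ennreal (snd z powr - \<gamma>))"
      by (simp only: mult_ac)
    also have "ennreal A * ennreal (6 powr (- \<gamma>) / (- \<gamma>)) = ennreal A'"
      using A(1) b unfolding A'_def by (subst ennreal_mult) auto
    finally show ?thesis .
  qed
  show ?thesis
  proof (rule that)
    show A': "0 < A'" using A(1) b unfolding A'_def by (intro mult_pos_pos) auto
    fix S :: "((real ^ 'n) \<times> real) set" and M
    assume S: "\<And>z. z \<in> S \<Longrightarrow> 0 < snd z"
      and M: "\<And>F. finite F \<Longrightarrow> F \<subseteq> S \<Longrightarrow> disjoint_cballs \<kappa> F \<Longrightarrow>
        (\<Sum>z\<in>F. emeasure \<mu> (ball (fst z) (snd z)) * ennreal (snd z powr - \<gamma>)) \<le> M"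
    have trunc: "emeasure (nu_measure \<mu> \<gamma>) (S \<inter> {z. snd z \<le> real N}) \<le> ennreal A' * M" for N
    proof -
      let ?K = "S \<inter> {z. snd z \<le> real N}"
      have K: "0 < \<kappa> * snd z \<and> \<kappa> * snd z \<le> \<kappa> * real N" if "z \<in> ?K" for z
        using that S assms by auto
      obtain C where C: "countable C" "C \<subseteq> ?K" "disjoint_cballs \<kappa> C"
        "\<And>z. z \<in> ?K \<Longrightarrow> \<exists>w. w \<in> C \<and> \<not> disjnt (cball (fst z) (\<kappa> * snd z)) (cball (fst w) (\<kappa> * snd w)) \<and>
                        cball (fst z) (\<kappa> * snd z) \<subseteq> ball (fst w) (5 * (\<kappa> * snd w))"
        by (rule Vitali_covering_lemma_cballs_balls[of ?K "\<lambda>z. \<kappa> * snd z" "\<kappa> * real N" fst, OF K]) blast+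
      show ?thesis
      proof (rule emeasure_nu_le[where C = C and R = ?R
            and c = "\<lambda>z. emeasure \<mu> (ball (fst z) (snd z)) * ennreal (snd z powr - \<gamma>)"])
        show "(\<Sum>z\<in>F. emeasure \<mu> (ball (fst z) (snd z)) * ennreal (snd z powr - \<gamma>)) \<le> M"
          if F: "finite F" "F \<subseteq> C" for F
          using F C(2) pairwise_subset[OF C(3) F(2)] by (intro M) auto
        show "?K \<subseteq> (\<Union>z\<in>C. ?R z)"
        proof
          fix z assume z: "z \<in> ?K"
          then obtain w where w: "w \<in> C" "cball (fst z) (\<kappa> * snd z) \<subseteq> ball (fst w) (5 * (\<kappa> * snd w))"
            using C(4) by blast
          from z S have zp: "0 < snd z" by auto
          then have p: "0 < \<kappa> * snd z" using assms by auto
          \<comment> \<open>In Euclidean space an inclusion of balls bounds the distance of the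
            centres plus the inner radius. This one inequality controls the position and the height
            of \<open>z\<close>.\<close>
          with w(2) have *: "dist (fst z) (fst w) + \<kappa> * snd z < 5 * (\<kappa> * snd w)"
            by (auto simp: cball_subset_ball_iff)
          then have "dist (fst z) (fst w) < 5 * \<kappa> * snd w" using p by linarith
          moreover have "\<kappa> * snd z < \<kappa> * (5 * snd w)"
            using * zero_le_dist[of "fst z" "fst w"] unfolding mult.left_commute[of \<kappa> 5] by linarith
          ultimately have "z \<in> ?R w" using zp assms by (cases z) (auto simp: dist_commute)
          with w(1) show "z \<in> (\<Union>z\<in>C. ?R z)" by blast
        qed
        show "\<And>z. z \<in> C \<Longrightarrow> emeasure (nu_measure \<mu> \<gamma>) (?R z) \<le> ennreal A' * (emeasure \<mu> (ball (fst z) (snd z)) * ennreal (snd z powr - \<gamma>))"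
          using C(2) S by (intro R) auto
      qed (use C(1) A' meas in \<open>auto\<close>)
    qed
    show "emeasure (nu_measure \<mu> \<gamma>) S \<le> ennreal A' * M"
    \<comment> \<open>The measures of the cuts converge to that of \<open>S\<close> only if
      \<open>S\<close> is measurable; otherwise its \<open>emeasure\<close> is 0 by
      convention.\<close>
    proof (cases "S \<in> sets (nu_measure \<mu> \<gamma>)")
      case True
      let ?T = "\<lambda>N. S \<inter> {z. snd z \<le> real N}"
      have eq: "{z. snd z \<le> real N} = UNIV \<times> {..real N}" for N by auto
      have "{z. snd z \<le> real N} \<in> sets (borel \<Otimes>\<^sub>M borel)" for N :: nat unfolding eq by simp
      then have "(SUP N. emeasure (nu_measure \<mu> \<gamma>) (?T N)) = emeasure (nu_measure \<mu> \<gamma>) (\<Union>N. ?T N)"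
        using True by (intro SUP_emeasure_incseq) (auto simp: incseq_def)
      moreover have "(\<Union>N. ?T N) = S" using real_arch_simple by auto
      ultimately have "emeasure (nu_measure \<mu> \<gamma>) S = (SUP N. emeasure (nu_measure \<mu> \<gamma>) (?T N))"
        by metis
      also have "\<dots> \<le> ennreal A' * M" by (intro SUP_least trunc)
      finally show ?thesis .
    qed (simp add: emeasure_notin_sets)
  qed
qed

text \<open>The slice of a cone at height t has measure at most a multiple of t^d, so the t-integral
  has exponent \<open>d - \<gamma> - 1\<close> and converges at infinity exactly because
  \<open>d < \<gamma>\<close>. A finite \<open>M\<close> also keeps the heights in \<open>S\<close>
  away from 0, as the selection from small radii requires.\<close>

lemma nu_le_pos:
  assumes "0 < d" "d < \<gamma>" "0 < \<kappa>" "0 < A" and ball: "\<And>x t. 0 < t \<Longrightarrow> emeasure \<mu> (ball x t) \<le> ennreal (A * t powr d)"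
  obtains A' where "0 < A'" "\<And>S M. (\<And>z. z \<in> S \<Longrightarrow> 0 < snd z) \<Longrightarrow>
     (\<And>F. finite F \<Longrightarrow> F \<subseteq> S \<Longrightarrow> disjoint_cballs \<kappa> F \<Longrightarrow>
        (\<Sum>z\<in>F. ennreal (snd z powr (d - \<gamma>))) \<le> M) \<Longrightarrow>
     emeasure (nu_measure \<mu> \<gamma>) S \<le> ennreal A' * M"
proof -
  define A' where "A' = A * (4 * \<kappa>) powr d * ((1/3) powr (d - \<gamma>) / (\<gamma> - d))"
  \<comment> \<open>If \<open>w\<close> is selected for \<open>z\<close>, then \<open>snd w\<close>
    is at most \<open>2 * snd z\<close> and the centres are at distance at most
    \<open>3 * \<kappa> * snd z\<close>. The constants 3 and 4 turn both bounds into strict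
    ones.\<close>
  let ?R = "\<lambda>z. {(x, t). snd z / 3 < t \<and> dist (fst z) x < 4 * \<kappa> * t}"
  have meas: "?R z \<in> sets (borel \<Otimes>\<^sub>M borel)" for z :: "(real ^ 'n) \<times> real"
    unfolding case_prod_beta borel_prod by (intro borel_open open_Collect_conj open_Collect_less continuous_intros)
  have R: "emeasure (nu_measure \<mu> \<gamma>) (?R z) \<le> ennreal A' * ennreal (snd z powr (d - \<gamma>))"
    if z: "0 < snd z" for z :: "(real ^ 'n) \<times> real"
  proof -
    have "emeasure (nu_measure \<mu> \<gamma>) (?R z) =
       (\<integral>\<^sup>+t. ennreal (t powr - (1 + \<gamma>)) * indicator {0<..} t * emeasure \<mu> {x. (x, t) \<in> ?R z} \<partial>lborel)"
      by (rule emeasure_nu(2)[OF meas])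
    also have "\<dots> \<le> (\<integral>\<^sup>+t. ennreal (A * (4 * \<kappa>) powr d) * (ennreal (t powr (d - \<gamma> - 1)) * indicator {snd z / 3<..} t) \<partial>lborel)"
    proof (rule nn_integral_mono)
      fix t :: real
      show "ennreal (t powr - (1 + \<gamma>)) * indicator {0<..} t * emeasure \<mu> {x. (x, t) \<in> ?R z}
        \<le> ennreal (A * (4 * \<kappa>) powr d) * (ennreal (t powr (d - \<gamma> - 1)) * indicator {snd z / 3<..} t)"
      proof (cases "snd z / 3 < t")
        case True
        with z have t: "0 < t" by simp
        have "{x. (x, t) \<in> ?R z} = ball (fst z) (4 * \<kappa> * t)" using True by auto
        then have "ennreal (t powr - (1 + \<gamma>)) * emeasure \<mu> {x. (x, t) \<in> ?R z}
            \<le> ennreal (t powr - (1 + \<gamma>)) * ennreal (A * (4 * \<kappa> * t) powr d)"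
          using ball[of "4 * \<kappa> * t" "fst z"] t assms by (intro mult_left_mono) auto
        also have "\<dots> = ennreal (A * (4 * \<kappa>) powr d) * ennreal (t powr (d - \<gamma> - 1))"
          using assms t by (simp add: ennreal_mult[symmetric] powr_mult powr_add[symmetric] algebra_simps)
        finally show ?thesis using t True by simp
      qed auto
    qed
    also have "\<dots> = ennreal (A * (4 * \<kappa>) powr d) * ennreal ((snd z / 3) powr (- (\<gamma> - d)) / (\<gamma> - d))"
      using assms z nn_integral_powr_greater[of "\<gamma> - d" "snd z / 3"] by (subst nn_integral_cmult) auto
    also have "(snd z / 3) powr (- (\<gamma> - d)) = (1/3) powr (d - \<gamma>) * snd z powr (d - \<gamma>)"
      using z by (simp add: powr_mult[symmetric])
    also have "ennreal (A * (4 * \<kappa>) powr d) * ennreal ((1/3) powr (d - \<gamma>) * snd z powr (d - \<gamma>) / (\<gamma> - d))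
       = ennreal A' * ennreal (snd z powr (d - \<gamma>))"
      using assms by (simp add: A'_def ennreal_mult[symmetric])
    finally show ?thesis .
  qed
  show ?thesis
  proof (rule that)
    show A': "0 < A'" using assms unfolding A'_def by auto
    fix S :: "((real ^ 'n) \<times> real) set" and M
    assume S: "\<And>z. z \<in> S \<Longrightarrow> 0 < snd z"
      and M: "\<And>F. finite F \<Longrightarrow> F \<subseteq> S \<Longrightarrow> disjoint_cballs \<kappa> F \<Longrightarrow>
        (\<Sum>z\<in>F. ennreal (snd z powr (d - \<gamma>))) \<le> M"
    show "emeasure (nu_measure \<mu> \<gamma>) S \<le> ennreal A' * M"
    proof (cases "M = \<infinity> \<or> S = {}")
      case True
      then show ?thesis using A' by (auto simp: ennreal_mult_top)
    next
      case False
      then obtain m where m: "M = ennreal m" "0 \<le> m" by (cases M) auto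
      \<comment> \<open>One-element families are trivially disjoint, so \<open>M\<close> bounds each
        term. The exponent \<open>d - \<gamma>\<close> is negative, hence this is a lower bound for
        the height.\<close>
      have le: "snd z powr (d - \<gamma>) \<le> m" if "z \<in> S" for z
        using M[of "{z}"] that m by auto
      obtain z0 where "z0 \<in> S" using False by auto
      then have mp: "0 < m" using le[of z0] S[of z0] by (smt (verit) powr_gt_zero)
      have T: "m powr (1 / (d - \<gamma>)) \<le> snd z" if "z \<in> S" for z
      proof -
        have "m powr (1 / (d - \<gamma>)) \<le> (snd z powr (d - \<gamma>)) powr (1 / (d - \<gamma>))"
          using le[OF that] S[OF that] assms mp by (intro powr_mono2') (auto simp: field_simps)
        also have "\<dots> = snd z" using S[OF that] assms by (simp add: powr_powr)
        finally show ?thesis .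
      qed
      obtain C where C: "countable C" "C \<subseteq> S" "disjoint_cballs \<kappa> C"
        "\<And>z. z \<in> S \<Longrightarrow> \<exists>w\<in>C. \<not> disjnt (cball (fst z) (\<kappa> * snd z)) (cball (fst w) (\<kappa> * snd w)) \<and> \<kappa> * snd w \<le> 2 * (\<kappa> * snd z)"
      proof (rule disjoint_cballs_from_small[of "\<kappa> * m powr (1 / (d - \<gamma>))" S "\<lambda>z. \<kappa> * snd z" fst])
        show "\<kappa> * m powr (1 / (d - \<gamma>)) \<le> \<kappa> * snd z" if "z \<in> S" for z
          using T[OF that] assms by (intro mult_left_mono) auto
      qed (use assms mp in auto)
      show ?thesis
      proof (rule emeasure_nu_le[where C = C and R = ?R and c = "\<lambda>z. ennreal (snd z powr (d - \<gamma>))"])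
        show "(\<Sum>z\<in>F. ennreal (snd z powr (d - \<gamma>))) \<le> M"
          if F: "finite F" "F \<subseteq> C" for F
          using F C(2) pairwise_subset[OF C(3) F(2)] by (intro M) auto
        show "S \<subseteq> (\<Union>z\<in>C. ?R z)"
        proof
          fix z assume z: "z \<in> S"
          then obtain w y where w: "w \<in> C" "dist (fst z) y \<le> \<kappa> * snd z" "dist (fst w) y \<le> \<kappa> * snd w"
            and kw: "\<kappa> * snd w \<le> 2 * (\<kappa> * snd z)"
            using C(4)[of z] by (auto simp: disjnt_iff)
          have "dist (fst w) (fst z) \<le> \<kappa> * snd w + \<kappa> * snd z"
            using w(2,3) dist_triangle2[of "fst w" "fst z" y] by simp
          also have "\<dots> < 4 * (\<kappa> * snd z)"
            using kw mult_pos_pos[OF assms(3) S[OF z]] by linarith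
          finally have "dist (fst w) (fst z) < 4 * \<kappa> * snd z" by simp
          moreover have "snd w \<le> 2 * snd z" using kw assms(3) by (simp add: mult.left_commute[of 2])
          ultimately have "z \<in> ?R w" using S[OF z] by (cases z) auto
          with w(1) show "z \<in> (\<Union>z\<in>C. ?R z)" by blast
        qed
        show "\<And>z. z \<in> C \<Longrightarrow> emeasure (nu_measure \<mu> \<gamma>) (?R z) \<le> ennreal A' * ennreal (snd z powr (d - \<gamma>))"
          using C(2) S by (intro R) auto
      qed (use C(1) A' meas in \<open>auto\<close>)
    qed
  qed
qed

end

section \<open>Averages over balls\<close>

context doubling_radon
begin

text \<open>Extended values make Tonelli and measurability available without integrability. For
  positive radius the divisor is positive and finite.\<close>

definition avg :: "(real ^ 'n \<Rightarrow> ennreal) \<Rightarrow> real ^ 'n \<Rightarrow> real \<Rightarrow> ennreal" where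
  "avg h x r = (\<integral>\<^sup>+y\<in>ball x r. h y \<partial>\<mu>) / emeasure \<mu> (ball x r)"

lemma ball_emeasure_cases:
  assumes "0 < r"
  obtains m where "0 < m" "emeasure \<mu> (ball x r) = ennreal m" "measure \<mu> (ball x r) = m"
proof -
  obtain m where m: "0 \<le> m" "emeasure \<mu> (ball x r) = ennreal m"
    using ball_finite[of x r] by (cases "emeasure \<mu> (ball x r)") auto
  then show ?thesis using that[of m] doubling_const_props(1)[OF assms, of x] by (simp add: measure_def)
qed

lemma borel_measurable_ball_integral:
  assumes [measurable]: "case_prod G \<in> borel_measurable (N \<Otimes>\<^sub>M borel)"
    "a \<in> borel_measurable N" "b \<in> borel_measurable N"
  shows "(\<lambda>z. \<integral>\<^sup>+y\<in>ball (a z) (b z). G z y \<partial>\<mu>) \<in> borel_measurable N"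
proof -
  have "(\<lambda>z. \<integral>\<^sup>+y. (if dist (a z) y < b z then G z y else 0) \<partial>\<mu>) \<in> borel_measurable N"
    by measurable
  also have "(\<lambda>z. \<integral>\<^sup>+y. (if dist (a z) y < b z then G z y else 0) \<partial>\<mu>) = (\<lambda>z. \<integral>\<^sup>+y\<in>ball (a z) (b z). G z y \<partial>\<mu>)"
    by (intro ext nn_integral_cong) (auto simp: indicator_def)
  finally show ?thesis .
qed

text \<open>The integrand may depend on the parameter, because the truncation below cuts the
  function at a level that varies with the height.\<close>

lemma borel_measurable_avg_param:
  assumes [measurable]: "case_prod G \<in> borel_measurable (N \<Otimes>\<^sub>M borel)"
    "a \<in> borel_measurable N" "b \<in> borel_measurable N"
  shows "(\<lambda>z. avg (G z) (a z) (b z)) \<in> borel_measurable N"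
proof -
  have "(\<lambda>z. \<integral>\<^sup>+y\<in>ball (a z) (b z). 1 \<partial>\<mu>) \<in> borel_measurable N"
    by (rule borel_measurable_ball_integral) auto
  then have [measurable]: "(\<lambda>z. emeasure \<mu> (ball (a z) (b z))) \<in> borel_measurable N" by simp
  note [measurable] = borel_measurable_ball_integral[OF assms]
  show ?thesis unfolding avg_def by measurable
qed

lemma borel_measurable_avg [measurable]:
  assumes [measurable]: "h \<in> borel_measurable borel" "a \<in> borel_measurable N" "b \<in> borel_measurable N"
  shows "(\<lambda>z. avg h (a z) (b z)) \<in> borel_measurable N"
  by (rule borel_measurable_avg_param) measurable

lemma avg_greater_imp:
  assumes "c < avg h x r" "0 < r"
  shows "c * emeasure \<mu> (ball x r) \<le> (\<integral>\<^sup>+y\<in>ball x r. h y \<partial>\<mu>)"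
proof -
  obtain m where m: "0 < m" "emeasure \<mu> (ball x r) = ennreal m"
    using ball_emeasure_cases[OF assms(2)] by metis
  have "c * ennreal m \<le> avg h x r * ennreal m"
    using assms by (intro mult_right_mono) auto
  also have "\<dots> = (\<integral>\<^sup>+y\<in>ball x r. h y \<partial>\<mu>)"
    using m by (simp add: avg_def ennreal_divide_times)
  finally show ?thesis by (simp add: m)
qed

lemma sum_disjoint_balls_le:
  assumes [measurable]: "h \<in> borel_measurable borel"
    and "finite F" "disjoint_cballs 1 F" "\<And>z. z \<in> F \<Longrightarrow> 0 < snd z"
  shows "(\<Sum>z\<in>F. \<integral>\<^sup>+y\<in>ball (fst z) (snd z). h y \<partial>\<mu>) \<le> (\<integral>\<^sup>+y. h y \<partial>\<mu>)"
proof -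
  let ?N = "density \<mu> h" and ?B = "\<lambda>z. ball (fst z) (snd z)"
  have B: "emeasure ?N (?B z) = (\<integral>\<^sup>+y\<in>?B z. h y \<partial>\<mu>)" for z :: "(real ^ 'n) \<times> real"
    by (subst emeasure_density) auto
  have "(\<Sum>z\<in>F. emeasure ?N (?B z)) = emeasure ?N (\<Union>z\<in>F. ?B z)"
  proof (rule sum_emeasure)
    show "disjoint_family_on ?B F"
      unfolding disjoint_family_on_def
    proof (intro ballI impI)
      fix z w assume "z \<in> F" "w \<in> F" "z \<noteq> w"
      then have "disjnt (cball (fst z) (snd z)) (cball (fst w) (snd w))"
        using pairwiseD[OF assms(3)] by simp
      then show "?B z \<inter> ?B w = {}"
        using ball_subset_cball[of "fst z" "snd z"] ball_subset_cball[of "fst w" "snd w"]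
        unfolding disjnt_def by blast
    qed
  qed (use assms in auto)
  also have "\<dots> \<le> emeasure ?N UNIV" by (intro emeasure_mono) auto
  also have "\<dots> = (\<integral>\<^sup>+y. h y \<partial>\<mu>)" by (subst emeasure_density) auto
  finally show ?thesis unfolding B .
qed

text \<open>By Tonelli the mass at \<open>y\<close> is counted over all centres \<open>x\<close>
  within distance \<open>r\<close>. For these the balls around \<open>x\<close> and \<open>y\<close>
  have comparable measure, so the averaging kernel has integral at most \<open>A\<close> in
  \<open>x\<close> too, uniformly in \<open>r\<close>.\<close>

lemma nn_integral_avg_le:
  obtains A where "0 < A" "\<And>g r. g \<in> borel_measurable borel \<Longrightarrow> 0 < r \<Longrightarrow>
    (\<integral>\<^sup>+x. avg g x r \<partial>\<mu>) \<le> ennreal A * (\<integral>\<^sup>+y. g y \<partial>\<mu>)"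
proof -
  obtain A where A: "A \<ge> 1" "\<And>x y r. 0 < r \<Longrightarrow> dist x y \<le> 1 * r \<Longrightarrow>
    emeasure \<mu> (ball x (1 * r)) \<le> ennreal A * emeasure \<mu> (ball y r)"
    using ball_growth[of 1] by blast
  interpret P: pair_sigma_finite \<mu> \<mu> ..
  show ?thesis
  proof (rule that)
    show "0 < A" using A by simp
    fix g :: "real ^ 'n \<Rightarrow> ennreal" and r :: real
    assume g [measurable]: "g \<in> borel_measurable borel" and r: "0 < r"
    have "(\<lambda>x. \<integral>\<^sup>+y\<in>ball x r. 1 \<partial>\<mu>) \<in> borel_measurable borel"
      by (rule borel_measurable_ball_integral) auto
    then have [measurable]: "(\<lambda>x. emeasure \<mu> (ball x r)) \<in> borel_measurable borel" by simp
    have "avg g x r = (\<integral>\<^sup>+y. (if dist x y < r then g y / emeasure \<mu> (ball x r) else 0) \<partial>\<mu>)" for x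
      unfolding avg_def
      by (subst nn_integral_divide[symmetric]) (auto intro!: nn_integral_cong simp: indicator_def)
    then have "(\<integral>\<^sup>+x. avg g x r \<partial>\<mu>)
      = (\<integral>\<^sup>+x. (\<integral>\<^sup>+y. (if dist x y < r then g y / emeasure \<mu> (ball x r) else 0) \<partial>\<mu>) \<partial>\<mu>)" by simp
    also have "\<dots> = (\<integral>\<^sup>+y. (\<integral>\<^sup>+x. (if dist x y < r then g y / emeasure \<mu> (ball x r) else 0) \<partial>\<mu>) \<partial>\<mu>)"
      by (rule P.Fubini'[symmetric]) (simp cong: sets_pair_measure_cong measurable_cong_sets)
    also have "\<dots> \<le> (\<integral>\<^sup>+y. ennreal A * g y \<partial>\<mu>)"
    proof (rule nn_integral_mono)
      fix y
      obtain m where m: "0 < m" "emeasure \<mu> (ball y r) = ennreal m"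
        using ball_emeasure_cases[OF r] by metis
      have "(\<integral>\<^sup>+x. (if dist x y < r then g y / emeasure \<mu> (ball x r) else 0) \<partial>\<mu>)
        \<le> (\<integral>\<^sup>+x. (g y * ennreal (A / m)) * indicator (ball y r) x \<partial>\<mu>)"
      proof (rule nn_integral_mono)
        fix x
        obtain k where k: "0 < k" "emeasure \<mu> (ball x r) = ennreal k"
          using ball_emeasure_cases[OF r] by metis
        have "1 / k \<le> A / m" if "dist x y < r"
        proof -
          have "ennreal m \<le> ennreal A * ennreal k"
            using A(2)[of r y x] that r m k by (simp add: dist_commute)
          also have "\<dots> = ennreal (A * k)" using A(1) k(1) by (intro ennreal_mult[symmetric]) auto
          finally have "m \<le> A * k" using A(1) k(1) by (subst (asm) ennreal_le_iff) auto
          then show ?thesis using k(1) m(1) by (simp add: field_simps)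
        qed
        then have "g y / ennreal k \<le> g y * ennreal (A / m)" if "dist x y < r"
          using that k(1) by (auto simp: divide_ennreal_def inverse_ennreal inverse_eq_divide intro!: mult_left_mono ennreal_leI)
        then show "(if dist x y < r then g y / emeasure \<mu> (ball x r) else 0)
          \<le> (g y * ennreal (A / m)) * indicator (ball y r) x"
          by (auto simp: k dist_commute)
      qed
      also have "\<dots> = g y * (ennreal (A / m) * ennreal m)"
        by (subst nn_integral_cmult_indicator) (auto simp: m mult_ac)
      also have "ennreal (A / m) * ennreal m = ennreal A"
        using A m(1) by (subst ennreal_mult[symmetric]) auto
      finally show "(\<integral>\<^sup>+x. (if dist x y < r then g y / emeasure \<mu> (ball x r) else 0) \<partial>\<mu>) \<le> ennreal A * g y"
        by (simp add: mult.commute)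
    qed
    also have "\<dots> = ennreal A * (\<integral>\<^sup>+y. g y \<partial>\<mu>)" by (simp add: nn_integral_cmult)
    finally show "(\<integral>\<^sup>+x. avg g x r \<partial>\<mu>) \<le> ennreal A * (\<integral>\<^sup>+y. g y \<partial>\<mu>)" .
  qed
qed

lemma avg_superlevel_le:
  assumes [measurable]: "g \<in> borel_measurable borel" and "0 < r" "0 < c"
    and A: "(\<integral>\<^sup>+x. avg g x r \<partial>\<mu>) \<le> ennreal A * (\<integral>\<^sup>+y. g y \<partial>\<mu>)" and "0 \<le> A"
  shows "emeasure \<mu> {x. ennreal c < avg g x r} \<le> ennreal (A / c) * (\<integral>\<^sup>+y. g y \<partial>\<mu>)"
proof -
  have "emeasure \<mu> {x. ennreal c < avg g x r} \<le> emeasure \<mu> {x\<in>UNIV. 1 \<le> ennreal (1 / c) * avg g x r}"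
  proof (rule emeasure_mono)
    show "{x. ennreal c < avg g x r} \<subseteq> {x\<in>UNIV. 1 \<le> ennreal (1 / c) * avg g x r}"
    proof (intro subsetI CollectI conjI UNIV_I)
      fix x assume "x \<in> {x. ennreal c < avg g x r}"
      then have "ennreal c < avg g x r" by simp
      then have "ennreal (1 / c) * ennreal c \<le> ennreal (1 / c) * avg g x r"
        by (intro mult_left_mono) auto
      then show "1 \<le> ennreal (1 / c) * avg g x r"
        using assms by (simp add: ennreal_mult[symmetric])
    qed
  qed measurable
  also have "\<dots> \<le> ennreal (1 / c) * (\<integral>\<^sup>+x. avg g x r * indicator UNIV x \<partial>\<mu>)"
    by (rule nn_integral_Markov_inequality) auto
  also have "\<dots> \<le> ennreal (1 / c) * (ennreal A * (\<integral>\<^sup>+y. g y \<partial>\<mu>))"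
    using A by (intro mult_left_mono) auto
  also have "\<dots> = ennreal (A / c) * (\<integral>\<^sup>+y. g y \<partial>\<mu>)"
    using assms by (simp add: mult.assoc[symmetric] ennreal_mult[symmetric])
  finally show ?thesis .
qed

end

section \<open>The truncation estimate for exponents above 1\<close>

lemma nn_integral_truncation_weight:
  fixes \<gamma> p s v :: real
  assumes "\<gamma> \<noteq> 0" "1 < p" "0 < s" "0 < v"
  shows "(\<integral>\<^sup>+t. ennreal (t powr (\<gamma> / p - \<gamma> - 1)) * (if 0 < t \<and> s * t powr (- \<gamma> / p) < v then 1 else 0) \<partial>lborel)
    = ennreal ((v / s) powr (p - 1) / (\<bar>\<gamma>\<bar> * (1 - 1 / p)))"
proof -
  \<comment> \<open>The height at which \<open>s * t powr (- \<gamma> / p)\<close> equals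
    \<open>v\<close>. The admissible heights lie above it if \<gamma> > 0 and below it if \<gamma> <
    0.\<close>
  define T where "T = (v / s) powr (- p / \<gamma>)"
  \<comment> \<open>The weight is \<open>t powr (- a - 1)\<close>, and \<open>a\<close> has the sign
    of \<gamma> because p > 1. So the weight is integrable on the very side of \<open>T\<close> that
    occurs.\<close>
  define a where "a = \<gamma> * (1 - 1 / p)"
  have T: "0 < T" "T powr (- \<gamma> / p) = v / s" "T powr (- a) = (v / s) powr (p - 1)"
    using assms by (auto simp: T_def a_def powr_powr right_diff_distrib)
  have a: "\<gamma> / p - \<gamma> - 1 = - a - 1" "\<bar>a\<bar> = \<bar>\<gamma>\<bar> * (1 - 1 / p)"
    using assms by (simp add: a_def algebra_simps, simp add: a_def abs_mult)
  have iff: "s * t powr (- \<gamma> / p) < v \<longleftrightarrow> t powr (- \<gamma> / p) < T powr (- \<gamma> / p)" for t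
    unfolding T(2) using assms by (simp only: pos_less_divide_eq mult.commute)
  show ?thesis
  proof (cases "0 < \<gamma>")
    case True
    then have ap: "0 < a" using assms by (simp add: a_def)
    have "(0 < t \<and> s * t powr (- \<gamma> / p) < v) = (T < t)" for t
    proof
      assume "0 < t \<and> s * t powr (- \<gamma> / p) < v"
      then have t: "0 < t" "t powr (- \<gamma> / p) < T powr (- \<gamma> / p)" using iff by auto
      show "T < t"
      proof (rule ccontr)
        assume "\<not> T < t"
        then have "T powr (- \<gamma> / p) \<le> t powr (- \<gamma> / p)" using t(1) True assms by (intro powr_mono2') auto
        with t show False by simp
      qed
    next
      assume "T < t"
      then show "0 < t \<and> s * t powr (- \<gamma> / p) < v"
        using T(1) True assms powr_less_mono2_neg[of "- \<gamma> / p" T t] iff by auto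
    qed
    then have "(\<integral>\<^sup>+t. ennreal (t powr (\<gamma> / p - \<gamma> - 1)) * (if 0 < t \<and> s * t powr (- \<gamma> / p) < v then 1 else 0) \<partial>lborel)
      = (\<integral>\<^sup>+t. ennreal (t powr (- a - 1)) * indicator {T<..} t \<partial>lborel)"
      by (intro nn_integral_cong) (auto simp: a indicator_def)
    then show ?thesis using nn_integral_powr_greater[OF ap T(1)] ap by (simp add: T a(2)[symmetric])
  next
    case False
    then have ap: "0 < - a" "\<gamma> < 0" using assms by (auto simp: a_def mult_neg_pos)
    have gp: "0 < - \<gamma> / p" using ap assms by (intro divide_pos_pos) auto
    have "(0 < t \<and> s * t powr (- \<gamma> / p) < v) = (0 < t \<and> t < T)" for t
    proof
      assume "0 < t \<and> s * t powr (- \<gamma> / p) < v"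
      then have t: "0 < t" "t powr (- \<gamma> / p) < T powr (- \<gamma> / p)" using iff by auto
      have "t < T"
      proof (rule ccontr)
        assume "\<not> t < T"
        then have "T powr (- \<gamma> / p) \<le> t powr (- \<gamma> / p)" using T(1) gp by (intro powr_mono2) auto
        with t show False by simp
      qed
      with t show "0 < t \<and> t < T" by simp
    next
      assume "0 < t \<and> t < T"
      then show "0 < t \<and> s * t powr (- \<gamma> / p) < v"
        using gp powr_less_mono2[of "- \<gamma> / p" t T] iff by auto
    qed
    then have "(\<integral>\<^sup>+t. ennreal (t powr (\<gamma> / p - \<gamma> - 1)) * (if 0 < t \<and> s * t powr (- \<gamma> / p) < v then 1 else 0) \<partial>lborel)
      = (\<integral>\<^sup>+t. ennreal (t powr (- a - 1)) * indicator {0<..<T} t \<partial>lborel)"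
      by (intro nn_integral_cong) (auto simp: a indicator_def)
    then show ?thesis using nn_integral_powr_less[OF ap(1), of T] ap T(1) a(2)
      by (simp add: T)
  qed
qed

lemma ennreal_less_powr_mult_iff:
  assumes "0 < t" "0 \<le> s"
  shows "ennreal s < ennreal (t powr a) * X \<longleftrightarrow> ennreal (s * t powr - a) < X"
proof (cases X)
  case (real r)
  have "s < t powr a * r \<longleftrightarrow> s * t powr - a < r"
    using assms by (simp add: powr_minus field_simps)
  then show ?thesis
    using real assms by (simp add: ennreal_mult[symmetric] ennreal_less_iff)
next
  case top
  then show ?thesis using assms by (simp add: ennreal_mult_top)
qed

context doubling_radon
begin

text \<open>The factor \<open>\<kappa>\<close> is 1 for averages and 5 for the Poincare inequality.
  Averaging is bounded on L^1 uniformly in the radius, so enlarging the radius does not affect the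
  argument.\<close>

lemma nu_le_truncation:
  assumes "\<gamma> \<noteq> 0" "1 < p" "0 < \<kappa>"
  obtains A where "0 < A" "\<And>h s S. h \<in> borel_measurable borel \<Longrightarrow> (\<And>y. 0 \<le> h y) \<Longrightarrow> 0 < s \<Longrightarrow>
    (\<And>z. z \<in> S \<Longrightarrow> 0 < snd z \<and>
       ennreal (s * snd z powr (- \<gamma> / p)) < avg (\<lambda>y. ennreal (h y)) (fst z) (\<kappa> * snd z)) \<Longrightarrow>
    ennreal (s powr p) * emeasure (nu_measure \<mu> \<gamma>) S \<le> ennreal A * (\<integral>\<^sup>+y. ennreal (h y powr p) \<partial>\<mu>)"
proof -
  obtain A0 where A0: "0 < A0" "\<And>g r. g \<in> borel_measurable borel \<Longrightarrow> 0 < r \<Longrightarrow>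
    (\<integral>\<^sup>+x. avg g x r \<partial>\<mu>) \<le> ennreal A0 * (\<integral>\<^sup>+y. g y \<partial>\<mu>)"
    using nn_integral_avg_le by blast
  define B where "B = \<bar>\<gamma>\<bar> * (1 - 1 / p)"
  have B: "0 < B" using assms by (simp add: B_def)
  \<comment> \<open>One factor 2 comes from Chebyshev's inequality at half the level,
    \<open>2 powr (p - 1)\<close> from truncating at half the level, and \<open>B\<close> from the
    integral of the weight.\<close>
  define A where "A = A0 * 2 powr p / B"
  show ?thesis
  proof (rule that)
    show "0 < A" using A0 B by (simp add: A_def)
    fix h :: "real ^ 'n \<Rightarrow> real" and s and S :: "((real ^ 'n) \<times> real) set"
    assume h [measurable]: "h \<in> borel_measurable borel" and hp: "\<And>y. 0 \<le> h y" and s: "0 < s"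
      and S: "\<And>z. z \<in> S \<Longrightarrow> 0 < snd z \<and>
       ennreal (s * snd z powr (- \<gamma> / p)) < avg (\<lambda>y. ennreal (h y)) (fst z) (\<kappa> * snd z)"
    \<comment> \<open>Half the level at height t. Values of \<open>h\<close> up to
      \<open>c t\<close> contribute at most \<open>c t\<close> to the average, so the part
      \<open>g t\<close> above it must contribute more than the other half.\<close>
    define c where "c t = s * t powr (- \<gamma> / p) / 2" for t
    have c_meas [measurable]: "c \<in> borel_measurable borel" unfolding c_def by measurable
    have cp: "0 < c t" if "0 < t" for t using that s by (simp add: c_def)
    define g where "g t y = (if c t < h y then ennreal (h y) else 0)" for t y
    have g_meas [measurable]: "g t \<in> borel_measurable borel" for t unfolding g_def by measurable
    \<comment> \<open>A measurable set containing \<open>S\<close>: the superlevel set of the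
      averages of the truncated functions.\<close>
    define T where "T = {z. 0 < snd z \<and> ennreal (c (snd z)) < avg (g (snd z)) (fst z) (\<kappa> * snd z)}"
    have [measurable]: "(\<lambda>z. avg (g (snd z)) (fst z) (\<kappa> * snd z)) \<in> borel_measurable (borel \<Otimes>\<^sub>M borel)"
      by (rule borel_measurable_avg_param) (unfold g_def, measurable)
    have T: "T \<in> sets (borel \<Otimes>\<^sub>M borel)"
    proof -
      have "{z \<in> space (borel \<Otimes>\<^sub>M borel). 0 < snd z \<and> ennreal (c (snd z)) < avg (g (snd z)) (fst z) (\<kappa> * snd z)}
        \<in> sets (borel \<Otimes>\<^sub>M borel)" by measurable
      then show ?thesis by (simp add: T_def space_pair_measure)
    qed
    have "S \<subseteq> T"
    proof
      fix z assume z: "z \<in> S"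
      define x t r where "x = fst z" and "t = snd z" and "r = \<kappa> * t"
      have t: "0 < t" "ennreal (s * t powr (- \<gamma> / p)) < avg (\<lambda>y. ennreal (h y)) x r"
        using S[OF z] by (auto simp: x_def t_def r_def)
      have r: "0 < r" using t assms by (simp add: r_def)
      obtain m where m: "0 < m" "emeasure \<mu> (ball x r) = ennreal m"
        using ball_emeasure_cases[OF r] by metis
      have "(\<integral>\<^sup>+y\<in>ball x r. ennreal (h y) \<partial>\<mu>) \<le> (\<integral>\<^sup>+y. ennreal (c t) * indicator (ball x r) y + g t y * indicator (ball x r) y \<partial>\<mu>)"
        using cp[OF t(1)] hp by (intro nn_integral_mono) (auto simp: g_def indicator_def ennreal_leI)
      also have "\<dots> = ennreal (c t) * ennreal m + (\<integral>\<^sup>+y\<in>ball x r. g t y \<partial>\<mu>)"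
      proof -
        have [measurable]: "ball x r \<in> sets borel" by simp
        have "(\<lambda>y. ennreal (c t) * indicator (ball x r) y) \<in> borel_measurable borel"
          "(\<lambda>y. g t y * indicator (ball x r) y) \<in> borel_measurable borel"
          unfolding g_def by measurable
        then show ?thesis
          by (subst nn_integral_add) (simp_all add: nn_integral_cmult_indicator m)
      qed
      finally have "avg (\<lambda>y. ennreal (h y)) x r \<le> (ennreal (c t) * ennreal m + (\<integral>\<^sup>+y\<in>ball x r. g t y \<partial>\<mu>)) / ennreal m"
        unfolding avg_def m(2) by (intro divide_right_mono_ennreal)
      also have "\<dots> = ennreal (c t) * ennreal m / ennreal m + avg (g t) x r"
        unfolding avg_def m(2) by (rule add_divide_distrib_ennreal)
      also have "ennreal (c t) * ennreal m / ennreal m = ennreal (c t)"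
        using m(1) cp[OF t(1)] by (simp add: ennreal_mult[symmetric] divide_ennreal)
      finally have "ennreal (s * t powr (- \<gamma> / p)) < ennreal (c t) + avg (g t) x r"
        using t(2) by simp
      moreover have "ennreal (s * t powr (- \<gamma> / p)) = ennreal (c t) + ennreal (c t)"
        using cp[OF t(1)] by (subst ennreal_plus[symmetric]) (auto simp: c_def)
      ultimately have "ennreal (c t) < avg (g t) x r"
        by (simp add: ennreal_add_left_cancel_less)
      then show "z \<in> T" using t(1) by (simp add: T_def x_def t_def r_def)
    qed
    then have "emeasure (nu_measure \<mu> \<gamma>) S \<le> emeasure (nu_measure \<mu> \<gamma>) T"
      using T by (intro emeasure_mono) auto
    also have "\<dots> = (\<integral>\<^sup>+t. ennreal (t powr - (1 + \<gamma>)) * indicator {0<..} t * emeasure \<mu> {x. (x, t) \<in> T} \<partial>lborel)"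
      by (rule emeasure_nu(2)[OF T])
    also have "\<dots> \<le> (\<integral>\<^sup>+t. (\<integral>\<^sup>+y. ennreal (2 * A0 / s) * (ennreal (h y) * (ennreal (t powr (\<gamma> / p - \<gamma> - 1)) *
          (if 0 < t \<and> s / 2 * t powr (- \<gamma> / p) < h y then 1 else 0))) \<partial>\<mu>) \<partial>lborel)"
    proof (rule nn_integral_mono)
      fix t :: real
      show "ennreal (t powr - (1 + \<gamma>)) * indicator {0<..} t * emeasure \<mu> {x. (x, t) \<in> T}
        \<le> (\<integral>\<^sup>+y. ennreal (2 * A0 / s) * (ennreal (h y) * (ennreal (t powr (\<gamma> / p - \<gamma> - 1)) *
          (if 0 < t \<and> s / 2 * t powr (- \<gamma> / p) < h y then 1 else 0))) \<partial>\<mu>)"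
      proof (cases "0 < t")
        case True
        have "emeasure \<mu> {x. (x, t) \<in> T} = emeasure \<mu> {x. ennreal (c t) < avg (g t) x (\<kappa> * t)}"
          using True by (simp add: T_def)
        also have "\<dots> \<le> ennreal (A0 / c t) * (\<integral>\<^sup>+y. g t y \<partial>\<mu>)"
          using True assms A0 cp by (intro avg_superlevel_le) auto
        finally have "ennreal (t powr - (1 + \<gamma>)) * emeasure \<mu> {x. (x, t) \<in> T}
          \<le> ennreal (t powr - (1 + \<gamma>)) * (ennreal (A0 / c t) * (\<integral>\<^sup>+y. g t y \<partial>\<mu>))"
          by (intro mult_left_mono) auto
        also have "\<dots> = ennreal (t powr - (1 + \<gamma>) * (A0 / c t)) * (\<integral>\<^sup>+y. g t y \<partial>\<mu>)"
          using A0(1) cp[OF True] by (subst ennreal_mult) (auto simp: mult.assoc)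
        also have "t powr - (1 + \<gamma>) * (A0 / c t) = 2 * A0 / s * t powr (\<gamma> / p - \<gamma> - 1)"
          using True s by (simp add: c_def powr_diff powr_minus powr_add field_simps)
        also have "ennreal (2 * A0 / s * t powr (\<gamma> / p - \<gamma> - 1)) * (\<integral>\<^sup>+y. g t y \<partial>\<mu>)
          = (\<integral>\<^sup>+y. ennreal (2 * A0 / s * t powr (\<gamma> / p - \<gamma> - 1)) * g t y \<partial>\<mu>)"
          by (simp add: nn_integral_cmult)
        also have "\<dots> = (\<integral>\<^sup>+y. ennreal (2 * A0 / s) * (ennreal (h y) * (ennreal (t powr (\<gamma> / p - \<gamma> - 1)) *
          (if 0 < t \<and> s / 2 * t powr (- \<gamma> / p) < h y then 1 else 0))) \<partial>\<mu>)"
        proof -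
          have "ennreal (2 * A0 / s * t powr (\<gamma> / p - \<gamma> - 1)) = ennreal (2 * A0 / s) * ennreal (t powr (\<gamma> / p - \<gamma> - 1))"
            using A0(1) s by (intro ennreal_mult) auto
          then show ?thesis
            using True by (intro nn_integral_cong) (auto simp: g_def c_def mult.assoc mult.left_commute mult.commute)
        qed
        finally show ?thesis using True by simp
      qed auto
    qed
    also have "\<dots> = (\<integral>\<^sup>+y. (\<integral>\<^sup>+t. ennreal (2 * A0 / s) * (ennreal (h y) * (ennreal (t powr (\<gamma> / p - \<gamma> - 1)) *
          (if 0 < t \<and> s / 2 * t powr (- \<gamma> / p) < h y then 1 else 0))) \<partial>lborel) \<partial>\<mu>)"
      by (rule Fubini') (simp cong: sets_pair_measure_cong measurable_cong_sets)
    also have "\<dots> = (\<integral>\<^sup>+y. ennreal (A / s powr p) * ennreal (h y powr p) \<partial>\<mu>)"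
    proof (rule nn_integral_cong)
      fix y
      let ?J = "\<integral>\<^sup>+t. ennreal (t powr (\<gamma> / p - \<gamma> - 1)) * (if 0 < t \<and> s / 2 * t powr (- \<gamma> / p) < h y then 1 else 0) \<partial>lborel"
      have "(\<integral>\<^sup>+t. ennreal (2 * A0 / s) * (ennreal (h y) * (ennreal (t powr (\<gamma> / p - \<gamma> - 1)) *
          (if 0 < t \<and> s / 2 * t powr (- \<gamma> / p) < h y then 1 else 0))) \<partial>lborel)
          = ennreal (2 * A0 / s) * (ennreal (h y) * ?J)"
        by (simp add: nn_integral_cmult)
      also have "\<dots> = ennreal (A / s powr p) * ennreal (h y powr p)"
      proof (cases "h y = 0")
        case False
        with hp[of y] have v: "0 < h y" by simp
        have J: "?J = ennreal ((h y / (s / 2)) powr (p - 1) / B)"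
          unfolding B_def using assms s v by (intro nn_integral_truncation_weight) auto
        have "2 * A0 / s * (h y * ((h y / (s / 2)) powr (p - 1) / B)) = A / s powr p * h y powr p"
          using v s B by (simp add: A_def powr_diff powr_divide powr_mult field_simps)
        then show ?thesis using A0(1) s v B \<open>0 < A\<close> unfolding J
          by (simp add: ennreal_mult[symmetric])
      qed auto
      finally show "(\<integral>\<^sup>+t. ennreal (2 * A0 / s) * (ennreal (h y) * (ennreal (t powr (\<gamma> / p - \<gamma> - 1)) *
          (if 0 < t \<and> s / 2 * t powr (- \<gamma> / p) < h y then 1 else 0))) \<partial>lborel)
        = ennreal (A / s powr p) * ennreal (h y powr p)" .
    qed
    also have "\<dots> = ennreal (A / s powr p) * (\<integral>\<^sup>+y. ennreal (h y powr p) \<partial>\<mu>)"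
      by (simp add: nn_integral_cmult)
    finally have "ennreal (s powr p) * emeasure (nu_measure \<mu> \<gamma>) S
      \<le> ennreal (s powr p) * (ennreal (A / s powr p) * (\<integral>\<^sup>+y. ennreal (h y powr p) \<partial>\<mu>))"
      by (intro mult_left_mono) auto
    also have "\<dots> = ennreal A * (\<integral>\<^sup>+y. ennreal (h y powr p) \<partial>\<mu>)"
      using s \<open>0 < A\<close> by (simp add: mult.assoc[symmetric] ennreal_mult[symmetric])
    finally show "ennreal (s powr p) * emeasure (nu_measure \<mu> \<gamma>) S \<le> ennreal A * (\<integral>\<^sup>+y. ennreal (h y powr p) \<partial>\<mu>)" .
  qed
qed

text \<open>The ball contains the dyadic cube through its centre once the side is small enough,
  which gives the lower bound. No single dyadic cube need contain the ball, so the upper bound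
  compares it by doubling with a ball inside that cube.\<close>

lemma dyadic_regular_ball:
  assumes "dyadic_regular \<mu> d" "0 < d"
  obtains a1 a2 where "0 < a1" "0 < a2"
    "\<And>x t. 0 < t \<Longrightarrow> ennreal (a1 * t powr d) \<le> emeasure \<mu> (ball x t)"
    "\<And>x t. 0 < t \<Longrightarrow> emeasure \<mu> (ball x t) \<le> ennreal (a2 * t powr d)"
proof -
  obtain c1 c2 where c: "0 < c1" "0 < c2"
     "\<And>k j. ennreal (c1 * (2 powi k) powr d) \<le> emeasure \<mu> (dyadic_cube k j)"
     "\<And>k j. emeasure \<mu> (dyadic_cube k j) \<le> ennreal (c2 * (2 powi k) powr d)"
    using assms(1) unfolding dyadic_regular_def by blast
  define n where "n = real CARD('n)"
  have n: "1 \<le> n" using zero_less_card_finite[where 'a='n] by (simp add: n_def)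
  obtain A where A: "A \<ge> 1" "\<And>x y r. 0 < r \<Longrightarrow> dist x y \<le> (4 * n) * r \<Longrightarrow>
    emeasure \<mu> (ball x ((4 * n) * r)) \<le> ennreal A * emeasure \<mu> (ball y r)"
    using ball_growth[of "4 * n"] by blast
  have key: "\<exists>l. 0 < l \<and> n * l < t \<and> t \<le> 2 * n * l \<and> ennreal (c1 * l powr d) \<le> emeasure \<mu> (ball x t) \<and>
      emeasure \<mu> (ball x t) \<le> ennreal (A * (c2 * l powr d))" if t: "0 < t" for x t
  proof -
    \<comment> \<open>The largest \<open>k\<close> with \<open>n * 2 powi k < t\<close>. Taking the
      ceiling minus one keeps this strict, so that the cube, of diameter at most
      \<open>n * l\<close>, fits into the open ball.\<close>
    define k where "k = \<lceil>log 2 (t / n)\<rceil> - 1"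
    define l :: real where "l = 2 powi k"
    have l: "l = 2 powr real_of_int k" by (simp add: l_def powr_real_of_int')
    have lp: "0 < l" by (simp add: l_def)
    have tn: "0 < t / n" using t n by simp
    have "real_of_int k < log 2 (t / n)" "log 2 (t / n) \<le> real_of_int k + 1" unfolding k_def by linarith+
    then have "l < t / n" "t / n \<le> 2 powr (real_of_int k + 1)"
      unfolding l using tn by (auto simp: less_log_iff log_le_iff)
    then have lt: "n * l < t" "t \<le> 2 * n * l" using n by (auto simp: l powr_add field_simps)
    define j where "j i = \<lfloor>x $ i / l\<rfloor>" for i
    let ?Q = "dyadic_cube k j"
    have Q: "y \<in> ?Q \<longleftrightarrow> (\<forall>i. of_int (j i) * l \<le> y $ i \<and> y $ i < (of_int (j i) + 1) * l)" for y
      by (simp add: dyadic_cube_def half_open_cube_def l_def[symmetric] algebra_simps)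
    have xQ: "x \<in> ?Q"
      unfolding Q
    proof
      fix i
      have "of_int (j i) \<le> x $ i / l" "x $ i / l < of_int (j i) + 1" unfolding j_def by linarith+
      then show "of_int (j i) * l \<le> x $ i \<and> x $ i < (of_int (j i) + 1) * l"
        using lp by (simp add: pos_le_divide_eq pos_divide_less_eq)
    qed
    have close: "dist x y < t" if "y \<in> ?Q" for y
    proof -
      have "dist x y \<le> (\<Sum>i\<in>UNIV. \<bar>(x - y) $ i\<bar>)" unfolding dist_norm by (rule norm_le_l1_cart)
      also have "\<dots> \<le> (\<Sum>i\<in>(UNIV::'n set). l)"
      proof (rule sum_mono)
        fix i
        show "\<bar>(x - y) $ i\<bar> \<le> l"
          using xQ[unfolded Q, rule_format, of i] that[unfolded Q, rule_format, of i]
          by (simp add: distrib_right abs_le_iff)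
      qed
      also have "\<dots> = n * l" by (simp add: n_def)
      finally show ?thesis using lt by simp
    qed
    then have sub: "?Q \<subseteq> ball x t" by auto
    \<comment> \<open>The centre of the cube. Dilating its inscribed ball, of radius
      \<open>l / 2\<close>, by \<open>4 * n\<close> reaches radius \<open>2 * n * l\<close>, which
      is at least \<open>t\<close>.\<close>
    define y :: "real ^ 'n" where "y = (\<chi> i. (of_int (j i) + 1 / 2) * l)"
    have yQ: "y \<in> ?Q" unfolding Q y_def using lp by (auto simp: algebra_simps)
    have sub2: "ball y (l / 2) \<subseteq> ?Q"
    proof
      fix w assume "w \<in> ball y (l / 2)"
      then have "\<bar>(w - y) $ i\<bar> < l / 2" for i
        using component_le_norm_cart[of "w - y" i] by (auto simp: dist_norm norm_minus_commute)
      then have w: "\<bar>w $ i - (of_int (j i) + 1 / 2) * l\<bar> < l / 2" for i by (simp add: y_def)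
      show "w \<in> ?Q" unfolding Q
      proof
        fix i
        show "of_int (j i) * l \<le> w $ i \<and> w $ i < (of_int (j i) + 1) * l"
          using w[of i] unfolding distrib_right by (simp add: abs_if split: if_splits)
      qed
    qed
    have Qm: "?Q \<in> sets \<mu>"
    proof -
      have "?Q = (\<Inter>i. {y. of_int (j i) * l \<le> y $ i} \<inter> {y. y $ i < (of_int (j i) + 1) * l})"
        using Q by auto
      then show ?thesis by simp
    qed
    have "ennreal (c1 * l powr d) \<le> emeasure \<mu> ?Q" using c(3)[of k j] by (simp add: l_def)
    also have "\<dots> \<le> emeasure \<mu> (ball x t)" using sub by (intro emeasure_mono) auto
    finally have lower: "ennreal (c1 * l powr d) \<le> emeasure \<mu> (ball x t)" .
    have "emeasure \<mu> (ball x t) \<le> emeasure \<mu> (ball x ((4 * n) * (l / 2)))"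
      using lt by (intro emeasure_mono subset_ball) (auto simp: mult_ac)
    also have "\<dots> \<le> ennreal A * emeasure \<mu> (ball y (l / 2))"
      using lp lt close[OF yQ] by (intro A(2)) (auto simp: mult_ac)
    also have "\<dots> \<le> ennreal A * emeasure \<mu> ?Q"
      using sub2 Qm by (intro mult_left_mono emeasure_mono) auto
    also have "\<dots> \<le> ennreal A * ennreal (c2 * l powr d)"
      using c(4)[of k j] by (intro mult_left_mono) (auto simp: l_def)
    finally have "emeasure \<mu> (ball x t) \<le> ennreal (A * (c2 * l powr d))"
      using A(1) c by (simp add: ennreal_mult)
    with lower lp lt show ?thesis by blast
  qed
  show ?thesis
  proof (rule that)
    show "0 < c1 * (1 / (2 * n)) powr d" "0 < A * c2" using c n A by auto
    fix x :: "real ^ 'n" and t :: real assume t: "0 < t"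
    obtain l where l: "0 < l" "n * l < t" "t \<le> 2 * n * l" "ennreal (c1 * l powr d) \<le> emeasure \<mu> (ball x t)"
      "emeasure \<mu> (ball x t) \<le> ennreal (A * (c2 * l powr d))" using key[OF t] by blast
    have "(1 / (2 * n) * t) powr d \<le> l powr d"
      using l n assms t by (intro powr_mono2) (auto simp: field_simps)
    then have "(1 / (2 * n)) powr d * t powr d \<le> l powr d" using n t by (simp add: powr_mult[symmetric])
    then have "c1 * (1 / (2 * n)) powr d * t powr d \<le> c1 * l powr d"
      using c by (simp add: mult.assoc)
    then show "ennreal (c1 * (1 / (2 * n)) powr d * t powr d) \<le> emeasure \<mu> (ball x t)"
      using l(4) by (meson ennreal_leI order_trans)
    have "1 * l \<le> n * l" using n l(1) by (intro mult_right_mono) auto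
    then have "l \<le> t" using l(2) by simp
    then have "l powr d \<le> t powr d" using l assms by (intro powr_mono2) auto
    then have "A * (c2 * l powr d) \<le> A * c2 * t powr d" using A c by simp
    then show "emeasure \<mu> (ball x t) \<le> ennreal (A * c2 * t powr d)"
      using l(5) by (meson ennreal_leI order_trans)
  qed
qed


text \<open>Integrals over balls ignore null sets, so a nonnegative Borel representative
  \<open>h\<close> gives the same \<open>a_fun\<close> at every point of the half-space, not just
  almost everywhere. After this, the argument uses only extended nonnegative integrals over
  \<mu>.\<close>

lemma a_fun_representative:
  assumes f: "locally_integrable (completion \<mu>) f" "AE x in \<mu>. 0 \<le> f x"
  obtains h where "h \<in> borel_measurable borel" "\<And>y. 0 \<le> h y"
    "\<And>\<gamma> p x t. 0 < t \<Longrightarrow> 0 \<le> a_fun \<mu> \<gamma> p f (x, t)"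
    "\<And>\<gamma> p x t. 0 < t \<Longrightarrow> ennreal (a_fun \<mu> \<gamma> p f (x, t)) = ennreal (t powr (\<gamma> / p)) * avg (\<lambda>y. ennreal (h y)) x t"
    "\<And>p. Lp_norm (completion \<mu>) p f = enn_powr (\<integral>\<^sup>+y. ennreal (h y powr p) \<partial>\<mu>) (1 / p)"
proof -
  have "f \<in> borel_measurable (completion \<mu>)" using f(1) by (simp add: locally_integrable_def)
  then obtain g where g: "g \<in> borel_measurable \<mu>" "AE x in \<mu>. f x = g x"
    using completion_ex_borel_measurable_real by blast
  define h where "h x = max 0 (g x)" for x
  have h [measurable]: "h \<in> borel_measurable borel" using g(1) unfolding h_def by simp
  have h0: "0 \<le> h y" for y by (simp add: h_def)
  have fh: "AE x in \<mu>. f x = h x" using g(2) f(2) by eventually_elim (simp add: h_def)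
  have fin: "set_integrable \<mu> K h \<and> (LINT y:K|completion \<mu>. f y) = (LINT y:K|\<mu>. h y)"
    if K: "bounded K" "K \<in> sets borel" for K
  proof -
    have "set_integrable (completion \<mu>) (closure K) f"
      using f(1) K(1) by (simp add: locally_integrable_def compact_closure)
    then have i1: "set_integrable (completion \<mu>) K f"
      by (rule set_integrable_subset) (use K in \<open>auto intro: closure_subset[THEN subsetD]\<close>)
    have [measurable]: "K \<in> sets borel" by (rule K)
    have hm: "(\<lambda>y. indicator K y *\<^sub>R h y) \<in> borel_measurable \<mu>" by simp
    have ae: "AE y in completion \<mu>. indicator K y *\<^sub>R f y = indicator K y *\<^sub>R h y"
      using AE_completion[OF fh] by eventually_elim simp
    have hm': "(\<lambda>y. indicator K y *\<^sub>R h y) \<in> borel_measurable (completion \<mu>)"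
      using hm by (rule measurable_completion)
    have "integrable (completion \<mu>) (\<lambda>y. indicator K y *\<^sub>R h y)"
      using i1 ae hm' unfolding set_integrable_def by (subst integrable_cong_AE[symmetric]) auto
    then have "set_integrable \<mu> K h"
      unfolding set_integrable_def by (subst (asm) integrable_completion[OF hm])
    moreover have "(LINT y:K|completion \<mu>. f y) = (\<integral>y. indicator K y *\<^sub>R h y \<partial>completion \<mu>)"
      unfolding set_lebesgue_integral_def
      by (rule integral_cong_AE) (use i1 ae hm' in \<open>auto simp: set_integrable_def\<close>)
    ultimately show ?thesis
      using integral_completion[OF hm] unfolding set_lebesgue_integral_def by metis
  qed
  have nn: "(\<integral>\<^sup>+y\<in>K. ennreal (h y) \<partial>\<mu>) = ennreal (LINT y:K|\<mu>. h y)"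
    if K: "bounded K" "K \<in> sets borel" for K
  proof -
    have "(\<integral>\<^sup>+y. ennreal (indicator K y *\<^sub>R h y) \<partial>\<mu>) = ennreal (\<integral>y. indicator K y *\<^sub>R h y \<partial>\<mu>)"
      using fin[OF K] h0 unfolding set_integrable_def by (intro nn_integral_eq_integral) auto
    moreover have "(\<integral>\<^sup>+y\<in>K. ennreal (h y) \<partial>\<mu>) = (\<integral>\<^sup>+y. ennreal (indicator K y *\<^sub>R h y) \<partial>\<mu>)"
      by (intro nn_integral_cong) (auto simp: indicator_def)
    ultimately show ?thesis by (simp add: set_lebesgue_integral_def)
  qed
  have int0: "0 \<le> (LINT y:K|\<mu>. h y)" for K
    unfolding set_lebesgue_integral_def using h0 by (intro integral_nonneg_AE) auto
  have mean: "mean (completion \<mu>) f (ball x t) = (LINT y:ball x t|\<mu>. h y) / measure \<mu> (ball x t)" for x t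
    using fin[of "ball x t"] by (simp add: mean_def)
  show ?thesis
  proof (rule that[of h])
    show "0 \<le> a_fun \<mu> \<gamma> p f (x, t)" for \<gamma> p x t
      by (simp add: a_fun_def mean int0)
    show "ennreal (a_fun \<mu> \<gamma> p f (x, t)) = ennreal (t powr (\<gamma> / p)) * avg (\<lambda>y. ennreal (h y)) x t"
      if t: "0 < t" for \<gamma> p x t
    proof -
      obtain m where m: "0 < m" "emeasure \<mu> (ball x t) = ennreal m" "measure \<mu> (ball x t) = m"
        using ball_emeasure_cases[OF t] by metis
      have "avg (\<lambda>y. ennreal (h y)) x t = ennreal ((LINT y:ball x t|\<mu>. h y) / m)"
        unfolding avg_def m(2) using m(1) int0 by (subst nn) (auto simp: divide_ennreal)
      moreover have "ennreal (t powr (\<gamma> / p) * ((LINT y:ball x t|\<mu>. h y) / m))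
        = ennreal (t powr (\<gamma> / p)) * ennreal ((LINT y:ball x t|\<mu>. h y) / m)"
        using m(1) int0 by (intro ennreal_mult) auto
      ultimately show ?thesis by (simp add: a_fun_def mean m(3))
    qed
    show "Lp_norm (completion \<mu>) p f = enn_powr (\<integral>\<^sup>+y. ennreal (h y powr p) \<partial>\<mu>) (1 / p)" for p
    proof -
      have "(\<integral>\<^sup>+ x. ennreal (norm (f x) powr p) \<partial>completion \<mu>) = (\<integral>\<^sup>+y. ennreal (h y powr p) \<partial>\<mu>)"
        unfolding nn_integral_completion
      proof (rule nn_integral_cong_AE)
        show "AE x in \<mu>. ennreal (norm (f x) powr p) = ennreal (h x powr p)"
          using fh by eventually_elim (use h0 in auto)
      qed
      then show ?thesis by (simp add: Lp_norm_def)
    qed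
  qed (fact h h0)+
qed

text \<open>All cases with p > 1, regular or not, are covered by truncation. For p = 1 the level
  condition on a ball bounds \<open>emeasure \<mu> (ball x t) * t powr - \<gamma>\<close> by the
  integral over that ball divided by \<open>s\<close>, and disjoint balls add up.\<close>

lemma distr_term_a_fun_le:
  assumes "\<gamma> < 0 \<or> (\<exists>d. 0 < d \<and> d < \<gamma> \<and> dyadic_regular \<mu> d) \<or> (0 < \<gamma> \<and> 1 < p)" "1 \<le> p"
  obtains A where "0 < A" "\<And>h s S. h \<in> borel_measurable borel \<Longrightarrow> (\<And>y. 0 \<le> h y) \<Longrightarrow> 0 < s \<Longrightarrow>
    (\<And>z. z \<in> S \<Longrightarrow> 0 < snd z \<and>
       ennreal (s * snd z powr (- \<gamma> / p)) < avg (\<lambda>y. ennreal (h y)) (fst z) (snd z)) \<Longrightarrow>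
    ennreal (s powr p) * emeasure (nu_measure \<mu> \<gamma>) S \<le> ennreal A * (\<integral>\<^sup>+y. ennreal (h y powr p) \<partial>\<mu>)"
proof (cases "1 < p")
  case True
  from assms True have "\<gamma> \<noteq> 0" by auto
  show ?thesis
    using nu_le_truncation[OF \<open>\<gamma> \<noteq> 0\<close> True zero_less_one, unfolded mult_1] that by blast
next
  case False
  with assms have p: "p = 1" by simp
  \<comment> \<open>The constant \<open>a\<close> unifies the two coverings: it is 1 for \<gamma> <
    0, and in the regular case the inverse of the lower regularity constant, which turns
    \<open>t powr (d - \<gamma>)\<close> into a multiple of ball measure times
    \<open>t powr - \<gamma>\<close>.\<close>
  obtain A a where A: "0 < A" "0 < a" and main: "\<And>S M. (\<And>z. z \<in> S \<Longrightarrow> 0 < snd z) \<Longrightarrow>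
     (\<And>F. finite F \<Longrightarrow> F \<subseteq> S \<Longrightarrow> disjoint_cballs 1 F \<Longrightarrow>
        (\<Sum>z\<in>F. ennreal a * (emeasure \<mu> (ball (fst z) (snd z)) * ennreal (snd z powr - \<gamma>))) \<le> M) \<Longrightarrow>
     emeasure (nu_measure \<mu> \<gamma>) S \<le> ennreal A * M"
  proof (cases "\<gamma> < 0")
    case True
    obtain A where "0 < A" "\<And>S M. (\<And>z. z \<in> S \<Longrightarrow> 0 < snd z) \<Longrightarrow>
     (\<And>F. finite F \<Longrightarrow> F \<subseteq> S \<Longrightarrow> disjoint_cballs 1 F \<Longrightarrow>
        (\<Sum>z\<in>F. emeasure \<mu> (ball (fst z) (snd z)) * ennreal (snd z powr - \<gamma>)) \<le> M) \<Longrightarrow>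
     emeasure (nu_measure \<mu> \<gamma>) S \<le> ennreal A * M"
      using nu_le_neg[OF True zero_less_one] by blast
    then show ?thesis by (intro that[of A 1]) auto
  next
    case False
    with assms p obtain d where d: "0 < d" "d < \<gamma>" "dyadic_regular \<mu> d" by auto
    obtain a1 a2 where a: "0 < a1" "0 < a2"
      "\<And>x t. 0 < t \<Longrightarrow> ennreal (a1 * t powr d) \<le> emeasure \<mu> (ball x t)"
      "\<And>x t. 0 < t \<Longrightarrow> emeasure \<mu> (ball x t) \<le> ennreal (a2 * t powr d)"
      using dyadic_regular_ball[OF d(3,1)] by metis
    obtain A where A: "0 < A" "\<And>S M. (\<And>z. z \<in> S \<Longrightarrow> 0 < snd z) \<Longrightarrow>
     (\<And>F. finite F \<Longrightarrow> F \<subseteq> S \<Longrightarrow> disjoint_cballs 1 F \<Longrightarrow>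
        (\<Sum>z\<in>F. ennreal (snd z powr (d - \<gamma>))) \<le> M) \<Longrightarrow>
     emeasure (nu_measure \<mu> \<gamma>) S \<le> ennreal A * M"
      using nu_le_pos[OF d(1,2) zero_less_one a(2) a(4)] by blast
    show ?thesis
    proof (rule that[of A "1 / a1"])
      fix S :: "((real ^ 'n) \<times> real) set" and M
      assume S: "\<And>z. z \<in> S \<Longrightarrow> 0 < snd z"
        and M: "\<And>F. finite F \<Longrightarrow> F \<subseteq> S \<Longrightarrow> disjoint_cballs 1 F \<Longrightarrow>
        (\<Sum>z\<in>F. ennreal (1 / a1) * (emeasure \<mu> (ball (fst z) (snd z)) * ennreal (snd z powr - \<gamma>))) \<le> M"
      show "emeasure (nu_measure \<mu> \<gamma>) S \<le> ennreal A * M"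
      proof (rule A(2)[OF S])
        fix F assume F: "finite F" "F \<subseteq> S" "disjoint_cballs 1 F"
        have "(\<Sum>z\<in>F. ennreal (snd z powr (d - \<gamma>)))
          \<le> (\<Sum>z\<in>F. ennreal (1 / a1) * (emeasure \<mu> (ball (fst z) (snd z)) * ennreal (snd z powr - \<gamma>)))"
        proof (rule sum_mono)
          fix z assume "z \<in> F"
          then have t: "0 < snd z" using F(2) S[of z] by blast
          have "ennreal (snd z powr (d - \<gamma>)) = ennreal (1 / a1) * (ennreal (a1 * snd z powr d) * ennreal (snd z powr - \<gamma>))"
            using a(1) t by (simp add: ennreal_mult[symmetric] powr_diff powr_minus field_simps)
          also have "\<dots> \<le> ennreal (1 / a1) * (emeasure \<mu> (ball (fst z) (snd z)) * ennreal (snd z powr - \<gamma>))"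
            using a(3)[OF t] by (intro mult_left_mono mult_right_mono) auto
          finally show "ennreal (snd z powr (d - \<gamma>)) \<le> ennreal (1 / a1) * (emeasure \<mu> (ball (fst z) (snd z)) * ennreal (snd z powr - \<gamma>))" .
        qed
        also have "\<dots> \<le> M" by (rule M[OF F])
        finally show "(\<Sum>z\<in>F. ennreal (snd z powr (d - \<gamma>))) \<le> M" .
      qed auto
    qed (use A a in auto)
  qed
  show ?thesis
  proof (rule that)
    show "0 < A * a" using A by simp
    fix h :: "real ^ 'n \<Rightarrow> real" and s and S :: "((real ^ 'n) \<times> real) set"
    assume h [measurable]: "h \<in> borel_measurable borel" and hp: "\<And>y. 0 \<le> h y" and s: "0 < s"
      and S: "\<And>z. z \<in> S \<Longrightarrow> 0 < snd z \<and>
       ennreal (s * snd z powr (- \<gamma> / p)) < avg (\<lambda>y. ennreal (h y)) (fst z) (snd z)"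
    have "emeasure (nu_measure \<mu> \<gamma>) S \<le> ennreal A * (ennreal (a / s) * (\<integral>\<^sup>+y. ennreal (h y) \<partial>\<mu>))"
    proof (rule main)
      fix F assume F: "finite F" "F \<subseteq> S" "disjoint_cballs 1 F"
      have "(\<Sum>z\<in>F. ennreal a * (emeasure \<mu> (ball (fst z) (snd z)) * ennreal (snd z powr - \<gamma>)))
        \<le> (\<Sum>z\<in>F. ennreal (a / s) * (\<integral>\<^sup>+y\<in>ball (fst z) (snd z). ennreal (h y) \<partial>\<mu>))"
      proof (rule sum_mono)
        fix z assume "z \<in> F"
        then have z: "0 < snd z" "ennreal (s * snd z powr (- \<gamma> / p)) < avg (\<lambda>y. ennreal (h y)) (fst z) (snd z)"
          using F(2) S[of z] by blast+
        have "ennreal a * (emeasure \<mu> (ball (fst z) (snd z)) * ennreal (snd z powr - \<gamma>))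
          = ennreal (a / s) * (ennreal (s * snd z powr (- \<gamma> / p)) * emeasure \<mu> (ball (fst z) (snd z)))"
        proof -
          have "ennreal a * ennreal (snd z powr - \<gamma>) = ennreal (a / s) * ennreal (s * snd z powr (- \<gamma> / p))"
            using A(2) s by (simp add: ennreal_mult[symmetric] p)
          then have "(ennreal a * ennreal (snd z powr - \<gamma>)) * emeasure \<mu> (ball (fst z) (snd z))
            = (ennreal (a / s) * ennreal (s * snd z powr (- \<gamma> / p))) * emeasure \<mu> (ball (fst z) (snd z))"
            by simp
          then show ?thesis by (simp only: mult_ac)
        qed
        also have "\<dots> \<le> ennreal (a / s) * (\<integral>\<^sup>+y\<in>ball (fst z) (snd z). ennreal (h y) \<partial>\<mu>)"
          using avg_greater_imp[OF z(2,1)] by (intro mult_left_mono) auto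
        finally show "ennreal a * (emeasure \<mu> (ball (fst z) (snd z)) * ennreal (snd z powr - \<gamma>))
          \<le> ennreal (a / s) * (\<integral>\<^sup>+y\<in>ball (fst z) (snd z). ennreal (h y) \<partial>\<mu>)" .
      qed
      also have "\<dots> = ennreal (a / s) * (\<Sum>z\<in>F. (\<integral>\<^sup>+y\<in>ball (fst z) (snd z). ennreal (h y) \<partial>\<mu>))"
        by (simp add: sum_distrib_left)
      also have "\<dots> \<le> ennreal (a / s) * (\<integral>\<^sup>+y. ennreal (h y) \<partial>\<mu>)"
      proof (intro mult_left_mono sum_disjoint_balls_le F)
        show "\<And>z. z \<in> F \<Longrightarrow> 0 < snd z" using F(2) S by blast
      qed auto
      finally show "(\<Sum>z\<in>F. ennreal a * (emeasure \<mu> (ball (fst z) (snd z)) * ennreal (snd z powr - \<gamma>)))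
        \<le> ennreal (a / s) * (\<integral>\<^sup>+y. ennreal (h y) \<partial>\<mu>)" .
    qed (use S in auto)
    then have "ennreal s * emeasure (nu_measure \<mu> \<gamma>) S \<le> ennreal s * (ennreal A * (ennreal (a / s) * (\<integral>\<^sup>+y. ennreal (h y) \<partial>\<mu>)))"
      by (rule mult_left_mono) auto
    also have "\<dots> = ennreal (A * a) * (\<integral>\<^sup>+y. ennreal (h y) \<partial>\<mu>)"
      using A s by (simp add: mult.assoc[symmetric] ennreal_mult[symmetric])
    finally show "ennreal (s powr p) * emeasure (nu_measure \<mu> \<gamma>) S \<le> ennreal (A * a) * (\<integral>\<^sup>+y. ennreal (h y powr p) \<partial>\<mu>)"
      using s hp by (simp add: p)
  qed
qed

theorem weak_Lp_norm_a_fun_le: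
  assumes "\<gamma> < 0 \<or> (\<exists>d. 0 < d \<and> d < \<gamma> \<and> dyadic_regular \<mu> d) \<or> (0 < \<gamma> \<and> 1 < p)" "1 \<le> p"
  shows "\<exists>C>0. \<forall>f. locally_integrable (completion \<mu>) f \<and> (AE x in \<mu>. 0 \<le> f x) \<longrightarrow>
        weak_Lp_norm \<mu> \<gamma> p (a_fun \<mu> \<gamma> p f) \<le> ennreal C * Lp_norm (completion \<mu>) p f"
proof -
  obtain A where A: "0 < A" "\<And>h s S. h \<in> borel_measurable borel \<Longrightarrow> (\<And>y. 0 \<le> h y) \<Longrightarrow> 0 < s \<Longrightarrow>
    (\<And>z. z \<in> S \<Longrightarrow> 0 < snd z \<and>
       ennreal (s * snd z powr (- \<gamma> / p)) < avg (\<lambda>y. ennreal (h y)) (fst z) (snd z)) \<Longrightarrow>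
    ennreal (s powr p) * emeasure (nu_measure \<mu> \<gamma>) S \<le> ennreal A * (\<integral>\<^sup>+y. ennreal (h y powr p) \<partial>\<mu>)"
    using distr_term_a_fun_le[OF assms] by blast
  show ?thesis
  proof (intro exI[of _ "A powr (1 / p)"] conjI allI impI)
    show "0 < A powr (1 / p)" using A by simp
    fix f :: "real ^ 'n \<Rightarrow> real"
    assume "locally_integrable (completion \<mu>) f \<and> (AE x in \<mu>. 0 \<le> f x)"
    then have f: "locally_integrable (completion \<mu>) f" "AE x in \<mu>. 0 \<le> f x" by auto
    obtain h where h: "h \<in> borel_measurable borel" "\<And>y. 0 \<le> h y"
        "\<And>\<gamma> p x t. 0 < t \<Longrightarrow> 0 \<le> a_fun \<mu> \<gamma> p f (x, t)"
      "\<And>\<gamma> p x t. 0 < t \<Longrightarrow> ennreal (a_fun \<mu> \<gamma> p f (x, t)) = ennreal (t powr (\<gamma> / p)) * avg (\<lambda>y. ennreal (h y)) x t"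
      "\<And>p. Lp_norm (completion \<mu>) p f = enn_powr (\<integral>\<^sup>+y. ennreal (h y powr p) \<partial>\<mu>) (1 / p)"
      by (rule a_fun_representative[OF f]) (rule that; assumption)
    show "weak_Lp_norm \<mu> \<gamma> p (a_fun \<mu> \<gamma> p f) \<le> ennreal (A powr (1 / p)) * Lp_norm (completion \<mu>) p f"
      unfolding h(5)
    proof (rule weak_Lp_norm_le)
      fix s :: real assume s: "0 < s"
      show "distr_term \<mu> \<gamma> p (a_fun \<mu> \<gamma> p f) s \<le> ennreal A * (\<integral>\<^sup>+y. ennreal (h y powr p) \<partial>\<mu>)"
        unfolding distr_term_def
      proof (rule A(2)[OF h(1,2) s])
        fix z assume "z \<in> {z. 0 < snd z \<and> s < \<bar>a_fun \<mu> \<gamma> p f z\<bar>}"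
        then have z: "0 < snd z" "s < \<bar>a_fun \<mu> \<gamma> p f (fst z, snd z)\<bar>" by auto
        then have "ennreal s < ennreal (a_fun \<mu> \<gamma> p f (fst z, snd z))"
          using h(3)[OF z(1), of \<gamma> p "fst z"] s by (simp add: ennreal_less_iff)
        then show "0 < snd z \<and> ennreal (s * snd z powr (- \<gamma> / p)) < avg (\<lambda>y. ennreal (h y)) (fst z) (snd z)"
          using z(1) s unfolding h(4)[OF z(1)] by (simp add: ennreal_less_powr_mult_iff)
      qed
    qed (use A assms in auto)
  qed
qed

end

section \<open>Lower bounds for averages at small scales\<close>

text \<open>Fatou's lemma concerns sequences whereas the level \<open>s\<close> is a real variable.
  Limits at infinity are carried to 0 by inversion, so both filters are tested by positive
  sequences.\<close>

lemma le_Liminf_sequences: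
  fixes G :: "real \<Rightarrow> ennreal"
  assumes F: "F = at_right 0 \<or> F = at_top"
    and le: "\<And>X. filterlim X F sequentially \<Longrightarrow> (\<And>n. 0 < X n) \<Longrightarrow> I \<le> liminf (\<lambda>n. G (X n))"
  shows "I \<le> Liminf F G"
  unfolding le_Liminf_iff
proof (intro allI impI)
  fix y assume y: "y < I"
  have *: "\<forall>\<^sub>F n in sequentially. y < G (X n)" if "filterlim X F sequentially" "\<And>n. 0 < X n" for X
    using less_LiminfD[OF less_le_trans[OF y le[OF that]]] .
  show "\<forall>\<^sub>F x in F. y < G x"
    using F
  proof
    assume F: "F = at_right 0"
    show ?thesis unfolding F
    proof (rule sequentially_imp_eventually_at_right[of 0 1])
      fix X :: "nat \<Rightarrow> real" assume X: "\<And>n. 0 < X n" "X \<longlonglongrightarrow> 0"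
      then have "filterlim X (at_right 0) sequentially"
        by (intro tendsto_imp_filterlim_at_right) auto
      then show "\<forall>\<^sub>F n in sequentially. y < G (X n)" using * X F by auto
    qed simp
  next
    assume F: "F = at_top"
    show ?thesis unfolding F eventually_at_top_to_right
    proof (rule sequentially_imp_eventually_at_right[of 0 1])
      fix X :: "nat \<Rightarrow> real" assume X: "\<And>n. 0 < X n" "X \<longlonglongrightarrow> 0"
      then have "filterlim X (at_right 0) sequentially"
        by (intro tendsto_imp_filterlim_at_right) auto
      then have "filterlim (\<lambda>n. inverse (X n)) at_top sequentially"
        by (rule filterlim_compose[OF filterlim_inverse_at_top_right])
      then show "\<forall>\<^sub>F n in sequentially. y < G (inverse (X n))" using * X F by auto
    qed simp
  qed
qed

context doubling_radon
begin

text \<open>A one-sided Lebesgue differentiation theorem with a constant: covering by the balls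
  \<open>B(y, r)\<close> inside \<open>U\<close> while testing the averages on \<open>B(y, 5r)\<close> only costs a doubling factor,
  so that the \<open>5r\<close>-covering lemma suffices.\<close>
lemma outer_measure_small_averages:
  assumes h [measurable]: "h \<in> borel_measurable borel"
    and A: "A \<ge> 1" "\<And>x r. 0 < r \<Longrightarrow> emeasure \<mu> (ball x (5 * r)) \<le> ennreal A * emeasure \<mu> (ball x r)"
    and q: "0 < q" and E: "bounded E"
    and hE: "\<And>x. x \<in> E \<Longrightarrow> ennreal (2 * A * q) < h x"
    and small: "\<And>x \<delta>. x \<in> E \<Longrightarrow> 0 < \<delta> \<Longrightarrow> \<exists>t. 0 < t \<and> t < \<delta> \<and> avg h x t \<le> ennreal q"
  shows "outer_measure_of \<mu> E = 0"
proof -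
  let ?e = "outer_measure_of \<mu> E"
  \<comment> \<open>On \<open>E\<close> the function exceeds \<open>2 * A * q\<close>, while its
    integral over the enlarged balls is at most \<open>A * q\<close> times the measure of the
    disjoint small ones. The spare factor 2 is what the final contradiction uses.\<close>
  have key: "ennreal (2 * A * q) * ?e \<le> ennreal (A * q) * emeasure \<mu> U" if U: "open U" "E \<subseteq> U" for U
  proof -
    have "\<exists>r. 0 < r \<and> r \<le> 1 \<and> ball x r \<subseteq> U \<and> avg h x (5 * r) \<le> ennreal q" if x: "x \<in> E" for x
    proof -
      obtain d where d: "0 < d" "ball x d \<subseteq> U" using U x open_contains_ball by blast
      then obtain t where t: "0 < t" "t < min d 1" "avg h x t \<le> ennreal q"
        using small[OF x, of "min d 1"] by auto
      have "ball x (t / 5) \<subseteq> ball x d" using t by (intro subset_ball) simp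
      then have "ball x (t / 5) \<subseteq> U" using d(2) by blast
      then show ?thesis using t by (intro exI[of _ "t / 5"]) auto
    qed
    then obtain r where r: "\<And>x. x \<in> E \<Longrightarrow> 0 < r x" "\<And>x. x \<in> E \<Longrightarrow> r x \<le> 1"
      "\<And>x. x \<in> E \<Longrightarrow> ball x (r x) \<subseteq> U" "\<And>x. x \<in> E \<Longrightarrow> avg h x (5 * r x) \<le> ennreal q"
      using bchoice[of E "\<lambda>x r. 0 < r \<and> r \<le> 1 \<and> ball x r \<subseteq> U \<and> avg h x (5 * r) \<le> ennreal q"] by blast
    obtain C where C: "countable C" "C \<subseteq> E"
      "pairwise (\<lambda>x y. disjnt (cball x (r x)) (cball y (r y))) C"
      "\<And>x. x \<in> E \<Longrightarrow> \<exists>y. y \<in> C \<and> \<not> disjnt (cball x (r x)) (cball y (r y)) \<and> cball x (r x) \<subseteq> ball y (5 * r y)"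
      by (rule Vitali_covering_lemma_cballs_balls[of E r 1 "\<lambda>x. x"]) (use r in blast)+
    let ?B = "\<lambda>y. ball y (5 * r y)"
    let ?G = "{x. ennreal (2 * A * q) < h x} \<inter> (\<Union>y\<in>C. ?B y)"
    have un: "(\<Union>y\<in>C. ?B y) \<in> sets borel" by (intro borel_open open_UN) auto
    have hs: "{x. ennreal (2 * A * q) < h x} \<in> sets borel" by measurable
    have "E \<subseteq> ?G"
    proof
      fix x assume x: "x \<in> E"
      then obtain y where "y \<in> C" "cball x (r x) \<subseteq> ?B y" using C(4) by blast
      moreover have "x \<in> cball x (r x)" using r(1)[OF x] by simp
      ultimately show "x \<in> ?G" using hE[OF x] by blast
    qed
    then have "?e \<le> outer_measure_of \<mu> ?G" by (rule outer_measure_of_mono)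
    also have "\<dots> = emeasure \<mu> ?G" using un hs by (intro outer_measure_of_eq) auto
    finally have "ennreal (2 * A * q) * ?e \<le> ennreal (2 * A * q) * emeasure \<mu> ?G"
      by (intro mult_left_mono) auto
    also have "\<dots> = (\<integral>\<^sup>+x. ennreal (2 * A * q) * indicator ?G x \<partial>\<mu>)"
      using un hs by (subst nn_integral_cmult_indicator) auto
    also have "\<dots> \<le> (\<integral>\<^sup>+x. h x * indicator (\<Union>y\<in>C. ?B y) x \<partial>\<mu>)"
      by (intro nn_integral_mono) (auto simp: indicator_def)
    also have "\<dots> = emeasure (density \<mu> h) (\<Union>y\<in>C. ?B y)"
      using un by (subst emeasure_density) auto
    also have "\<dots> \<le> ennreal (A * q) * emeasure \<mu> U"
    proof (rule countable_UN_emeasure_le[OF C(1)])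
      fix F assume F: "finite F" "F \<subseteq> C"
      have "(\<Sum>y\<in>F. emeasure (density \<mu> h) (?B y)) \<le> (\<Sum>y\<in>F. ennreal (A * q) * emeasure \<mu> (ball y (r y)))"
      proof (rule sum_mono)
        fix y assume "y \<in> F"
        then have y: "y \<in> E" using F C by blast
        then have ry: "0 < 5 * r y" using r(1) by simp
        obtain m where m: "0 < m" "emeasure \<mu> (?B y) = ennreal m"
          using ball_emeasure_cases[OF ry] by metis
        have "emeasure (density \<mu> h) (?B y) = (\<integral>\<^sup>+x\<in>?B y. h x \<partial>\<mu>)" by (subst emeasure_density) auto
        also have "\<dots> = avg h y (5 * r y) * ennreal m"
          using m by (simp add: avg_def ennreal_divide_times)
        also have "\<dots> \<le> ennreal q * ennreal m" using r(4)[OF y] by (intro mult_right_mono) auto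
        also have "\<dots> \<le> ennreal q * (ennreal A * emeasure \<mu> (ball y (r y)))"
          using A(2)[OF r(1)[OF y], of y] m(2) by (intro mult_left_mono) auto
        also have "\<dots> = ennreal (A * q) * emeasure \<mu> (ball y (r y))"
          using A(1) q by (simp add: ennreal_mult mult_ac)
        finally show "emeasure (density \<mu> h) (?B y) \<le> ennreal (A * q) * emeasure \<mu> (ball y (r y))" .
      qed
      also have "\<dots> = ennreal (A * q) * (\<Sum>y\<in>F. emeasure \<mu> (ball y (r y)))" by (simp add: sum_distrib_left)
      also have "(\<Sum>y\<in>F. emeasure \<mu> (ball y (r y))) = emeasure \<mu> (\<Union>y\<in>F. ball y (r y))"
      proof (rule sum_emeasure)
        show "disjoint_family_on (\<lambda>y. ball y (r y)) F"
          unfolding disjoint_family_on_def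
        proof (intro ballI impI)
          fix x y assume "x \<in> F" "y \<in> F" "x \<noteq> y"
          then have "disjnt (cball x (r x)) (cball y (r y))"
            using pairwiseD[OF C(3)] F(2) by blast
          then show "ball x (r x) \<inter> ball y (r y) = {}"
            using ball_subset_cball[of x "r x"] ball_subset_cball[of y "r y"]
            unfolding disjnt_def by blast
        qed
      qed (use F in auto)
      also have "ennreal (A * q) * emeasure \<mu> (\<Union>y\<in>F. ball y (r y)) \<le> ennreal (A * q) * emeasure \<mu> U"
      proof (intro mult_left_mono emeasure_mono)
        show "(\<Union>y\<in>F. ball y (r y)) \<subseteq> U" using r(3) F(2) C(2) by blast
      qed (use U in auto)
      finally show "(\<Sum>y\<in>F. emeasure (density \<mu> h) (?B y)) \<le> ennreal (A * q) * emeasure \<mu> U" .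
    qed auto
    finally show ?thesis .
  qed
  \<comment> \<open>Nothing makes \<open>E\<close> measurable, but outer regularity is available for
    Borel sets, so it is applied to a measurable hull of \<open>E\<close>.\<close>
  obtain B where B: "B \<in> sets \<mu>" "E \<subseteq> B" "?e = emeasure \<mu> B"
    using outer_measure_of_attain[of E \<mu>] by auto
  have "?e \<le> emeasure \<mu> (closure E)"
  proof -
    have "?e \<le> outer_measure_of \<mu> (closure E)" by (intro outer_measure_of_mono closure_subset)
    also have "\<dots> = emeasure \<mu> (closure E)" by (intro outer_measure_of_eq) auto
    finally show ?thesis .
  qed
  also have "\<dots> < \<infinity>" using E by (intro bounded_finite) auto
  finally obtain e where e: "?e = ennreal e" "0 \<le> e" by (cases ?e) auto
  \<comment> \<open>If \<open>e\<close> were positive, outer regularity would give an open set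
    containing \<open>E\<close> of measure below \<open>2 * e\<close>, against \<open>key\<close>.
    Boundedness of \<open>E\<close> entered to make \<open>e\<close> finite.\<close>
  have "2 * e \<le> e"
  proof (rule ccontr)
    assume "\<not> 2 * e \<le> e"
    then have "emeasure \<mu> B < ennreal (2 * e)" using e unfolding B(3)[symmetric] by (simp add: ennreal_less_iff)
    then obtain U where U: "open U" "B \<subseteq> U" "emeasure \<mu> U < ennreal (2 * e)"
      using outer_regular[of B "ennreal (2 * e)"] B(1) by auto
    have "ennreal (2 * A * q) * ennreal e \<le> ennreal (A * q) * emeasure \<mu> U"
      using key[of U] U B(2) e by auto
    also have "\<dots> < ennreal (A * q) * ennreal (2 * e)"
      using A(1) q U(3) by (intro ennreal_mult_strict_left_mono) auto
    also have "\<dots> = ennreal (2 * A * q) * ennreal e"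
      using A(1) q e by (simp add: ennreal_mult[symmetric] mult_ac)
    finally show False by simp
  qed
  then show ?thesis using e by simp
qed

text \<open>Points where the averages drop too low along arbitrarily small radii lie in countably
  many null sets, indexed by a rational level and a bounded ball. The function need not be
  integrable, nor nonnegative, since \<open>ennreal\<close> sends negative values to 0.\<close>

lemma AE_liminf_avg_ge:
  obtains c where "0 < c" "\<And>h. h \<in> borel_measurable borel \<Longrightarrow>
    AE x in \<mu>. \<exists>\<delta>>0. \<forall>t. 0 < t \<and> t < \<delta> \<longrightarrow> ennreal (c * h x) \<le> avg (\<lambda>y. ennreal (h y)) x t"
proof -
  obtain A where A: "A \<ge> 1" "\<And>x y r. 0 < r \<Longrightarrow> dist x y \<le> 5 * r \<Longrightarrow>
    emeasure \<mu> (ball x (5 * r)) \<le> ennreal A * emeasure \<mu> (ball y r)"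
    using ball_growth[of 5] by blast
  show ?thesis
  proof (rule that)
    show "0 < 1 / (4 * A)" using A by simp
    fix h :: "real ^ 'n \<Rightarrow> real" assume h [measurable]: "h \<in> borel_measurable borel"
    define N where "N q k = {x. x \<in> ball 0 (real k) \<and> ennreal (2 * A * q) < ennreal (h x) \<and>
      (\<forall>\<delta>>0. \<exists>t. 0 < t \<and> t < \<delta> \<and> avg (\<lambda>y. ennreal (h y)) x t \<le> ennreal q)}" for q k
    have "AE x in \<mu>. x \<notin> N q k" if q: "0 < q" for q k
    proof -
      have "outer_measure_of \<mu> (N q k) = 0"
      proof (rule outer_measure_small_averages[OF _ A(1) _ q])
        show "emeasure \<mu> (ball x (5 * r)) \<le> ennreal A * emeasure \<mu> (ball x r)" if "0 < r" for x r
          using A(2)[OF that, of x x] that by simp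
        show "bounded (N q k)" by (rule bounded_subset[of "ball 0 (real k)"]) (auto simp: N_def)
      qed (auto simp: N_def)
      then obtain B where "B \<in> sets \<mu>" "N q k \<subseteq> B" "emeasure \<mu> B = 0"
        using outer_measure_of_attain[of "N q k" \<mu>] by auto
      then show ?thesis by (intro AE_I[of _ _ B]) auto
    qed
    then have "AE x in \<mu>. \<forall>q\<in>{q \<in> \<rat>. 0 < q}. \<forall>k. x \<notin> N q k"
      by (subst AE_ball_countable) (auto simp: AE_all_countable countable_rat intro: countable_subset[OF _ countable_rat])
    then show "AE x in \<mu>. \<exists>\<delta>>0. \<forall>t. 0 < t \<and> t < \<delta> \<longrightarrow> ennreal (1 / (4 * A) * h x) \<le> avg (\<lambda>y. ennreal (h y)) x t"
    proof eventually_elim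
      fix x assume x: "\<forall>q\<in>{q \<in> \<rat>. 0 < q}. \<forall>k. x \<notin> N q k"
      show "\<exists>\<delta>>0. \<forall>t. 0 < t \<and> t < \<delta> \<longrightarrow> ennreal (1 / (4 * A) * h x) \<le> avg (\<lambda>y. ennreal (h y)) x t"
      proof (cases "0 < h x")
        case False
        then have "ennreal (1 / (4 * A) * h x) = 0" using A(1) by (intro ennreal_neg mult_nonneg_nonpos) auto
        then show ?thesis by (intro exI[of _ 1]) auto
      next
        case True
        \<comment> \<open>The open gap between these numbers contains a rational \<open>q\<close>:
          being below \<open>h x / (2 * A)\<close> it makes the null set \<open>N q k\<close>
          applicable, and being above \<open>h x / (4 * A)\<close> it yields the claimed
          constant.\<close>
        have "h x / (4 * A) < h x / (2 * A)" using True A(1) by (simp add: field_simps)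
        then obtain q where q: "q \<in> \<rat>" "h x / (4 * A) < q" "q < h x / (2 * A)"
          using Rats_dense_in_real by blast
        have "0 < h x / (4 * A)" using True A(1) by simp
        then have q0: "0 < q" using q by linarith
        obtain k where k: "norm x < real k" using reals_Archimedean2 by blast
        have "2 * A * q < h x" using q(3) A(1) by (simp add: field_simps)
        then have "ennreal (2 * A * q) < ennreal (h x)" using q0 A(1) by (simp add: ennreal_less_iff)
        then obtain \<delta> where "0 < \<delta>" "\<And>t. 0 < t \<Longrightarrow> t < \<delta> \<Longrightarrow> ennreal q < avg (\<lambda>y. ennreal (h y)) x t"
          using x q q0 k unfolding N_def by (auto simp: not_le)
        moreover have "ennreal (1 / (4 * A) * h x) \<le> ennreal q" using q(2) by (intro ennreal_leI) simp
        ultimately show ?thesis by (intro exI[of _ \<delta>]) (meson le_less_trans less_imp_le)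
      qed
    qed
  qed
qed

end

section \<open>The converse inequality\<close>

lemma nn_integral_weight_ge:
  fixes \<gamma> p s c \<delta> :: real
  assumes "\<gamma> \<noteq> 0" "1 \<le> p" "0 < s" "0 < c" and T: "2 * (c / s) powr (- p / \<gamma>) < \<delta>"
    and P: "\<And>t. 0 < t \<Longrightarrow> t < \<delta> \<Longrightarrow> s * t powr (- \<gamma> / p) < c \<Longrightarrow> t \<in> P"
  shows "ennreal (2 powr - \<bar>1 + \<gamma>\<bar> / 2 * (c / s) powr p)
    \<le> (\<integral>\<^sup>+t. ennreal (t powr - (1 + \<gamma>)) * indicator {0<..} t * indicator P t \<partial>lborel)"
proof -
  define T where "T = (c / s) powr (- p / \<gamma>)"
  have T0: "0 < T" "2 * T < \<delta>" "T powr (- \<gamma> / p) = c / s" "T powr (- \<gamma>) = (c / s) powr p"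
    using assms by (auto simp: T_def powr_powr)
  \<comment> \<open>One dyadic piece next to the threshold is enough: there the weight is comparable
    to \<open>T powr - (1 + \<gamma>)\<close>, and the length is at least \<open>T / 2\<close>,
    which together give \<open>T powr - \<gamma>\<close>. It lies above or below \<open>T\<close>
    according to the sign of \<gamma>.\<close>
  define J where "J = (if 0 < \<gamma> then {T<..<2 * T} else {T / 2<..<T})"
  have J: "t \<in> P \<and> 0 < t \<and> 2 powr - \<bar>1 + \<gamma>\<bar> * T powr - (1 + \<gamma>) \<le> t powr - (1 + \<gamma>)" if "t \<in> J" for t
  proof -
    have t: "0 < t" "t < \<delta>" "1 / 2 \<le> t / T" "t / T \<le> 2"
      using that T0 by (auto simp: J_def field_simps split: if_splits)
    have "t powr (- \<gamma> / p) < T powr (- \<gamma> / p)"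
    proof (cases "0 < \<gamma>")
      case True
      then show ?thesis using that T0 assms by (intro powr_less_mono2_neg) (auto simp: J_def)
    next
      case False
      then have "0 < - \<gamma> / p" using assms by (intro divide_pos_pos) auto
      then show ?thesis using that T0 t False by (intro powr_less_mono2) (auto simp: J_def)
    qed
    then have "s * t powr (- \<gamma> / p) < c" unfolding T0(3) using assms by (simp only: pos_less_divide_eq mult.commute)
    with P t have tP: "t \<in> P" by blast
    have "2 powr - \<bar>1 + \<gamma>\<bar> \<le> (t / T) powr - (1 + \<gamma>)"
    proof (cases "0 \<le> 1 + \<gamma>")
      case True
      have "2 powr - (1 + \<gamma>) \<le> (t / T) powr - (1 + \<gamma>)"
        using True t T0 by (intro powr_mono2') auto
      then show ?thesis using True by simp
    next
      case False
      have "(1 / 2) powr - (1 + \<gamma>) \<le> (t / T) powr - (1 + \<gamma>)"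
        using False t by (intro powr_mono2) auto
      also have "(1 / 2) powr - (1 + \<gamma>) = 2 powr (1 + \<gamma>)"
        by (simp add: powr_minus_divide powr_divide powr_diff field_simps powr_add)
      finally show ?thesis using False by (simp add: add.commute)
    qed
    then have "2 powr - \<bar>1 + \<gamma>\<bar> * T powr - (1 + \<gamma>) \<le> (t / T) powr - (1 + \<gamma>) * T powr - (1 + \<gamma>)"
      by (intro mult_right_mono) auto
    also have "\<dots> = t powr - (1 + \<gamma>)" using t T0 by (simp add: powr_mult[symmetric])
    finally show ?thesis using tP t by blast
  qed
  have "ennreal (2 powr - \<bar>1 + \<gamma>\<bar> * T powr - (1 + \<gamma>) * (T / 2))
    \<le> ennreal (2 powr - \<bar>1 + \<gamma>\<bar> * T powr - (1 + \<gamma>)) * emeasure lborel J"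
  proof -
    have "ennreal (T / 2) \<le> emeasure lborel J"
      using T0(1) by (auto simp: J_def intro!: ennreal_leI)
    then have "ennreal (2 powr - \<bar>1 + \<gamma>\<bar> * T powr - (1 + \<gamma>)) * ennreal (T / 2)
      \<le> ennreal (2 powr - \<bar>1 + \<gamma>\<bar> * T powr - (1 + \<gamma>)) * emeasure lborel J"
      by (intro mult_left_mono) auto
    then show ?thesis using T0(1) by (subst ennreal_mult) auto
  qed
  also have "\<dots> = (\<integral>\<^sup>+t. ennreal (2 powr - \<bar>1 + \<gamma>\<bar> * T powr - (1 + \<gamma>)) * indicator J t \<partial>lborel)"
    by (subst nn_integral_cmult_indicator) (auto simp: J_def)
  also have "\<dots> \<le> (\<integral>\<^sup>+t. ennreal (t powr - (1 + \<gamma>)) * indicator {0<..} t * indicator P t \<partial>lborel)"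
    using J by (intro nn_integral_mono) (auto simp: indicator_def intro!: ennreal_leI)
  also have "2 powr - \<bar>1 + \<gamma>\<bar> * T powr - (1 + \<gamma>) * (T / 2) = 2 powr - \<bar>1 + \<gamma>\<bar> / 2 * (c / s) powr p"
    using T0(1) unfolding T0(4)[symmetric] by (simp add: powr_diff powr_minus powr_add field_simps)
  finally show ?thesis .
qed

context doubling_radon
begin

theorem Lp_norm_le_weak_Lp_limit_a_fun:
  assumes "\<gamma> \<noteq> 0" "1 \<le> p"
  shows "\<exists>C>0. \<forall>f. locally_integrable (completion \<mu>) f \<and> (AE x in \<mu>. 0 \<le> f x) \<longrightarrow>
        Lp_norm (completion \<mu>) p f \<le> ennreal C * weak_Lp_limit \<mu> \<gamma> p (a_fun \<mu> \<gamma> p f)"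
proof -
  obtain c0 where c0: "0 < c0" "\<And>h. h \<in> borel_measurable borel \<Longrightarrow>
    AE x in \<mu>. \<exists>\<delta>>0. \<forall>t. 0 < t \<and> t < \<delta> \<longrightarrow> ennreal (c0 * h x) \<le> avg (\<lambda>y. ennreal (h y)) x t"
    using AE_liminf_avg_ge by blast
  define k where "k = 2 powr - \<bar>1 + \<gamma>\<bar> / 2 * c0 powr p"
  have k: "0 < k" using c0 by (simp add: k_def)
  \<comment> \<open>Both limits are treated as one lower limit along \<open>Fl\<close>.\<close>
  define Fl :: "real filter" where "Fl = (if 0 < \<gamma> then at_right 0 else at_top)"
  have Fl: "Fl = at_right 0 \<or> Fl = at_top" by (simp add: Fl_def)
  show ?thesis
  proof (intro exI[of _ "(1 / k) powr (1 / p)"] conjI allI impI)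
    show "0 < (1 / k) powr (1 / p)" using k by simp
    fix f :: "real ^ 'n \<Rightarrow> real"
    assume "locally_integrable (completion \<mu>) f \<and> (AE x in \<mu>. 0 \<le> f x)"
    then have f: "locally_integrable (completion \<mu>) f" "AE x in \<mu>. 0 \<le> f x" by auto
    obtain h where h: "h \<in> borel_measurable borel" "\<And>y. 0 \<le> h y"
        "\<And>\<gamma> p x t. 0 < t \<Longrightarrow> 0 \<le> a_fun \<mu> \<gamma> p f (x, t)"
      "\<And>\<gamma> p x t. 0 < t \<Longrightarrow> ennreal (a_fun \<mu> \<gamma> p f (x, t)) = ennreal (t powr (\<gamma> / p)) * avg (\<lambda>y. ennreal (h y)) x t"
      "\<And>p. Lp_norm (completion \<mu>) p f = enn_powr (\<integral>\<^sup>+y. ennreal (h y powr p) \<partial>\<mu>) (1 / p)"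
      by (rule a_fun_representative[OF f]) (rule that; assumption)
    note [measurable] = h(1)
    define S where "S s = {z. 0 < snd z \<and> ennreal (s * snd z powr (- \<gamma> / p)) < avg (\<lambda>y. ennreal (h y)) (fst z) (snd z)}" for s
    have S: "{z. 0 < snd z \<and> s < \<bar>a_fun \<mu> \<gamma> p f z\<bar>} = S s" if s: "0 < s" for s
    proof -
      have "s < \<bar>a_fun \<mu> \<gamma> p f (x, t)\<bar> \<longleftrightarrow> ennreal (s * t powr (- \<gamma> / p)) < avg (\<lambda>y. ennreal (h y)) x t"
        if t: "0 < t" for x t
      proof -
        have "s < \<bar>a_fun \<mu> \<gamma> p f (x, t)\<bar> \<longleftrightarrow> ennreal s < ennreal (a_fun \<mu> \<gamma> p f (x, t))"
          using h(3)[OF t, of \<gamma> p x] s by (simp add: ennreal_less_iff)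
        then show ?thesis unfolding h(4)[OF t] using t s by (simp add: ennreal_less_powr_mult_iff)
      qed
      then show ?thesis by (auto simp: S_def)
    qed
    have S_sets: "S s \<in> sets (borel \<Otimes>\<^sub>M borel)" for s
    proof -
      have "{z \<in> space (borel \<Otimes>\<^sub>M borel). 0 < snd z \<and>
          ennreal (s * snd z powr (- \<gamma> / p)) < avg (\<lambda>y. ennreal (h y)) (fst z) (snd z)} \<in> sets (borel \<Otimes>\<^sub>M borel)"
        by measurable
      then show ?thesis by (simp add: S_def space_pair_measure)
    qed
    define \<phi> where "\<phi> s x = ennreal (s powr p) *
      (\<integral>\<^sup>+t. ennreal (t powr - (1 + \<gamma>)) * indicator {0<..} t * indicator (S s) (x, t) \<partial>lborel)" for s x
    have \<phi>_meas: "\<phi> s \<in> borel_measurable \<mu>" for s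
    proof -
      note [measurable] = S_sets[of s]
      have "(\<lambda>x. \<integral>\<^sup>+t. ennreal (t powr - (1 + \<gamma>)) * indicator {0<..} t * indicator (S s) (x, t) \<partial>lborel) \<in> borel_measurable borel"
        by (rule lborel.borel_measurable_nn_integral) measurable
      then show ?thesis unfolding \<phi>_def by simp
    qed
    have distr: "distr_term \<mu> \<gamma> p (a_fun \<mu> \<gamma> p f) s = (\<integral>\<^sup>+x. \<phi> s x \<partial>\<mu>)" if s: "0 < s" for s
    proof -
      note [measurable] = S_sets[of s]
      have "(\<lambda>x. \<integral>\<^sup>+t. ennreal (t powr - (1 + \<gamma>)) * indicator {0<..} t * indicator (S s) (x, t) \<partial>lborel) \<in> borel_measurable borel"
        by (rule lborel.borel_measurable_nn_integral) measurable
      then show ?thesis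
        unfolding distr_term_def S[OF s] \<phi>_def emeasure_nu(1)[OF S_sets] by (subst nn_integral_cmult) auto
    qed
    have ev: "AE x in \<mu>. \<forall>\<^sub>F s in Fl. ennreal k * ennreal (h x powr p) \<le> \<phi> s x"
      using c0(2)[OF h(1)]
    proof eventually_elim
      fix x assume "\<exists>\<delta>>0. \<forall>t. 0 < t \<and> t < \<delta> \<longrightarrow> ennreal (c0 * h x) \<le> avg (\<lambda>y. ennreal (h y)) x t"
      then obtain \<delta> where \<delta>: "0 < \<delta>" "\<And>t. 0 < t \<Longrightarrow> t < \<delta> \<Longrightarrow> ennreal (c0 * h x) \<le> avg (\<lambda>y. ennreal (h y)) x t"
        by blast
      show "\<forall>\<^sub>F s in Fl. ennreal k * ennreal (h x powr p) \<le> \<phi> s x"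
      proof (cases "h x = 0")
        case False
        define c where "c = c0 * h x"
        have c: "0 < c" using c0(1) h(2)[of x] False by (simp add: c_def)
        \<comment> \<open>The threshold height tends to 0 along \<open>Fl\<close> for either sign of
          \<gamma>. This is why averages at small scales, below an unknown \<open>\<delta>\<close>
          depending on the point, determine the limit.\<close>
        have "((\<lambda>s. 2 * (c / s) powr (- p / \<gamma>)) \<longlongrightarrow> 2 * 0) Fl"
        proof (cases "0 < \<gamma>")
          case True
          have "filterlim (\<lambda>s. c * inverse s) at_top (at_right 0)"
            using c by (intro filterlim_tendsto_pos_mult_at_top[OF tendsto_const] filterlim_inverse_at_top_right)
          then have "filterlim (\<lambda>s. c / s) at_top (at_right 0)" by (simp add: divide_inverse)
          then have "((\<lambda>s. (c / s) powr (- p / \<gamma>)) \<longlongrightarrow> 0) (at_right 0)"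
            using True assms by (intro tendsto_neg_powr) auto
          then show ?thesis using True by (intro tendsto_mult tendsto_const) (simp add: Fl_def)
        next
          case False
          then have "0 < - p / \<gamma>" using assms by (intro divide_neg_neg) auto
          moreover have "((\<lambda>s. c / s) \<longlongrightarrow> 0) at_top"
            using tendsto_divide_0[OF tendsto_const filterlim_at_top_imp_at_infinity[OF filterlim_ident]] .
          ultimately have "((\<lambda>s. (c / s) powr (- p / \<gamma>)) \<longlongrightarrow> 0 powr (- p / \<gamma>)) at_top"
            using c by (intro tendsto_powr2 tendsto_const eventually_mono[OF eventually_gt_at_top[of 0]]) auto
          then show ?thesis using False by (intro tendsto_mult tendsto_const) (simp add: Fl_def)
        qed
        then have "\<forall>\<^sub>F s in Fl. 2 * (c / s) powr (- p / \<gamma>) < \<delta>"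
          using \<delta>(1) by (intro order_tendstoD(2)) auto
        moreover have "\<forall>\<^sub>F s in Fl. 0 < s"
          unfolding Fl_def by (auto simp: eventually_at_right_less eventually_gt_at_top)
        ultimately show ?thesis
        proof eventually_elim
          fix s assume T: "2 * (c / s) powr (- p / \<gamma>) < \<delta>" and s: "0 < s"
          have "ennreal (2 powr - \<bar>1 + \<gamma>\<bar> / 2 * (c / s) powr p)
            \<le> (\<integral>\<^sup>+t. ennreal (t powr - (1 + \<gamma>)) * indicator {0<..} t * indicator {t. (x, t) \<in> S s} t \<partial>lborel)"
          proof (rule nn_integral_weight_ge[OF assms s c T])
            fix t assume t: "0 < t" "t < \<delta>" "s * t powr (- \<gamma> / p) < c"
            have "ennreal (s * t powr (- \<gamma> / p)) < ennreal c" using t s c by (simp add: ennreal_less_iff)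
            also have "\<dots> \<le> avg (\<lambda>y. ennreal (h y)) x t" using \<delta>(2) t by (simp add: c_def)
            finally show "t \<in> {t. (x, t) \<in> S s}" using t by (simp add: S_def)
          qed
          then have "ennreal (s powr p) * ennreal (2 powr - \<bar>1 + \<gamma>\<bar> / 2 * (c / s) powr p)
            \<le> ennreal (s powr p) * (\<integral>\<^sup>+t. ennreal (t powr - (1 + \<gamma>)) * indicator {0<..} t * indicator {t. (x, t) \<in> S s} t \<partial>lborel)"
            by (rule mult_left_mono) auto
          also have "\<dots> = \<phi> s x" unfolding \<phi>_def by (simp add: indicator_def)
          also have "ennreal (s powr p) * ennreal (2 powr - \<bar>1 + \<gamma>\<bar> / 2 * (c / s) powr p) = ennreal k * ennreal (h x powr p)"
          proof -
            have "s powr p * (2 powr - \<bar>1 + \<gamma>\<bar> / 2 * (c / s) powr p) = k * h x powr p"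
              using s c c0(1) h(2)[of x] by (simp add: k_def c_def powr_divide powr_mult)
            then show ?thesis using k by (simp add: ennreal_mult[symmetric])
          qed
          finally show "ennreal k * ennreal (h x powr p) \<le> \<phi> s x" .
        qed
      qed simp
    qed
    have "ennreal k * (\<integral>\<^sup>+x. ennreal (h x powr p) \<partial>\<mu>) \<le> Liminf Fl (distr_term \<mu> \<gamma> p (a_fun \<mu> \<gamma> p f))"
    proof (rule le_Liminf_sequences[OF Fl])
      fix X :: "nat \<Rightarrow> real" assume X: "filterlim X Fl sequentially" "\<And>n. 0 < X n"
      have "ennreal k * (\<integral>\<^sup>+x. ennreal (h x powr p) \<partial>\<mu>) = (\<integral>\<^sup>+x. ennreal k * ennreal (h x powr p) \<partial>\<mu>)"
        by (simp add: nn_integral_cmult)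
      also have "\<dots> \<le> (\<integral>\<^sup>+x. liminf (\<lambda>n. \<phi> (X n) x) \<partial>\<mu>)"
      proof (rule nn_integral_mono_AE)
        show "AE x in \<mu>. ennreal k * ennreal (h x powr p) \<le> liminf (\<lambda>n. \<phi> (X n) x)"
          using ev
        proof eventually_elim
          fix x assume "\<forall>\<^sub>F s in Fl. ennreal k * ennreal (h x powr p) \<le> \<phi> s x"
          then have "\<forall>\<^sub>F n in sequentially. ennreal k * ennreal (h x powr p) \<le> \<phi> (X n) x"
            using X(1) unfolding filterlim_iff by blast
          then show "ennreal k * ennreal (h x powr p) \<le> liminf (\<lambda>n. \<phi> (X n) x)"
            by (rule Liminf_bounded)
        qed
      qed
      also have "\<dots> \<le> liminf (\<lambda>n. \<integral>\<^sup>+x. \<phi> (X n) x \<partial>\<mu>)"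
        by (rule nn_integral_liminf) (rule \<phi>_meas)
      finally show "ennreal k * (\<integral>\<^sup>+x. ennreal (h x powr p) \<partial>\<mu>) \<le> liminf (\<lambda>n. distr_term \<mu> \<gamma> p (a_fun \<mu> \<gamma> p f) (X n))"
        using X(2) by (simp add: distr)
    qed
    \<comment> \<open>For \<gamma> < 0 even the lower limit at infinity dominates the norm; passing
      to the upper limit only weakens the result.\<close>
    also have "\<dots> \<le> (if 0 < \<gamma> then Liminf (at_right 0) (distr_term \<mu> \<gamma> p (a_fun \<mu> \<gamma> p f))
               else Limsup at_top (distr_term \<mu> \<gamma> p (a_fun \<mu> \<gamma> p f)))" (is "_ \<le> ?L")
      by (auto simp: Fl_def Liminf_le_Limsup)
    finally have le: "ennreal k * (\<integral>\<^sup>+x. ennreal (h x powr p) \<partial>\<mu>) \<le> ?L" .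
    have "(\<integral>\<^sup>+x. ennreal (h x powr p) \<partial>\<mu>) = ennreal (1 / k) * (ennreal k * (\<integral>\<^sup>+x. ennreal (h x powr p) \<partial>\<mu>))"
      using k by (simp add: mult.assoc[symmetric] ennreal_mult[symmetric])
    also have "\<dots> \<le> ennreal (1 / k) * ?L" using le by (intro mult_left_mono) auto
    finally have "enn_powr (\<integral>\<^sup>+x. ennreal (h x powr p) \<partial>\<mu>) (1 / p) \<le> enn_powr (ennreal (1 / k) * ?L) (1 / p)"
      using assms by (intro enn_powr_mono) auto
    also have "\<dots> = ennreal ((1 / k) powr (1 / p)) * weak_Lp_limit \<mu> \<gamma> p (a_fun \<mu> \<gamma> p f)"
      unfolding weak_Lp_limit_def using k assms by (intro enn_powr_cmult) auto
    finally show "Lp_norm (completion \<mu>) p f \<le> ennreal ((1 / k) powr (1 / p)) * weak_Lp_limit \<mu> \<gamma> p (a_fun \<mu> \<gamma> p f)"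
      unfolding h(5) .
  qed
qed

end

section \<open>Mean oscillation over balls and cubes\<close>

lemma locally_integrable_set_integrable:
  fixes f :: "real ^ 'n \<Rightarrow> 'b::{banach, second_countable_topology}"
  assumes "locally_integrable lebesgue f" "bounded B" "B \<in> sets lebesgue"
  shows "set_integrable lebesgue B f"
proof -
  have "set_integrable lebesgue (closure B) f"
    using assms by (simp add: locally_integrable_def compact_closure)
  then show ?thesis
    by (rule set_integrable_subset) (use assms in \<open>auto intro: closure_subset[THEN subsetD]\<close>)
qed

lemma set_integrable_const:
  fixes d :: real
  assumes "B \<in> fmeasurable M"
  shows "set_integrable M B (\<lambda>y. d)"
proof -
  have "integrable M (indicator B :: _ \<Rightarrow> real)"
    using assms by (intro integrable_real_indicator) (auto simp: fmeasurable_def)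
  then show ?thesis unfolding set_integrable_def by (rule integrable_scaleR_left)
qed

lemma mean_osc_nonneg: "0 \<le> mean_osc f E"
  unfolding mean_osc_def mean_def set_lebesgue_integral_def by simp

text \<open>Replacing the mean by another constant \<open>c\<close> costs a factor 2, since the
  distance from \<open>c\<close> to the mean is itself at most the average of
  \<open>\<bar>f y - c\<bar>\<close>.\<close>

lemma mean_osc_le_integral:
  fixes f :: "real ^ 'n \<Rightarrow> real"
  assumes f: "locally_integrable lebesgue f" and B: "bounded B" "B \<in> sets lebesgue" "0 < measure lebesgue B"
  shows "mean_osc f B \<le> 2 / measure lebesgue B * (LINT y:B|lebesgue. \<bar>f y - c\<bar>)"
proof -
  let ?m = "measure lebesgue B" and ?a = "mean lebesgue f B"
  have Bl: "B \<in> lmeasurable" using B(1,2) by (simp add: bounded_set_imp_lmeasurable)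
  have fi: "set_integrable lebesgue B f" by (rule locally_integrable_set_integrable[OF f B(1,2)])
  have ci: "set_integrable lebesgue B (\<lambda>y. d)" for d :: real
    by (rule set_integrable_const[OF Bl])
  have di: "set_integrable lebesgue B (\<lambda>y. \<bar>f y - d\<bar>)" for d
    using fi ci by (intro set_integrable_abs set_integral_diff)
  have cint: "(LINT y:B|lebesgue. d) = ?m * d" for d :: real
    using Bl by (simp add: set_lebesgue_integral_def fmeasurable_def)
  have "(LINT y:B|lebesgue. f y - c) = ?m * ?a - ?m * c"
    using B(3) by (subst set_integral_diff(2)[OF fi ci]) (simp add: mean_def cint)
  moreover have "\<bar>LINT y:B|lebesgue. f y - c\<bar> \<le> (LINT y:B|lebesgue. \<bar>f y - c\<bar>)"
    using set_integral_norm_bound[OF set_integral_diff(1)[OF fi ci], of c] by simp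
  ultimately have ac: "?m * \<bar>c - ?a\<bar> \<le> (LINT y:B|lebesgue. \<bar>f y - c\<bar>)"
  proof -
    have "?m * \<bar>c - ?a\<bar> = \<bar>?m * ?a - ?m * c\<bar>"
      using B(3) by (simp add: right_diff_distrib[symmetric] abs_mult abs_minus_commute)
    with \<open>\<bar>LINT y:B|lebesgue. f y - c\<bar> \<le> _\<close> \<open>(LINT y:B|lebesgue. f y - c) = _\<close>
    show ?thesis by linarith
  qed
  have "(LINT y:B|lebesgue. \<bar>f y - ?a\<bar>) \<le> (LINT y:B|lebesgue. \<bar>f y - c\<bar> + \<bar>c - ?a\<bar>)"
    using di ci B(2) by (intro set_integral_mono set_integral_add) auto
  also have "\<dots> = (LINT y:B|lebesgue. \<bar>f y - c\<bar>) + ?m * \<bar>c - ?a\<bar>"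
    by (subst set_integral_add(2)[OF di ci]) (simp add: cint)
  also have "\<dots> \<le> 2 * (LINT y:B|lebesgue. \<bar>f y - c\<bar>)" using ac by simp
  finally show ?thesis using B(3) by (simp add: mean_osc_def mean_def field_simps)
qed

text \<open>The mean over the larger set serves as competing constant on the smaller one.\<close>

lemma mean_osc_subset_le:
  fixes f :: "real ^ 'n \<Rightarrow> real"
  assumes f: "locally_integrable lebesgue f" and "bounded Q" "B \<in> sets lebesgue" "Q \<in> sets lebesgue"
    and "B \<subseteq> Q" "0 < measure lebesgue B"
  shows "mean_osc f B \<le> 2 * measure lebesgue Q / measure lebesgue B * mean_osc f Q"
proof -
  let ?c = "mean lebesgue f Q"
  have Ql: "Q \<in> lmeasurable" using assms by (simp add: bounded_set_imp_lmeasurable)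
  have Qp: "0 < measure lebesgue Q"
    using assms measure_mono_fmeasurable[OF \<open>B \<subseteq> Q\<close> \<open>B \<in> sets lebesgue\<close> Ql] by simp
  have "set_integrable lebesgue Q (\<lambda>y. ?c)" by (rule set_integrable_const[OF Ql])
  then have i: "set_integrable lebesgue Q (\<lambda>y. \<bar>f y - ?c\<bar>)"
    using locally_integrable_set_integrable[OF f assms(2,4)] by (intro set_integrable_abs set_integral_diff)
  have "(LINT y:B|lebesgue. \<bar>f y - ?c\<bar>) \<le> (LINT y:Q|lebesgue. \<bar>f y - ?c\<bar>)"
    using set_integrable_subset[OF i assms(3,5)] i assms(5)
    unfolding set_lebesgue_integral_def set_integrable_def
    by (intro integral_mono) (auto simp: indicator_def)
  then have "2 / measure lebesgue B * (LINT y:B|lebesgue. \<bar>f y - ?c\<bar>) \<le> 2 / measure lebesgue B * (LINT y:Q|lebesgue. \<bar>f y - ?c\<bar>)"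
    using assms by (intro mult_left_mono) auto
  also have "\<dots> = 2 * measure lebesgue Q / measure lebesgue B * mean_osc f Q"
    using Qp assms by (simp add: mean_osc_def mean_def[of _ _ Q])
  finally show ?thesis
    using mean_osc_le_integral[OF f _ assms(3,6), of ?c] bounded_subset[OF assms(2,5)] by (meson order_trans)
qed

section \<open>Cubes and the John-Nirenberg functional\<close>

lemma half_open_cube_sets: "half_open_cube a l \<in> sets borel"
proof -
  have "half_open_cube a l = (\<Inter>i. {y. a $ i \<le> y $ i} \<inter> {y. y $ i < a $ i + l})"
    by (auto simp: half_open_cube_def)
  then show ?thesis by simp
qed

lemma emeasure_half_open_cube:
  fixes a :: "real ^ 'n"
  assumes "0 \<le> l"
  shows "emeasure lborel (half_open_cube a l) = ennreal (l ^ CARD('n))"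
proof (rule antisym)
  let ?b = "\<chi> i. a $ i + l"
  have i: "(?b - a) \<bullet> i = l" if i: "i \<in> Basis" for i
  proof -
    from i obtain j where "i = axis j 1" by (auto simp: Basis_vec_def)
    then show ?thesis by (simp add: inner_axis inner_commute[of _ "axis j 1"])
  qed
  have prod: "(\<Prod>i\<in>Basis. (?b - a) \<bullet> i) = l ^ CARD('n)" using i by simp
  have le: "a \<bullet> i \<le> ?b \<bullet> i" if "i \<in> Basis" for i using i[OF that] assms by (simp add: inner_diff_left)
  have "emeasure lborel (half_open_cube a l) \<le> emeasure lborel (cbox a ?b)"
    by (intro emeasure_mono) (auto simp: half_open_cube_def mem_box_cart less_imp_le)
  also have "\<dots> = ennreal (l ^ CARD('n))"
    using le by (subst emeasure_lborel_cbox) (auto simp: prod)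
  finally show "emeasure lborel (half_open_cube a l) \<le> ennreal (l ^ CARD('n))" .
  have "ennreal (l ^ CARD('n)) = emeasure lborel (box a ?b)"
    using le by (subst emeasure_lborel_box) (auto simp: prod)
  also have "\<dots> \<le> emeasure lborel (half_open_cube a l)"
    by (intro emeasure_mono) (auto simp: half_open_cube_def mem_box_cart less_imp_le half_open_cube_sets)
  finally show "ennreal (l ^ CARD('n)) \<le> emeasure lborel (half_open_cube a l)" .
qed

lemma measure_ball_lebesgue:
  fixes x :: "real ^ 'n"
  assumes "0 \<le> t"
  shows "emeasure lborel (ball x t) = ennreal (unit_ball_vol (real CARD('n)) * t ^ CARD('n))"
    "measure lebesgue (ball x t) = unit_ball_vol (real CARD('n)) * t ^ CARD('n)"
  using emeasure_ball[OF assms, of x] content_ball[OF assms, of x] by simp_all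

text \<open>The cube with centre \<open>fst z\<close> and side \<open>2 * snd z\<close>. It is
  half-open because the families in \<open>JN_norm\<close> consist of half-open cubes, and it still
  contains the open ball.\<close>

definition circumscribed_cube :: "(real ^ 'n) \<times> real \<Rightarrow> (real ^ 'n) set" where
  "circumscribed_cube z = half_open_cube (\<chi> i. fst z $ i - snd z) (2 * snd z)"

lemma circumscribed_cube:
  fixes z :: "(real ^ 'n) \<times> real"
  assumes "0 < snd z"
  shows "ball (fst z) (snd z) \<subseteq> circumscribed_cube z"
    "circumscribed_cube z \<subseteq> cball (fst z) (real CARD('n) * snd z)"
    "emeasure lebesgue (circumscribed_cube z) = ennreal ((2 * snd z) ^ CARD('n))"
    "measure lebesgue (circumscribed_cube z) = (2 * snd z) ^ CARD('n)"
    "fst z \<in> circumscribed_cube z"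
proof -
  have mem: "y \<in> circumscribed_cube z \<longleftrightarrow> (\<forall>i. - snd z \<le> (y - fst z) $ i \<and> (y - fst z) $ i < snd z)" for y
    by (auto simp: circumscribed_cube_def half_open_cube_def algebra_simps)
  show "fst z \<in> circumscribed_cube z" using assms by (simp add: mem)
  show "ball (fst z) (snd z) \<subseteq> circumscribed_cube z"
  proof
    fix y assume "y \<in> ball (fst z) (snd z)"
    then have "\<bar>(y - fst z) $ i\<bar> < snd z" for i
      using component_le_norm_cart[of "y - fst z" i] by (auto simp: dist_norm norm_minus_commute)
    then show "y \<in> circumscribed_cube z" unfolding mem by (smt (verit))
  qed
  show "circumscribed_cube z \<subseteq> cball (fst z) (real CARD('n) * snd z)"
  proof
    fix y assume y: "y \<in> circumscribed_cube z"
    have "norm (y - fst z) \<le> (\<Sum>i\<in>UNIV. \<bar>(y - fst z) $ i\<bar>)" by (rule norm_le_l1_cart)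
    also have "\<dots> \<le> (\<Sum>i\<in>(UNIV::'n set). snd z)"
    proof (rule sum_mono)
      fix i
      show "\<bar>(y - fst z) $ i\<bar> \<le> snd z" using y[unfolded mem, rule_format, of i] by linarith
    qed
    finally show "y \<in> cball (fst z) (real CARD('n) * snd z)" by (simp add: dist_norm norm_minus_commute)
  qed
  show e: "emeasure lebesgue (circumscribed_cube z) = ennreal ((2 * snd z) ^ CARD('n))"
    using assms by (simp add: circumscribed_cube_def half_open_cube_sets emeasure_half_open_cube)
  show "measure lebesgue (circumscribed_cube z) = (2 * snd z) ^ CARD('n)"
    unfolding measure_def e using assms by simp
qed

text \<open>Each cube lies in the closed ball dilated by the dimension, so disjoint dilated balls
  give disjoint cubes. Distinct indices thus give distinct cubes, and the sum over \<open>F\<close>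
  is one of the sums in the supremum.\<close>

lemma sum_cubes_le_JN:
  fixes f :: "real ^ 'n \<Rightarrow> real"
  assumes F: "finite F" "disjoint_cballs (real CARD('n)) F" "\<And>z. z \<in> F \<Longrightarrow> 0 < snd z"
  shows "(\<Sum>z\<in>F. emeasure lebesgue (circumscribed_cube z) * ennreal (mean_osc f (circumscribed_cube z) powr p))
    \<le> (SUP P\<in>{P. P \<subseteq> {half_open_cube a l | a l. 0 < l} \<and> pairwise disjnt P}.
        \<Sum>\<^sub>\<infinity>Q\<in>P. emeasure lebesgue Q * ennreal (mean_osc f Q powr p))"
proof -
  let ?P = "circumscribed_cube ` F"
  have disj: "disjnt (circumscribed_cube z) (circumscribed_cube w)" if "z \<in> F" "w \<in> F" "z \<noteq> w" for z w
    using pairwiseD[OF F(2) that] circumscribed_cube(2)[OF F(3)[OF that(1)]]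
      circumscribed_cube(2)[OF F(3)[OF that(2)]] by (meson disjnt_subset1 disjnt_subset2)
  have inj: "inj_on circumscribed_cube F"
  proof (rule inj_onI, rule ccontr)
    fix z w assume "z \<in> F" "w \<in> F" "circumscribed_cube z = circumscribed_cube w" "z \<noteq> w"
    with disj[of z w] circumscribed_cube(5)[OF F(3), of z] show False by (auto simp: disjnt_def)
  qed
  have "(\<Sum>z\<in>F. emeasure lebesgue (circumscribed_cube z) * ennreal (mean_osc f (circumscribed_cube z) powr p))
    = (\<Sum>Q\<in>?P. emeasure lebesgue Q * ennreal (mean_osc f Q powr p))"
    by (simp add: sum.reindex[OF inj])
  also have "\<dots> = (\<Sum>\<^sub>\<infinity>Q\<in>?P. emeasure lebesgue Q * ennreal (mean_osc f Q powr p))"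
    using F(1) by simp
  also have "\<dots> \<le> (SUP P\<in>{P. P \<subseteq> {half_open_cube a l | a l. 0 < l} \<and> pairwise disjnt P}.
        \<Sum>\<^sub>\<infinity>Q\<in>P. emeasure lebesgue Q * ennreal (mean_osc f Q powr p))"
  proof (rule SUP_upper)
    have "?P \<subseteq> {half_open_cube a l | a l. 0 < l}"
    proof
      fix Q assume "Q \<in> ?P"
      then obtain z where "z \<in> F" "Q = circumscribed_cube z" by blast
      then show "Q \<in> {half_open_cube a l | a l. 0 < l}"
        unfolding circumscribed_cube_def using F(3)[of z] by (auto intro!: exI[of _ "2 * snd z"])
    qed
    moreover have "pairwise disjnt ?P"
      by (rule pairwise_imageI) (rule disj)
    ultimately show "?P \<in> {P. P \<subseteq> {half_open_cube a l | a l. 0 < l} \<and> pairwise disjnt P}" by blast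
  qed
  finally show ?thesis .
qed

theorem weak_Lp_norm_b_fun_le:
  assumes lb: "doubling_radon (lborel :: (real ^ 'n) measure)"
    and \<gamma>: "\<gamma> \<notin> {0..real CARD('n)}" and p: "1 \<le> p"
  shows "\<exists>C>0. \<forall>f::real ^ 'n \<Rightarrow> real. locally_integrable lebesgue f \<longrightarrow>
        weak_Lp_norm lborel \<gamma> p (b_fun \<gamma> p f) \<le> ennreal C * JN_norm p f"
proof -
  interpret doubling_radon "lborel :: (real ^ 'n) measure" by (rule lb)
  define n where "n = CARD('n)"
  define v where "v = unit_ball_vol (real n)"
  have n: "0 < n" by (simp add: n_def)
  have v: "0 < v" by (simp add: v_def)
  have ball: "emeasure lborel (ball x t) = ennreal (v * t powr real n)" "measure lebesgue (ball x t) = v * t ^ n"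
    if "0 < t" for x :: "real ^ 'n" and t
    using measure_ball_lebesgue[of t x] that by (simp_all add: v_def n_def powr_realpow)
  \<comment> \<open>For Lebesgue measure, ball measure times \<open>t powr - \<gamma>\<close> is a
    multiple of \<open>t powr (real n - \<gamma>)\<close>. Both coverings therefore take the same
    form, the second with \<open>d = n\<close>, and together they exhaust \<gamma> outside
    [0, n].\<close>
  obtain A where A: "0 < A" and main: "\<And>(S :: ((real ^ 'n) \<times> real) set) M. (\<And>z. z \<in> S \<Longrightarrow> 0 < snd z) \<Longrightarrow>
     (\<And>F. finite F \<Longrightarrow> F \<subseteq> S \<Longrightarrow> disjoint_cballs (real n) F \<Longrightarrow>
        (\<Sum>z\<in>F. ennreal (snd z powr (real n - \<gamma>))) \<le> M) \<Longrightarrow>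
     emeasure (nu_measure lborel \<gamma>) S \<le> ennreal A * M"
  proof (cases "\<gamma> < 0")
    case True
    have "0 < real n" using n by simp
    from nu_le_neg[OF True this] obtain A where A: "0 < A" "\<And>(S :: ((real ^ 'n) \<times> real) set) M. (\<And>z. z \<in> S \<Longrightarrow> 0 < snd z) \<Longrightarrow>
     (\<And>F. finite F \<Longrightarrow> F \<subseteq> S \<Longrightarrow> disjoint_cballs (real n) F \<Longrightarrow>
        (\<Sum>z\<in>F. emeasure lborel (ball (fst z) (snd z)) * ennreal (snd z powr - \<gamma>)) \<le> M) \<Longrightarrow>
     emeasure (nu_measure lborel \<gamma>) S \<le> ennreal A * M" by blast
    show ?thesis
    proof (rule that[of "A * v"])
      show "0 < A * v" using A v by simp
      fix S :: "((real ^ 'n) \<times> real) set" and M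
      assume S: "\<And>z. z \<in> S \<Longrightarrow> 0 < snd z"
        and M: "\<And>F. finite F \<Longrightarrow> F \<subseteq> S \<Longrightarrow> disjoint_cballs (real n) F \<Longrightarrow>
        (\<Sum>z\<in>F. ennreal (snd z powr (real n - \<gamma>))) \<le> M"
      have "emeasure (nu_measure lborel \<gamma>) S \<le> ennreal A * (ennreal v * M)"
      proof (rule A(2)[OF S])
        fix F assume F: "finite F" "F \<subseteq> S" "disjoint_cballs (real n) F"
        have "(\<Sum>z\<in>F. emeasure lborel (ball (fst z) (snd z)) * ennreal (snd z powr - \<gamma>))
          = (\<Sum>z\<in>F. ennreal v * ennreal (snd z powr (real n - \<gamma>)))"
        proof (rule sum.cong[OF refl])
          fix z assume "z \<in> F"
          then have t: "0 < snd z" using F(2) S by blast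
          show "emeasure lborel (ball (fst z) (snd z)) * ennreal (snd z powr - \<gamma>) = ennreal v * ennreal (snd z powr (real n - \<gamma>))"
            using v t by (simp add: ball ennreal_mult[symmetric] powr_diff powr_minus_divide mult.assoc)
        qed
        also have "\<dots> \<le> ennreal v * M"
          unfolding sum_distrib_left[symmetric] by (intro mult_left_mono M F) auto
        finally show "(\<Sum>z\<in>F. emeasure lborel (ball (fst z) (snd z)) * ennreal (snd z powr - \<gamma>)) \<le> ennreal v * M" .
      qed
      then show "emeasure (nu_measure lborel \<gamma>) S \<le> ennreal (A * v) * M"
        using A(1) v by (simp add: ennreal_mult mult.assoc)
    qed
  next
    case False
    with \<gamma> have g: "real n < \<gamma>" by (simp add: n_def)
    have rn: "0 < real n" using n by simp
    have "emeasure lborel (ball x t) \<le> ennreal (v * t powr real n)" if "0 < t" for x :: "real ^ 'n" and t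
      using ball[OF that] by simp
    from nu_le_pos[OF rn g rn v this] show ?thesis using that by blast
  qed
  \<comment> \<open>Twice the ratio of the volumes of the circumscribed cube and the ball, which is
    the cost of passing from the ball to the cube.\<close>
  define K where "K = 2 * 2 ^ n / v"
  have K: "0 < K" using v by (simp add: K_def)
  \<comment> \<open>The level condition gives \<open>t powr (real n - \<gamma>) * s powr p\<close>
    at most t^n times the p-th power of K times the oscillation; writing t^n as the volume (2t)^n of
    the cube over 2^n leaves \<open>c\<close>.\<close>
  define c where "c = K powr p / 2 ^ n"
  have c: "0 < c" using K by (simp add: c_def)
  show ?thesis
  proof (intro exI[of _ "(A * c) powr (1 / p)"] conjI allI impI)
    show "0 < (A * c) powr (1 / p)" using A c by simp
    fix f :: "real ^ 'n \<Rightarrow> real" assume f: "locally_integrable lebesgue f"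
    let ?M = "SUP P\<in>{P. P \<subseteq> {half_open_cube a l | a l. 0 < l} \<and> pairwise disjnt P}.
        \<Sum>\<^sub>\<infinity>Q\<in>P. emeasure lebesgue Q * ennreal (mean_osc f Q powr p)"
    show "weak_Lp_norm lborel \<gamma> p (b_fun \<gamma> p f) \<le> ennreal ((A * c) powr (1 / p)) * JN_norm p f"
      unfolding JN_norm_def
    proof (rule weak_Lp_norm_le)
      fix s :: real assume s: "0 < s"
      let ?S = "{z. 0 < snd z \<and> s < \<bar>b_fun \<gamma> p f z\<bar>}"
      have "emeasure (nu_measure lborel \<gamma>) ?S \<le> ennreal A * (ennreal (c / s powr p) * ?M)"
      proof (rule main)
        fix F assume F: "finite F" "F \<subseteq> ?S" "disjoint_cballs (real n) F"
        have "(\<Sum>z\<in>F. ennreal (snd z powr (real n - \<gamma>)))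
          \<le> (\<Sum>z\<in>F. ennreal (c / s powr p) * (emeasure lebesgue (circumscribed_cube z) * ennreal (mean_osc f (circumscribed_cube z) powr p)))"
        proof (rule sum_mono)
          fix z assume "z \<in> F"
          then have z: "0 < snd z" "s < \<bar>b_fun \<gamma> p f z\<bar>" using F(2) by blast+
          define t where "t = snd z"
          let ?O = "mean_osc f (circumscribed_cube z)"
          have t: "0 < t" using z by (simp add: t_def)
          have "mean_osc f (ball (fst z) t) \<le> 2 * measure lebesgue (circumscribed_cube z) / measure lebesgue (ball (fst z) t) * ?O"
          proof (rule mean_osc_subset_le[OF f])
            show "bounded (circumscribed_cube z)"
              using circumscribed_cube(2)[OF z(1)] bounded_cball bounded_subset by blast
            show "circumscribed_cube z \<in> sets lebesgue"
              unfolding circumscribed_cube_def by (intro sets_completionI_sets) (simp add: half_open_cube_sets)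
            show "ball (fst z) t \<subseteq> circumscribed_cube z" unfolding t_def by (rule circumscribed_cube(1)[OF z(1)])
            show "0 < measure lebesgue (ball (fst z) t)" using t v by (simp add: ball)
          qed auto
          also have "2 * measure lebesgue (circumscribed_cube z) / measure lebesgue (ball (fst z) t) = K"
            using t v unfolding ball(2)[OF t] circumscribed_cube(4)[OF z(1)]
            by (simp add: K_def t_def n_def power_mult_distrib)
          finally have O: "mean_osc f (ball (fst z) t) \<le> K * ?O" .
          have "s < t powr (\<gamma> / p) * mean_osc f (ball (fst z) t)"
            using z(2) by (simp add: b_fun_def t_def case_prod_beta abs_mult mean_osc_nonneg)
          also have "\<dots> \<le> t powr (\<gamma> / p) * (K * ?O)" using O by (intro mult_left_mono) auto
          finally have "s powr p \<le> (t powr (\<gamma> / p) * (K * ?O)) powr p"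
            using s p by (intro powr_mono2) auto
          also have "\<dots> = t powr \<gamma> * (K powr p * ?O powr p)"
            using K p by (simp add: powr_mult powr_powr mean_osc_nonneg)
          finally have "s powr p \<le> t powr \<gamma> * (K powr p * ?O powr p)" .
          then have "t powr (real n - \<gamma>) * s powr p \<le> t powr (real n - \<gamma>) * (t powr \<gamma> * (K powr p * ?O powr p))"
            by (intro mult_left_mono) auto
          also have "\<dots> = c * ((2 * t) ^ n * ?O powr p)"
            using t by (simp add: c_def powr_diff powr_realpow power_mult_distrib)
          finally have "t powr (real n - \<gamma>) \<le> c / s powr p * ((2 * t) ^ n * ?O powr p)"
            using s by (simp add: field_simps)
          then have "ennreal (t powr (real n - \<gamma>)) \<le> ennreal (c / s powr p * ((2 * t) ^ n * ?O powr p))"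
            by (rule ennreal_leI)
          also have "\<dots> = ennreal (c / s powr p) * (emeasure lebesgue (circumscribed_cube z) * ennreal (?O powr p))"
            unfolding circumscribed_cube(3)[OF z(1)] using c t by (subst ennreal_mult) (auto simp: ennreal_mult t_def n_def)
          finally show "ennreal (snd z powr (real n - \<gamma>)) \<le> ennreal (c / s powr p) * (emeasure lebesgue (circumscribed_cube z) * ennreal (?O powr p))"
            by (simp add: t_def)
        qed
        also have "\<dots> \<le> ennreal (c / s powr p) * ?M"
          unfolding sum_distrib_left[symmetric]
          using F by (intro mult_left_mono sum_cubes_le_JN) (auto simp: n_def)
        finally show "(\<Sum>z\<in>F. ennreal (snd z powr (real n - \<gamma>))) \<le> ennreal (c / s powr p) * ?M" .
      qed auto
      then have "distr_term lborel \<gamma> p (b_fun \<gamma> p f) s \<le> ennreal (s powr p) * (ennreal A * (ennreal (c / s powr p) * ?M))"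
        unfolding distr_term_def by (intro mult_left_mono) auto
      also have "\<dots> = ennreal (A * c) * ?M"
        using s A c by (simp add: mult.assoc[symmetric] ennreal_mult[symmetric])
      finally show "distr_term lborel \<gamma> p (b_fun \<gamma> p f) s \<le> ennreal (A * c) * ?M" .
    qed (use A c p in auto)
  qed
qed

section \<open>Smooth test functions\<close>

text \<open>The greatest fixed point of having a derivative in the same class: differentiability of
  all orders, without an index for the order.\<close>

coinductive smooth1 :: "(real \<Rightarrow> real) \<Rightarrow> bool" where
  smooth1I: "(\<And>x. (h has_real_derivative h' x) (at x)) \<Longrightarrow> smooth1 h' \<Longrightarrow> smooth1 h"

lemma smooth1E:
  assumes "smooth1 h"
  obtains h' where "\<And>x. (h has_real_derivative h' x) (at x)" "smooth1 h'"
  using assms by (cases rule: smooth1.cases) auto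

text \<open>The coinduction principle in working form. The proofs below differ only in the choice of
  a class \<open>X\<close> that differentiation does not leave.\<close>

lemma smooth1_closed_class:
  assumes "h \<in> X" and "\<And>k. k \<in> X \<Longrightarrow> \<exists>k'\<in>X. \<forall>x. (k has_real_derivative k' x) (at x)"
  shows "smooth1 h"
  using assms(1) by (coinduction arbitrary: h rule: smooth1.coinduct) (use assms(2) in blast)

lemma smooth1_continuous: "smooth1 h \<Longrightarrow> continuous_on UNIV h"
  by (erule smooth1E) (meson DERIV_continuous_on has_field_derivative_at_within)

lemma smooth1_measurable: "smooth1 h \<Longrightarrow> h \<in> borel_measurable borel"
  by (intro borel_measurable_continuous_onI smooth1_continuous)

lemma smooth1_diff:
  assumes "smooth1 f" "smooth1 g"
  shows "smooth1 (\<lambda>x. f x - g x)"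
proof (rule smooth1_closed_class[where X = "{k. \<exists>f g. smooth1 f \<and> smooth1 g \<and> k = (\<lambda>x. f x - g x)}"])
  fix k assume "k \<in> {k. \<exists>f g. smooth1 f \<and> smooth1 g \<and> k = (\<lambda>x. f x - g x)}"
  then obtain f g where fg: "smooth1 f" "smooth1 g" and k: "k = (\<lambda>x. f x - g x)" by blast
  obtain f' g' where "\<And>x. (f has_real_derivative f' x) (at x)" "smooth1 f'"
    "\<And>x. (g has_real_derivative g' x) (at x)" "smooth1 g'"
    using fg by (metis smooth1E)
  then show "\<exists>k'\<in>{k. \<exists>f g. smooth1 f \<and> smooth1 g \<and> k = (\<lambda>x. f x - g x)}.
      \<forall>x. (k has_real_derivative k' x) (at x)" unfolding k
    by (intro bexI[of _ "\<lambda>x. f' x - g' x"]) (auto intro!: derivative_eq_intros)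
qed (use assms in blast)

lemma smooth1_affine:
  assumes "smooth1 h"
  shows "smooth1 (\<lambda>x. h (a * x + b))"
proof (rule smooth1_closed_class[where X = "{k. \<exists>f c. smooth1 f \<and> k = (\<lambda>x. c * f (a * x + b))}"])
  show "(\<lambda>x. h (a * x + b)) \<in> {k. \<exists>f c. smooth1 f \<and> k = (\<lambda>x. c * f (a * x + b))}"
    using assms by (auto intro!: exI[of _ h] exI[of _ 1])
  fix k assume "k \<in> {k. \<exists>f c. smooth1 f \<and> k = (\<lambda>x. c * f (a * x + b))}"
  then obtain f c where f: "smooth1 f" and k: "k = (\<lambda>x. c * f (a * x + b))" by blast
  obtain f' where f': "\<And>x. (f has_real_derivative f' x) (at x)" "smooth1 f'"
    using f by (metis smooth1E)
  have "(k has_real_derivative (c * a) * f' (a * x + b)) (at x)" for x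
    unfolding k by (auto intro!: derivative_eq_intros DERIV_chain2[OF f'(1)])
  with f'(2) show "\<exists>k'\<in>{k. \<exists>f c. smooth1 f \<and> k = (\<lambda>x. c * f (a * x + b))}.
      \<forall>x. (k has_real_derivative k' x) (at x)"
    by (intro bexI[of _ "\<lambda>x. (c * a) * f' (a * x + b)"]) auto
qed

text \<open>Products alone are not closed under differentiation, as Leibniz' rule returns two of
  them; finite sums of products, encoded as lists of pairs, are.\<close>

lemma smooth1_mult:
  assumes "smooth1 f" "smooth1 g"
  shows "smooth1 (\<lambda>x. f x * g x)"
proof -
  define X where "X = {k. \<exists>L. (\<forall>(u, v)\<in>set L. smooth1 u \<and> smooth1 v) \<and> k = (\<lambda>x. \<Sum>(u, v)\<leftarrow>L. u x * v x)}"
  have step: "\<exists>L'. (\<forall>(u, v)\<in>set L'. smooth1 u \<and> smooth1 v) \<and>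
      (\<forall>x. ((\<lambda>x. \<Sum>(u, v)\<leftarrow>L. u x * v x) has_real_derivative (\<Sum>(u, v)\<leftarrow>L'. u x * v x)) (at x))"
    if "\<forall>(u, v)\<in>set L. smooth1 u \<and> smooth1 v" for L
    using that
  proof (induction L)
    case Nil
    then show ?case by (intro exI[of _ "[]"]) auto
  next
    case (Cons uv L)
    obtain u v where uv: "uv = (u, v)" by (cases uv)
    obtain L' where L': "\<forall>(u, v)\<in>set L'. smooth1 u \<and> smooth1 v"
      "\<And>x. ((\<lambda>x. \<Sum>(u, v)\<leftarrow>L. u x * v x) has_real_derivative (\<Sum>(u, v)\<leftarrow>L'. u x * v x)) (at x)"
      using Cons by auto
    have s: "smooth1 u" "smooth1 v" using Cons.prems uv by auto
    obtain u' v' where d: "\<And>x. (u has_real_derivative u' x) (at x)" "smooth1 u'"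
      "\<And>x. (v has_real_derivative v' x) (at x)" "smooth1 v'"
      using s by (metis smooth1E)
    show ?case
      by (rule exI[of _ "(u', v) # (u, v') # L'"])
        (use L' s d in \<open>auto simp: uv intro!: derivative_eq_intros\<close>)
  qed
  have "(\<lambda>x. f x * g x) \<in> X" unfolding X_def using assms by (auto intro!: exI[of _ "[(f, g)]"])
  then show ?thesis
  proof (rule smooth1_closed_class)
    fix k assume "k \<in> X"
    then obtain L where "\<forall>(u, v)\<in>set L. smooth1 u \<and> smooth1 v" "k = (\<lambda>x. \<Sum>(u, v)\<leftarrow>L. u x * v x)"
      unfolding X_def by blast
    with step[of L] obtain L' where "\<forall>(u, v)\<in>set L'. smooth1 u \<and> smooth1 v"
      "\<forall>x. (k has_real_derivative (\<Sum>(u, v)\<leftarrow>L'. u x * v x)) (at x)" by blast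
    then show "\<exists>k'\<in>X. \<forall>x. (k has_real_derivative k' x) (at x)"
      by (intro bexI[of _ "\<lambda>x. \<Sum>(u, v)\<leftarrow>L'. u x * v x"]) (auto simp: X_def)
  qed
qed

text \<open>The classical flat function exp(-1/t), divided by a power of t. The powers are included
  so that derivatives of all orders stay in the linear span of the family.\<close>

definition flat :: "nat \<Rightarrow> real \<Rightarrow> real" where
  "flat m t = (if 0 < t then exp (- (1 / t)) / t ^ m else 0)"

lemma flat_tendsto_0: "(flat m \<longlongrightarrow> 0) (at_right 0)"
proof -
  have "((\<lambda>t. inverse t ^ m / exp (inverse t)) \<longlongrightarrow> 0) (at_right (0::real))"
    by (rule filterlim_compose[OF tendsto_power_div_exp_0 filterlim_inverse_at_top_right])
  moreover have "\<forall>\<^sub>F t in at_right (0::real). inverse t ^ m / exp (inverse t) = flat m t"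
    unfolding eventually_at_right_field
    by (intro exI[of _ 1]) (auto simp: flat_def exp_minus field_simps)
  ultimately show ?thesis by (rule Lim_transform_eventually)
qed

lemma flat_has_derivative:
  "(flat m has_real_derivative flat (m + 2) t - real m * flat (m + 1) t) (at t)"
proof -
  consider "0 < t" | "t < 0" | "t = 0" by linarith
  then show ?thesis
  proof cases
    case 1
    have "((\<lambda>t. exp (- (1 / t)) / t ^ m) has_real_derivative flat (m + 2) t - real m * flat (m + 1) t) (at t)"
      using 1 by (cases m, auto intro!: derivative_eq_intros simp: flat_def field_simps power2_eq_square,
          metis One_nat_def power_eq_if)
    then show ?thesis
      by (rule has_field_derivative_transform_within_open[where S = "{0<..}"]) (use 1 in \<open>auto simp: flat_def\<close>)
  next
    case 2
    have "((\<lambda>t. 0) has_real_derivative flat (m + 2) t - real m * flat (m + 1) t) (at t)"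
      using 2 by (auto simp: flat_def)
    then show ?thesis
      by (rule has_field_derivative_transform_within_open[where S = "{..<0}"]) (use 2 in \<open>auto simp: flat_def\<close>)
  next
    case 3
    \<comment> \<open>From the right, the difference quotient of \<open>flat m\<close> at 0 is
      \<open>flat (Suc m)\<close>, which vanishes in the limit.\<close>
    have "((\<lambda>s. (flat m s - flat m 0) / (s - 0)) \<longlongrightarrow> 0) (at_right 0)"
      by (rule Lim_transform_eventually[OF flat_tendsto_0[of "Suc m"]])
        (auto simp: flat_def eventually_at_right_field intro!: exI[of _ 1])
    moreover have "((\<lambda>s. (flat m s - flat m 0) / (s - 0)) \<longlongrightarrow> 0) (at_left 0)"
      by (rule Lim_transform_eventually[OF tendsto_const])
        (auto simp: flat_def eventually_at_left_field intro!: exI[of _ "- 1"])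
    ultimately show ?thesis
      unfolding 3 has_field_derivative_iff by (simp add: filterlim_split_at flat_def)
  qed
qed

lemma smooth1_flat: "smooth1 (flat m)"
proof -
  define X where "X = {k. \<exists>L. k = (\<lambda>x. \<Sum>(c, m)\<leftarrow>L. c * flat m x)}"
  have step: "\<exists>L'. \<forall>x. ((\<lambda>x. \<Sum>(c, m)\<leftarrow>L. c * flat m x) has_real_derivative (\<Sum>(c, m)\<leftarrow>L'. c * flat m x)) (at x)" for L
  proof (induction L)
    case Nil
    then show ?case by (intro exI[of _ "[]"]) auto
  next
    case (Cons cm L)
    obtain c m where cm: "cm = (c, m)" by (cases cm)
    from Cons obtain L' where L':
      "\<And>x. ((\<lambda>x. \<Sum>(c, m)\<leftarrow>L. c * flat m x) has_real_derivative (\<Sum>(c, m)\<leftarrow>L'. c * flat m x)) (at x)"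
      by blast
    show ?case
      by (rule exI[of _ "(c, m + 2) # (- (c * real m), m + 1) # L'"])
        (use L' in \<open>auto simp: cm right_diff_distrib left_diff_distrib mult_ac intro!: derivative_eq_intros flat_has_derivative\<close>)
  qed
  have "flat m = (\<lambda>x. \<Sum>(c, m)\<leftarrow>[(1, m)]. c * flat m x)" by auto
  then have "flat m \<in> X" unfolding X_def by blast
  then show ?thesis
    by (rule smooth1_closed_class) (use step in \<open>auto simp: X_def; blast\<close>)
qed

definition bump :: "nat \<Rightarrow> real \<Rightarrow> real \<Rightarrow> real \<Rightarrow> real" where
  "bump k a b t = flat 0 (real k * t - real k * a) * flat 0 (real k * b - real k * t)"

lemma smooth1_bump: "smooth1 (bump k a b)"
  using smooth1_mult[OF smooth1_affine[OF smooth1_flat[of 0], of "real k" "- (real k * a)"]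
      smooth1_affine[OF smooth1_flat[of 0], of "- real k" "real k * b"]]
  by (simp add: bump_def[abs_def] algebra_simps)

lemma bump_bounds: "0 \<le> bump k a b t" "bump k a b t \<le> 1"
  by (auto simp: bump_def flat_def intro!: mult_le_one)

lemma bump_eq_0: "t \<notin> {a<..<b} \<Longrightarrow> bump k a b t = 0"
  by (auto simp: bump_def flat_def mult_less_cancel_left)

lemma bump_tendsto: "(\<lambda>k. bump k a b t) \<longlonglongrightarrow> indicator {a<..<b} t"
proof (cases "t \<in> {a<..<b}")
  case True
  have lim: "(\<lambda>k. flat 0 (real k * d)) \<longlonglongrightarrow> 1" if "0 < d" for d
  proof -
    have "(\<lambda>k. exp (- (1 / (real k * d)))) \<longlonglongrightarrow> exp (- 0)"
      using that
      by (intro tendsto_exp tendsto_minus tendsto_divide_0[OF tendsto_const] filterlim_at_top_imp_at_infinity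
          filterlim_at_top_mult_tendsto_pos[OF tendsto_const] filterlim_real_sequentially)
    moreover have "\<forall>\<^sub>F k in sequentially. exp (- (1 / (real k * d))) = flat 0 (real k * d)"
      using eventually_gt_at_top[of 0] by eventually_elim (use that in \<open>simp add: flat_def\<close>)
    ultimately show ?thesis by (simp add: tendsto_cong)
  qed
  have "(\<lambda>k. flat 0 (real k * (t - a)) * flat 0 (real k * (b - t))) \<longlonglongrightarrow> 1 * 1"
    using True by (intro tendsto_mult lim) auto
  then show ?thesis using True by (simp add: bump_def right_diff_distrib)
qed (simp add: bump_eq_0)

lemma smooth1_antiderivative:
  assumes "smooth1 h"
  obtains H where "smooth1 H" "\<And>x. (H has_real_derivative h x) (at x)"
proof -
  obtain H where H: "\<And>x. -\<infinity> < ereal x \<Longrightarrow> ereal x < \<infinity> \<Longrightarrow> (H has_vector_derivative h x) (at x)"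
    using einterval_antiderivative[of "-\<infinity>" "\<infinity>" h] smooth1_continuous[OF assms]
    by (auto simp: continuous_on_eq_continuous_at)
  then have "(H has_real_derivative h x) (at x)" for x
    by (simp add: has_real_derivative_iff_has_vector_derivative)
  then show ?thesis using that smooth1I assms by blast
qed

section \<open>Tensor products as test functions\<close>

lemma tensor_has_derivative:
  fixes h :: "'n::finite \<Rightarrow> real \<Rightarrow> real"
  assumes "\<And>i t. (h i has_real_derivative h' i t) (at t)"
  shows "((\<lambda>x. \<Prod>i\<in>UNIV. h i (x $ i)) has_derivative
    (\<lambda>y. \<Sum>i\<in>UNIV. (h' i (x $ i) * y $ i) * (\<Prod>j\<in>UNIV - {i}. h j (x $ j)))) (at x)"
proof (rule has_derivative_prod)
  fix i
  have "((\<lambda>x. x $ i) has_derivative (\<lambda>y. y $ i)) (at x)"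
    by (intro bounded_linear_imp_has_derivative bounded_linear_vec_nth)
  then show "((\<lambda>x. h i (x $ i)) has_derivative (\<lambda>y. h' i (x $ i) * y $ i)) (at x)"
    by (rule has_derivative_eq_rhs[OF has_derivative_compose[OF _ assms[unfolded has_field_derivative_def]]]) auto
qed

text \<open>A partial derivative changes just one factor, so iterated partial derivatives are again
  tensor products. This reduces smoothness in several variables to \<open>smooth1\<close>.\<close>

lemma partial_deriv_tensor:
  fixes h :: "'n::finite \<Rightarrow> real \<Rightarrow> real"
  assumes "\<And>i. smooth1 (h i)" "\<And>t. (h j has_real_derivative d t) (at t)"
  shows "partial_deriv j (\<lambda>x. \<Prod>i\<in>UNIV. h i (x $ i)) = (\<lambda>x. \<Prod>i\<in>UNIV. (h(j := d)) i (x $ i))"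
proof
  fix x :: "real ^ 'n"
  have "\<forall>i. \<exists>d. \<forall>t. (h i has_real_derivative d t) (at t)"
    using assms(1) smooth1E by metis
  then obtain h' where h': "\<And>i t. (h i has_real_derivative h' i t) (at t)" by metis
  have hj: "h' j = d" using DERIV_unique[OF h' assms(2)] by auto
  have "partial_deriv j (\<lambda>x. \<Prod>i\<in>UNIV. h i (x $ i)) x
    = (\<Sum>i\<in>UNIV. (h' i (x $ i) * axis j 1 $ i) * (\<Prod>k\<in>UNIV - {i}. h k (x $ k)))"
    unfolding partial_deriv_def frechet_derivative_at[OF tensor_has_derivative[OF h'], symmetric] by simp
  also have "\<dots> = (\<Sum>i\<in>UNIV. if i = j then d (x $ j) * (\<Prod>k\<in>UNIV - {j}. h k (x $ k)) else 0)"
    by (intro sum.cong) (auto simp: axis_def hj)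
  also have "\<dots> = d (x $ j) * (\<Prod>k\<in>UNIV - {j}. h k (x $ k))" by simp
  also have "\<dots> = (\<Prod>i\<in>UNIV. (h(j := d)) i (x $ i))"
    by (subst prod.remove[of UNIV j]) auto
  finally show "partial_deriv j (\<lambda>x. \<Prod>i\<in>UNIV. h i (x $ i)) x = (\<Prod>i\<in>UNIV. (h(j := d)) i (x $ i))" .
qed

lemma test_function_tensor:
  fixes h :: "'n::finite \<Rightarrow> real \<Rightarrow> real"
  assumes h: "\<And>i. smooth1 (h i)" and supp: "\<And>i t. t \<notin> {a i..b i} \<Longrightarrow> h i t = 0"
  shows "test_function (\<lambda>x. \<Prod>i\<in>UNIV. h i (x $ i))"
  unfolding test_function_def
proof (intro conjI allI)
  have iter: "\<exists>h'. (\<forall>i. smooth1 (h' i)) \<and> foldr partial_deriv is (\<lambda>x. \<Prod>i\<in>UNIV. h i (x $ i)) = (\<lambda>x. \<Prod>i\<in>UNIV. h' i (x $ i))" for "is"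
  proof (induction "is")
    case Nil
    then show ?case using h by (intro exI[of _ h]) auto
  next
    case (Cons j js)
    then obtain h' where h': "\<forall>i. smooth1 (h' i)"
      "foldr partial_deriv js (\<lambda>x. \<Prod>i\<in>UNIV. h i (x $ i)) = (\<lambda>x. \<Prod>i\<in>UNIV. h' i (x $ i))" by blast
    obtain d where d: "\<And>t. (h' j has_real_derivative d t) (at t)" "smooth1 d"
      using h'(1) by (metis smooth1E)
    show ?case using h' d partial_deriv_tensor[of h' j d]
      by (intro exI[of _ "h'(j := d)"]) auto
  qed
  fix "is" :: "'n list" and x :: "real ^ 'n"
  obtain h' where h': "\<forall>i. smooth1 (h' i)"
    "foldr partial_deriv is (\<lambda>x. \<Prod>i\<in>UNIV. h i (x $ i)) = (\<lambda>x. \<Prod>i\<in>UNIV. h' i (x $ i))" using iter by blast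
  have "\<forall>i. \<exists>d. \<forall>t. (h' i has_real_derivative d t) (at t)"
    using h'(1) smooth1E by metis
  then obtain h'' where "\<And>i t. (h' i has_real_derivative h'' i t) (at t)" by metis
  from tensor_has_derivative[of h' h'', OF this]
  show "foldr partial_deriv is (\<lambda>x. \<Prod>i\<in>UNIV. h i (x $ i)) differentiable (at x)"
    unfolding h'(2) by (auto simp: differentiable_def)
next
  have "{x. (\<Prod>i\<in>UNIV. h i (x $ i)) \<noteq> 0} \<subseteq> cbox (\<chi> i. a i) (\<chi> i. b i)"
  proof
    fix x assume "x \<in> {x. (\<Prod>i\<in>UNIV. h i (x $ i)) \<noteq> 0}"
    then have "h i (x $ i) \<noteq> 0" for i by simp
    then have "x $ i \<in> {a i..b i}" for i using supp by metis
    then show "x \<in> cbox (\<chi> i. a i) (\<chi> i. b i)" by (simp add: mem_box_cart)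
  qed
  then show "compact (closure {x. (\<Prod>i\<in>UNIV. h i (x $ i)) \<noteq> 0})"
    by (meson bounded_cbox bounded_subset compact_closure)
qed

section \<open>Difference quotients of weakly differentiable functions\<close>

lemma nn_integral_lborel_shift:
  fixes f :: "'a::euclidean_space \<Rightarrow> ennreal"
  assumes "f \<in> borel_measurable borel"
  shows "(\<integral>\<^sup>+x. f (x + c) \<partial>lborel) = (\<integral>\<^sup>+x. f x \<partial>lborel)"
proof -
  have "(\<integral>\<^sup>+x. f x \<partial>lborel) = (\<integral>\<^sup>+x. f x \<partial>distr lborel borel ((+) c))" by (simp add: lborel_distr_plus)
  also have "\<dots> = (\<integral>\<^sup>+x. f (c + x) \<partial>lborel)" using assms by (intro nn_integral_distr) auto
  finally show ?thesis by (simp add: add.commute)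
qed

lemma integral_lborel_shift:
  fixes f :: "'a::euclidean_space \<Rightarrow> real"
  assumes "f \<in> borel_measurable borel"
  shows "(\<integral>x. f (x + c) \<partial>lborel) = (\<integral>x. f x \<partial>lborel)"
    "integrable lborel (\<lambda>x. f (x + c)) \<longleftrightarrow> integrable lborel f"
proof -
  have "(\<integral>x. f x \<partial>lborel) = (\<integral>x. f x \<partial>distr lborel borel ((+) c))" by (simp add: lborel_distr_plus)
  also have "\<dots> = (\<integral>x. f (c + x) \<partial>lborel)" using assms by (intro integral_distr) auto
  finally show "(\<integral>x. f (x + c) \<partial>lborel) = (\<integral>x. f x \<partial>lborel)" by (simp add: add.commute)
  have "integrable lborel f \<longleftrightarrow> integrable (distr lborel borel ((+) c)) f" by (simp add: lborel_distr_plus)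
  also have "\<dots> \<longleftrightarrow> integrable lborel (\<lambda>x. f (c + x))" using assms by (intro integrable_distr_eq) auto
  finally show "integrable lborel (\<lambda>x. f (x + c)) \<longleftrightarrow> integrable lborel f" by (simp add: add.commute)
qed

text \<open>\<open>ennreal (W x)\<close> and \<open>ennreal (- W x)\<close> are the positive and
  negative parts. The measures with these densities agree and are finite on boxes, an
  intersection-stable generator, so they are equal, and the densities agree almost
  everywhere.\<close>

lemma AE_eq_0_if_box_integrals_0:
  fixes W :: "'a::euclidean_space \<Rightarrow> real"
  assumes W [measurable]: "W \<in> borel_measurable borel"
    and int: "\<And>a b. integrable lborel (\<lambda>x. indicator (box a b) x * W x)"
    and zero: "\<And>a b. (\<integral>x. indicator (box a b) x * W x \<partial>lborel) = 0"
  shows "AE x in lborel. W x = 0"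
proof -
  let ?P = "density lborel (\<lambda>x. ennreal (W x))" and ?N = "density lborel (\<lambda>x. ennreal (- W x))"
  have box: "emeasure ?P (box a b) = emeasure ?N (box a b) \<and> emeasure ?P (box a b) \<noteq> \<infinity>" for a b
  proof -
    let ?V = "\<lambda>x. indicator (box a b) x * W x"
    have b [measurable]: "box a b \<in> sets borel" by simp
    have P: "emeasure ?P (box a b) = (\<integral>\<^sup>+x. ennreal (?V x) \<partial>lborel)"
      by (subst emeasure_density) (auto intro!: nn_integral_cong simp: indicator_def)
    have N: "emeasure ?N (box a b) = (\<integral>\<^sup>+x. ennreal (- ?V x) \<partial>lborel)"
      by (subst emeasure_density) (auto intro!: nn_integral_cong simp: indicator_def)
    have fin: "(\<integral>\<^sup>+x. ennreal (?V x) \<partial>lborel) \<noteq> \<infinity>" "(\<integral>\<^sup>+x. ennreal (- ?V x) \<partial>lborel) \<noteq> \<infinity>"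
      using int[of a b] unfolding real_integrable_def by auto
    have "enn2real (\<integral>\<^sup>+x. ennreal (?V x) \<partial>lborel) = enn2real (\<integral>\<^sup>+x. ennreal (- ?V x) \<partial>lborel)"
      using zero[of a b] real_lebesgue_integral_def[OF int[of a b]] by simp
    then have "ennreal (enn2real (\<integral>\<^sup>+x. ennreal (?V x) \<partial>lborel)) = ennreal (enn2real (\<integral>\<^sup>+x. ennreal (- ?V x) \<partial>lborel))"
      by (rule arg_cong)
    then have "(\<integral>\<^sup>+x. ennreal (?V x) \<partial>lborel) = (\<integral>\<^sup>+x. ennreal (- ?V x) \<partial>lborel)"
      using fin by (simp only: ennreal_enn2real_if infinity_ennreal_def if_False)
    then show ?thesis using P N fin by simp
  qed
  have "?P = ?N"
  proof (rule measure_eqI_generator_eq[where E = "range (\<lambda>(a, b). box a b)" and \<Omega> = UNIV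
        and A = "\<lambda>n::nat. box (- (real n *\<^sub>R One)) (real n *\<^sub>R One)"])
    show "Int_stable (range (\<lambda>(a, b). box a b :: 'a set))"
      by (auto simp: Int_stable_def box_Int_box)
    show "sets ?P = sigma_sets UNIV (range (\<lambda>(a, b). box a b))"
      "sets ?N = sigma_sets UNIV (range (\<lambda>(a, b). box a b))"
      by (simp_all add: borel_eq_box)
    show "(\<Union>n. box (- (real n *\<^sub>R One)) (real n *\<^sub>R One)) = (UNIV :: 'a set)"
      by (rule UN_box_eq_UNIV)
    show "emeasure ?P (box (- (real n *\<^sub>R One)) (real n *\<^sub>R One)) \<noteq> \<infinity>" for n
      using box by blast
    show "emeasure ?P X = emeasure ?N X" if "X \<in> range (\<lambda>(a, b). box a b)" for X
      using that box by auto
  qed auto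
  then have "AE x in lborel. ennreal (W x) = ennreal (- W x)"
    by (intro sigma_finite_measure.density_unique[OF lborel.sigma_finite_measure_axioms]) auto
  then show ?thesis
  proof eventually_elim
    case (elim x)
    then show ?case by (cases "0 \<le> W x") (auto simp: ennreal_neg ennreal_eq_0_iff)
  qed
qed

text \<open>Translation by \<open>\<theta> *\<^sub>R w\<close> at each fixed \<theta> moves the
  segment average from \<open>G\<close> onto the bounded, compactly supported factor, so that local
  integrability of \<open>G\<close> suffices.\<close>

lemma Fubini_segment:
  fixes G \<psi> :: "real ^ 'n \<Rightarrow> real" and w :: "real ^ 'n"
  assumes G [measurable]: "G \<in> borel_measurable borel" and Gi: "\<And>R. integrable lborel (\<lambda>x. indicator (cball 0 R) x * G x)"
    and \<psi> [measurable]: "\<psi> \<in> borel_measurable borel" and \<psi>1: "\<And>x. \<bar>\<psi> x\<bar> \<le> 1" and \<psi>R: "\<And>x. x \<notin> cball 0 R \<Longrightarrow> \<psi> x = 0"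
  shows "integrable lborel (\<lambda>x. \<psi> x * (\<integral>\<theta>. indicator {0..1} \<theta> * G (x + \<theta> *\<^sub>R w) \<partial>lborel))"
    "(\<integral>x. \<psi> x * (\<integral>\<theta>. indicator {0..1} \<theta> * G (x + \<theta> *\<^sub>R w) \<partial>lborel) \<partial>lborel)
      = (\<integral>x. G x * (\<integral>\<theta>. indicator {0..1} \<theta> * \<psi> (x - \<theta> *\<^sub>R w) \<partial>lborel) \<partial>lborel)"
proof -
  define p where "p \<theta> x = indicator {0..1} \<theta> * (\<psi> x * G (x + \<theta> *\<^sub>R w))" for \<theta> x
  define q where "q \<theta> x = indicator {0..1} \<theta> * (\<psi> (x - \<theta> *\<^sub>R w) * G x)" for \<theta> x
  have pm [measurable]: "(\<lambda>(\<theta>, x). p \<theta> x) \<in> borel_measurable (lborel \<Otimes>\<^sub>M lborel)" unfolding p_def by measurable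
  have qm [measurable]: "(\<lambda>(\<theta>, x). q \<theta> x) \<in> borel_measurable (lborel \<Otimes>\<^sub>M lborel)" unfolding q_def by measurable
  have pq: "p \<theta> x = q \<theta> (x + \<theta> *\<^sub>R w)" for \<theta> x by (simp add: p_def q_def)
  \<comment> \<open>Translates of the support of \<open>\<psi>\<close> along the segment stay in the
    ball of radius \<open>R + norm w\<close>; this integral bounds all slices at once.\<close>
  let ?B = "\<integral>\<^sup>+x. ennreal (norm (indicator (cball 0 (R + norm w)) x * G x)) \<partial>lborel"
  have B: "?B < \<infinity>" using Gi[of "R + norm w"] by (simp add: integrable_iff_bounded)
  have qb: "(\<integral>\<^sup>+x. ennreal (norm (q \<theta> x)) \<partial>lborel) \<le> indicator {0..1} \<theta> * ?B" for \<theta>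
  proof (cases "\<theta> \<in> {0..1}")
    case True
    have "norm (q \<theta> x) \<le> norm (indicator (cball 0 (R + norm w)) x * G x)" for x
    proof (cases "x \<in> cball 0 (R + norm w)")
      case True
      then show ?thesis using \<psi>1[of "x - \<theta> *\<^sub>R w"] by (simp add: q_def abs_mult mult_left_le_one_le indicator_def)
    next
      case False
      have "norm x \<le> norm (x - \<theta> *\<^sub>R w) + norm (\<theta> *\<^sub>R w)" using norm_triangle_ineq[of "x - \<theta> *\<^sub>R w" "\<theta> *\<^sub>R w"] by simp
      also have "norm (\<theta> *\<^sub>R w) \<le> norm w" using \<open>\<theta> \<in> {0..1}\<close> by (simp add: mult_left_le_one_le)
      finally have "x - \<theta> *\<^sub>R w \<notin> cball 0 R" using False by simp
      then show ?thesis using \<psi>R by (simp add: q_def)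
    qed
    then show ?thesis using True by (auto intro!: nn_integral_mono ennreal_leI)
  qed (simp add: q_def)
  have "(\<integral>\<^sup>+z. ennreal (norm (case z of (\<theta>, x) \<Rightarrow> q \<theta> x)) \<partial>(lborel \<Otimes>\<^sub>M lborel)) = (\<integral>\<^sup>+\<theta>. \<integral>\<^sup>+x. ennreal (norm (q \<theta> x)) \<partial>lborel \<partial>lborel)"
    by (subst lborel.nn_integral_fst[symmetric]) auto
  also have "\<dots> \<le> (\<integral>\<^sup>+\<theta>. indicator {0..1} \<theta> * ?B \<partial>(lborel :: real measure))" by (intro nn_integral_mono qb)
  also have "\<dots> = ?B" by (simp add: nn_integral_multc)
  finally have qfin: "(\<integral>\<^sup>+z. ennreal (norm (case z of (\<theta>, x) \<Rightarrow> q \<theta> x)) \<partial>(lborel \<Otimes>\<^sub>M lborel)) < \<infinity>"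
    using B by (rule le_less_trans)
  then have qi: "integrable (lborel \<Otimes>\<^sub>M lborel) (\<lambda>(\<theta>, x). q \<theta> x)"
    by (intro integrableI_bounded) auto
  have q\<theta>: "q \<theta> \<in> borel_measurable borel" for \<theta> unfolding q_def by measurable
  have "(\<integral>\<^sup>+z. ennreal (norm (case z of (\<theta>, x) \<Rightarrow> p \<theta> x)) \<partial>(lborel \<Otimes>\<^sub>M lborel)) = (\<integral>\<^sup>+\<theta>. \<integral>\<^sup>+x. ennreal (norm (p \<theta> x)) \<partial>lborel \<partial>lborel)"
    by (subst lborel.nn_integral_fst[symmetric]) auto
  also have "\<dots> = (\<integral>\<^sup>+\<theta>. \<integral>\<^sup>+x. ennreal (norm (q \<theta> x)) \<partial>lborel \<partial>lborel)"
    unfolding pq using q\<theta> by (intro nn_integral_cong nn_integral_lborel_shift) auto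
  also have "\<dots> = (\<integral>\<^sup>+z. ennreal (norm (case z of (\<theta>, x) \<Rightarrow> q \<theta> x)) \<partial>(lborel \<Otimes>\<^sub>M lborel))"
    by (subst lborel.nn_integral_fst[symmetric]) auto
  finally have pi: "integrable (lborel \<Otimes>\<^sub>M lborel) (\<lambda>(\<theta>, x). p \<theta> x)"
    using qfin by (intro integrableI_bounded) auto
  have pint: "\<psi> x * (\<integral>\<theta>. indicator {0..1} \<theta> * G (x + \<theta> *\<^sub>R w) \<partial>lborel) = (\<integral>\<theta>. p \<theta> x \<partial>lborel)" for x
    unfolding p_def by (subst integral_mult_right_zero[symmetric]) (simp add: mult.left_commute)
  have qint: "G x * (\<integral>\<theta>. indicator {0..1} \<theta> * \<psi> (x - \<theta> *\<^sub>R w) \<partial>lborel) = (\<integral>\<theta>. q \<theta> x \<partial>lborel)" for x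
    unfolding q_def by (subst integral_mult_right_zero[symmetric]) (simp add: mult_ac)
  show "integrable lborel (\<lambda>x. \<psi> x * (\<integral>\<theta>. indicator {0..1} \<theta> * G (x + \<theta> *\<^sub>R w) \<partial>lborel))"
    unfolding pint using lborel_pair.integrable_snd[OF pi] by simp
  have "(\<integral>x. \<integral>\<theta>. p \<theta> x \<partial>lborel \<partial>lborel) = (\<integral>\<theta>. \<integral>x. p \<theta> x \<partial>lborel \<partial>lborel)"
    using lborel_pair.integral_snd[OF pi] lborel_pair.integral_fst[OF pi] by simp
  also have "\<dots> = (\<integral>\<theta>. \<integral>x. q \<theta> x \<partial>lborel \<partial>lborel)"
    unfolding pq using q\<theta> by (intro Bochner_Integration.integral_cong refl integral_lborel_shift) auto
  also have "\<dots> = (\<integral>x. \<integral>\<theta>. q \<theta> x \<partial>lborel \<partial>lborel)"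
    using lborel_pair.integral_snd[OF qi] lborel_pair.integral_fst[OF qi] by simp
  finally show "(\<integral>x. \<psi> x * (\<integral>\<theta>. indicator {0..1} \<theta> * G (x + \<theta> *\<^sub>R w) \<partial>lborel) \<partial>lborel)
      = (\<integral>x. G x * (\<integral>\<theta>. indicator {0..1} \<theta> * \<psi> (x - \<theta> *\<^sub>R w) \<partial>lborel) \<partial>lborel)"
    unfolding pint qint .
qed

text \<open>The defect \<open>W\<close> has integral 0 against every product of bumps, hence over
  every box. Integration by parts is assumed only for tensor products, and for the one direction
  \<open>j\<close>.\<close>

lemma weak_derivative_difference:
  fixes F G :: "real ^ 'n \<Rightarrow> real"
  assumes F [measurable]: "F \<in> borel_measurable borel" and Fi: "\<And>R. integrable lborel (\<lambda>x. indicator (cball 0 R) x * F x)"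
    and G [measurable]: "G \<in> borel_measurable borel" and Gi: "\<And>R. integrable lborel (\<lambda>x. indicator (cball 0 R) x * G x)"
    and weak: "\<And>h d a b. (\<And>i. smooth1 (h i)) \<Longrightarrow> (\<And>i t. t \<notin> {a i..b i} \<Longrightarrow> h i t = 0) \<Longrightarrow>
      (\<And>t. (h j has_real_derivative d t) (at t)) \<Longrightarrow> smooth1 d \<Longrightarrow>
      (\<integral>x. F x * (\<Prod>i\<in>UNIV. (h(j := d)) i (x $ i)) \<partial>lborel) = - (\<integral>x. G x * (\<Prod>i\<in>UNIV. h i (x $ i)) \<partial>lborel)"
  shows "AE x in lborel. F (x + s *\<^sub>R axis j 1) - F x
    = (\<integral>\<theta>. indicator {0..1} \<theta> * (s * G (x + \<theta> *\<^sub>R (s *\<^sub>R axis j 1))) \<partial>lborel)"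
proof -
  define w :: "real ^ 'n" where "w = s *\<^sub>R axis j 1"
  define I where "I x = (\<integral>\<theta>. indicator {0..1} \<theta> * (s * G (x + \<theta> *\<^sub>R w)) \<partial>lborel)" for x
  have I [measurable]: "I \<in> borel_measurable borel"
    unfolding I_def by (rule lborel.borel_measurable_lebesgue_integral) measurable
  define W where "W x = F (x + w) - F x - I x" for x
  have W [measurable]: "W \<in> borel_measurable borel" unfolding W_def by measurable
  have sGi: "integrable lborel (\<lambda>x. indicator (cball 0 R) x * (s * G x))" for R
    using integrable_mult_right[OF Gi[of R], of s] by (simp add: mult.left_commute)
  have Fint: "integrable lborel (\<lambda>x. \<psi> x * F x)"
    if [measurable]: "\<psi> \<in> borel_measurable borel" and "\<And>x. \<bar>\<psi> x\<bar> \<le> 1" "\<And>x. x \<notin> cball 0 R \<Longrightarrow> \<psi> x = 0" for \<psi> R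
  proof (rule Bochner_Integration.integrable_bound[OF Fi[of R]])
    show "AE x in lborel. norm (\<psi> x * F x) \<le> norm (indicator (cball 0 R) x * F x)"
    proof (rule AE_I2)
      fix x
      show "norm (\<psi> x * F x) \<le> norm (indicator (cball 0 R) x * F x)"
        using that(2)[of x] that(3)[of x]
        by (cases "x \<in> cball 0 R") (auto simp: abs_mult mult_left_le_one_le)
    qed
  qed measurable
  have Fshift: "integrable lborel (\<lambda>x. \<psi> x * F (x + w))"
      "(\<integral>x. \<psi> x * F (x + w) \<partial>lborel) = (\<integral>x. \<psi> (x - w) * F x \<partial>lborel)"
      "integrable lborel (\<lambda>x. \<psi> (x - w) * F x)"
    if \<psi> [measurable]: "\<psi> \<in> borel_measurable borel" and \<psi>1: "\<And>x. \<bar>\<psi> x\<bar> \<le> 1" and \<psi>R: "\<And>x. x \<notin> cball 0 R \<Longrightarrow> \<psi> x = 0" for \<psi> R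
  proof -
    show i: "integrable lborel (\<lambda>x. \<psi> (x - w) * F x)"
    proof (rule Fint[where R = "R + norm w"])
      fix x :: "real ^ 'n" assume "x \<notin> cball 0 (R + norm w)"
      then show "\<psi> (x - w) = 0"
        using norm_triangle_ineq2[of x w] by (intro \<psi>R) simp
    qed (use \<psi>1 in auto)
    show "integrable lborel (\<lambda>x. \<psi> x * F (x + w))"
      using integral_lborel_shift(2)[of "\<lambda>x. \<psi> (x - w) * F x" w] i by simp
    show "(\<integral>x. \<psi> x * F (x + w) \<partial>lborel) = (\<integral>x. \<psi> (x - w) * F x \<partial>lborel)"
      using integral_lborel_shift(1)[of "\<lambda>x. \<psi> (x - w) * F x" w] by simp
  qed
  have Iint: "integrable lborel (\<lambda>x. \<psi> x * I x)"
      "(\<integral>x. \<psi> x * I x \<partial>lborel) = (\<integral>x. s * G x * (\<integral>\<theta>. indicator {0..1} \<theta> * \<psi> (x - \<theta> *\<^sub>R w) \<partial>lborel) \<partial>lborel)"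
    if [measurable]: "\<psi> \<in> borel_measurable borel" and "\<And>x. \<bar>\<psi> x\<bar> \<le> 1" "\<And>x. x \<notin> cball 0 R \<Longrightarrow> \<psi> x = 0" for \<psi> R
    using Fubini_segment[of "\<lambda>x. s * G x" \<psi> R w] that sGi unfolding I_def by auto
  have Wint: "integrable lborel (\<lambda>x. \<psi> x * W x)"
    if "\<psi> \<in> borel_measurable borel" and "\<And>x. \<bar>\<psi> x\<bar> \<le> 1" "\<And>x. x \<notin> cball 0 R \<Longrightarrow> \<psi> x = 0" for \<psi> R
    using Fint[OF that] Fshift(1)[OF that] Iint(1)[OF that] unfolding W_def right_diff_distrib
    by (intro Bochner_Integration.integrable_diff)
  have box_int: "integrable lborel (\<lambda>x. indicator (box a b) x * W x)" for a b
  proof -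
    obtain R where "box a b \<subseteq> cball 0 R" using bounded_subset_ballD[OF bounded_box[of a b], of 0] ball_subset_cball by blast
    then show ?thesis by (intro Wint[where R = R]) (auto simp: indicator_def)
  qed
  have zero: "(\<integral>x. indicator (box a b) x * W x \<partial>lborel) = 0" for a b
  proof -
    obtain R where R: "cbox a b \<subseteq> cball 0 R" using bounded_subset_ballD[OF bounded_cbox[of a b], of 0] ball_subset_cball by blast
    define \<phi> where "\<phi> k x = (\<Prod>i\<in>UNIV. bump k (a $ i) (b $ i) (x $ i))" for k x
    have \<phi>m [measurable]: "\<phi> k \<in> borel_measurable borel" for k
      unfolding \<phi>_def using smooth1_measurable[OF smooth1_bump]
      by (intro borel_measurable_prod measurable_compose[OF _ smooth1_measurable[OF smooth1_bump]]) simp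
    have \<phi>1: "\<bar>\<phi> k x\<bar> \<le> 1" for k x
      unfolding \<phi>_def using bump_bounds by (auto simp: abs_prod intro!: prod_le_1)
    have \<phi>0: "\<phi> k x = 0" if "x \<notin> box a b" for k x
    proof -
      obtain i where "x $ i \<notin> {a $ i<..<b $ i}" using \<open>x \<notin> box a b\<close> by (auto simp: mem_box_cart)
      then have "bump k (a $ i) (b $ i) (x $ i) = 0" by (rule bump_eq_0)
      then show ?thesis unfolding \<phi>_def by (intro prod_zero) auto
    qed
    have \<phi>R: "\<phi> k x = 0" if "x \<notin> cball 0 R" for k x
      using that R box_subset_cbox[of a b] by (intro \<phi>0) blast
    have \<phi>W: "(\<integral>x. \<phi> k x * W x \<partial>lborel) = 0" for k
    proof -
      let ?h = "\<lambda>i. bump k (a $ i) (b $ i)"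
      obtain H where H: "smooth1 H" "\<And>t. (H has_real_derivative ?h j t) (at t)"
        using smooth1_antiderivative[OF smooth1_bump] by blast
      \<comment> \<open>An antiderivative of the bump is not compactly supported, but its difference
        with a translate is, because the two constants beyond the support cancel.\<close>
      define K where "K t = H t - H (t - s)" for t
      define d where "d t = ?h j t - ?h j (t - s)" for t
      define hh where "hh = ?h(j := K)"
      have Hs: "smooth1 (\<lambda>t. H (t - s))" "smooth1 (\<lambda>t. ?h j (t - s))"
        using smooth1_affine[OF H(1), of 1 "- s"] smooth1_affine[OF smooth1_bump, of k "a $ j" "b $ j" 1 "- s"] by simp_all
      have K: "smooth1 K" "smooth1 d"
        unfolding K_def[abs_def] d_def[abs_def] using Hs H(1) by (auto intro!: smooth1_diff smooth1_bump)
      have Kd: "(K has_real_derivative d t) (at t)" for t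
        unfolding K_def d_def by (auto intro!: derivative_eq_intros DERIV_chain2[OF H(2)] H(2))
      \<comment> \<open>\<open>K\<close> is \<open>s\<close> times the average of the bump over the
        segment from t to t - s. The weak identity therefore puts a segment average of the test
        function against \<open>G\<close>.\<close>
      have ftc: "(\<integral>\<theta>. (s * ?h j (t - \<theta> * s)) * indicator {0..1} \<theta> \<partial>lborel) = K t" for t
      proof -
        have "(\<integral>\<theta>. (s * ?h j (t - \<theta> * s)) * indicator {0..1} \<theta> \<partial>lborel) = - H (t - 1 * s) - - H (t - 0 * s)"
        proof (rule integral_FTC_Icc_real)
          show "((\<lambda>\<theta>. - H (t - \<theta> * s)) has_real_derivative s * ?h j (t - \<theta> * s)) (at \<theta>)" for \<theta>
            by (auto intro!: derivative_eq_intros DERIV_chain2[OF H(2)])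
          have "continuous_on UNIV (\<lambda>\<theta>. s * ?h j (t - \<theta> * s))"
            by (intro continuous_intros continuous_on_compose2[OF smooth1_continuous[OF smooth1_bump]]) auto
          then show "isCont (\<lambda>\<theta>. s * ?h j (t - \<theta> * s)) \<theta>" for \<theta>
            by (simp add: continuous_on_eq_continuous_at)
        qed auto
        then show ?thesis by (simp add: K_def)
      qed
      have hj0: "?h j t = 0" if "t \<notin> {a $ j..b $ j}" for t using that by (intro bump_eq_0) auto
      \<comment> \<open>The support of the bump swept along the shift; minimum and maximum allow for
        either sign of \<open>s\<close>.\<close>
      have K0: "K t = 0" if t: "t \<notin> {min (a $ j) (a $ j + s)..max (b $ j) (b $ j + s)}" for t
      proof -
        have "?h j (t - \<theta> * s) * indicator {0..1} \<theta> = 0" for \<theta>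
        proof (cases "\<theta> \<in> {0..1}")
          case True
          have "min 0 s \<le> \<theta> * s \<and> \<theta> * s \<le> max 0 s"
          proof (cases "0 \<le> s")
            case True
            then show ?thesis using \<open>\<theta> \<in> {0..1}\<close> by (simp add: mult_left_le_one_le)
          next
            case False
            then show ?thesis using \<open>\<theta> \<in> {0..1}\<close> mult_right_mono_neg[of \<theta> 1 s]
              by (simp add: mult_nonneg_nonpos)
          qed
          then have "t - \<theta> * s \<notin> {a $ j..b $ j}" using t by auto
          then show ?thesis using hj0 by simp
        qed simp
        then have "(\<lambda>\<theta>. (s * ?h j (t - \<theta> * s)) * indicator {0..1} \<theta>) = (\<lambda>\<theta>. 0)"
          by (simp only: mult.assoc mult_zero_right)
        then show ?thesis using ftc[of t] by simp
      qed
      let ?P = "\<lambda>x. \<Prod>i\<in>UNIV - {j}. ?h i (x $ i)"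
      have P_shift: "?P (x - \<theta> *\<^sub>R w) = ?P x" for x \<theta>
        by (intro prod.cong) (auto simp: w_def axis_def)
      have \<phi>_split: "\<phi> k x = ?h j (x $ j) * ?P x" for x
        unfolding \<phi>_def by (subst prod.remove[of UNIV j]) auto
      have \<phi>_shift: "\<phi> k (x - \<theta> *\<^sub>R w) = ?h j (x $ j - \<theta> * s) * ?P x" for x \<theta>
        unfolding \<phi>_split P_shift by (simp add: w_def axis_def)
      have prod_d: "(\<Prod>i\<in>UNIV. (hh(j := d)) i (x $ i)) = \<phi> k x - \<phi> k (x - w)" for x
        using \<phi>_shift[of x 1] unfolding hh_def d_def \<phi>_split
        by (subst prod.remove[of UNIV j]) (auto simp: left_diff_distrib)
      have prod_K: "(\<Prod>i\<in>UNIV. hh i (x $ i)) = s * (\<integral>\<theta>. indicator {0..1} \<theta> * \<phi> k (x - \<theta> *\<^sub>R w) \<partial>lborel)" for x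
      proof -
        have "(\<Prod>i\<in>UNIV. hh i (x $ i)) = K (x $ j) * ?P x"
          unfolding hh_def by (subst prod.remove[of UNIV j]) auto
        also have "\<dots> = (\<integral>\<theta>. (s * ?h j (x $ j - \<theta> * s)) * indicator {0..1} \<theta> \<partial>lborel) * ?P x"
          by (simp only: ftc)
        also have "\<dots> = (\<integral>\<theta>. (s * ?h j (x $ j - \<theta> * s)) * indicator {0..1} \<theta> * ?P x \<partial>lborel)"
          by (rule integral_mult_left_zero[symmetric])
        also have "\<dots> = (\<integral>\<theta>. s * (indicator {0..1} \<theta> * \<phi> k (x - \<theta> *\<^sub>R w)) \<partial>lborel)"
          unfolding \<phi>_shift by (simp add: mult_ac)
        also have "\<dots> = s * (\<integral>\<theta>. indicator {0..1} \<theta> * \<phi> k (x - \<theta> *\<^sub>R w) \<partial>lborel)"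
          by (rule integral_mult_right_zero)
        finally show ?thesis .
      qed
      have "(\<integral>x. F x * (\<Prod>i\<in>UNIV. (hh(j := d)) i (x $ i)) \<partial>lborel) = - (\<integral>x. G x * (\<Prod>i\<in>UNIV. hh i (x $ i)) \<partial>lborel)"
      proof (rule weak)
        show "smooth1 (hh i)" for i using K(1) smooth1_bump by (simp add: hh_def)
        show "hh i t = 0" if "t \<notin> {(if i = j then min (a $ j) (a $ j + s) else a $ i)..(if i = j then max (b $ j) (b $ j + s) else b $ i)}" for i t
          using that K0[of t] bump_eq_0[of t "a $ i" "b $ i" k] by (auto simp: hh_def split: if_splits)
        show "(hh j has_real_derivative d t) (at t)" for t using Kd by (simp add: hh_def)
      qed (rule K(2))
      then have eq: "(\<integral>x. F x * (\<phi> k x - \<phi> k (x - w)) \<partial>lborel)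
        = - (\<integral>x. s * G x * (\<integral>\<theta>. indicator {0..1} \<theta> * \<phi> k (x - \<theta> *\<^sub>R w) \<partial>lborel) \<partial>lborel)"
        unfolding prod_d prod_K by (simp add: mult_ac)
      have i1: "integrable lborel (\<lambda>x. \<phi> k x * F x)" by (rule Fint[OF \<phi>m \<phi>1 \<phi>R])
      have sh: "integrable lborel (\<lambda>x. \<phi> k x * F (x + w))"
        "(\<integral>x. \<phi> k x * F (x + w) \<partial>lborel) = (\<integral>x. \<phi> k (x - w) * F x \<partial>lborel)"
        "integrable lborel (\<lambda>x. \<phi> k (x - w) * F x)"
        using Fshift[of "\<phi> k" R] \<phi>m \<phi>1 \<phi>R by blast+
      have Ii: "integrable lborel (\<lambda>x. \<phi> k x * I x)"
        "(\<integral>x. \<phi> k x * I x \<partial>lborel) = (\<integral>x. s * G x * (\<integral>\<theta>. indicator {0..1} \<theta> * \<phi> k (x - \<theta> *\<^sub>R w) \<partial>lborel) \<partial>lborel)"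
        using Iint[of "\<phi> k" R] \<phi>m \<phi>1 \<phi>R by blast+
      have "(\<integral>x. F x * (\<phi> k x - \<phi> k (x - w)) \<partial>lborel) = (\<integral>x. \<phi> k x * F x - \<phi> k (x - w) * F x \<partial>lborel)"
        by (intro Bochner_Integration.integral_cong) (auto simp: algebra_simps)
      also have "\<dots> = (\<integral>x. \<phi> k x * F x \<partial>lborel) - (\<integral>x. \<phi> k x * F (x + w) \<partial>lborel)"
        unfolding sh(2) by (rule Bochner_Integration.integral_diff[OF i1 sh(3)])
      finally have "(\<integral>x. \<phi> k x * F x \<partial>lborel) - (\<integral>x. \<phi> k x * F (x + w) \<partial>lborel) = - (\<integral>x. \<phi> k x * I x \<partial>lborel)"
        using eq Ii(2) by simp
      moreover have "(\<integral>x. \<phi> k x * W x \<partial>lborel)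
        = (\<integral>x. \<phi> k x * F (x + w) \<partial>lborel) - (\<integral>x. \<phi> k x * F x \<partial>lborel) - (\<integral>x. \<phi> k x * I x \<partial>lborel)"
        unfolding W_def right_diff_distrib using i1 sh(1) Ii(1)
        by (simp add: Bochner_Integration.integral_diff Bochner_Integration.integrable_diff)
      ultimately show ?thesis by simp
    qed
    \<comment> \<open>All \<open>\<phi> k\<close> vanish off the box and are bounded by 1, so the
      restriction of \<open>W\<close> to the box dominates.\<close>
    have "(\<lambda>k. \<integral>x. \<phi> k x * W x \<partial>lborel) \<longlonglongrightarrow> (\<integral>x. indicator (box a b) x * W x \<partial>lborel)"
    proof (rule integral_dominated_convergence[where w = "\<lambda>x. norm (indicator (box a b) x * W x)"])
      show "AE x in lborel. (\<lambda>k. \<phi> k x * W x) \<longlonglongrightarrow> indicator (box a b) x * W x"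
      proof (rule AE_I2)
        fix x
        have "(\<lambda>k. \<phi> k x) \<longlonglongrightarrow> (\<Prod>i\<in>UNIV. indicator {a $ i<..<b $ i} (x $ i))"
          unfolding \<phi>_def by (intro tendsto_prod bump_tendsto)
        also have "(\<Prod>i\<in>UNIV. indicator {a $ i<..<b $ i} (x $ i)) = (indicator (box a b) x :: real)"
          by (auto simp: indicator_def mem_box_cart)
        finally show "(\<lambda>k. \<phi> k x * W x) \<longlonglongrightarrow> indicator (box a b) x * W x" by (intro tendsto_mult tendsto_const)
      qed
      show "AE x in lborel. norm (\<phi> k x * W x) \<le> norm (indicator (box a b) x * W x)" for k
      proof (rule AE_I2)
        fix x
        show "norm (\<phi> k x * W x) \<le> norm (indicator (box a b) x * W x)"
          using \<phi>0[of x k] \<phi>1[of k x] by (cases "x \<in> box a b") (auto simp: abs_mult mult_left_le_one_le)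
      qed
    qed (use box_int in auto)
    then show ?thesis unfolding \<phi>W by (simp add: LIMSEQ_const_iff)
  qed
  have "AE x in lborel. W x = 0" by (rule AE_eq_0_if_box_integrals_0[OF W box_int zero])
  then show ?thesis by eventually_elim (simp add: W_def I_def w_def)
qed

text \<open>For each \<theta> in [0, 1] the ball translated by \<open>\<theta> *\<^sub>R w\<close>
  stays inside \<open>ball z R\<close>. The dominating \<open>h\<close> in place of \<open>G\<close>
  makes the bound the same for all directions.\<close>

lemma nn_integral_difference_le:
  fixes F G h :: "real ^ 'n \<Rightarrow> real"
  assumes [measurable]: "F \<in> borel_measurable borel" "G \<in> borel_measurable borel" "h \<in> borel_measurable borel"
    and Gh: "AE x in lborel. \<bar>G x\<bar> \<le> h x"
    and diff: "AE x in lborel. F (x + w) - F x = (\<integral>\<theta>. indicator {0..1} \<theta> * (s * G (x + \<theta> *\<^sub>R w)) \<partial>lborel)"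
    and R: "dist y z + norm w + r \<le> R"
  shows "(\<integral>\<^sup>+x\<in>ball y r. ennreal \<bar>F (x + w) - F x\<bar> \<partial>lborel) \<le> ennreal \<bar>s\<bar> * (\<integral>\<^sup>+x\<in>ball z R. ennreal (h x) \<partial>lborel)"
proof -
  have [measurable]: "ball y r \<in> sets borel" "ball z R \<in> sets borel" by simp_all
  have "(\<integral>\<^sup>+x\<in>ball y r. ennreal \<bar>F (x + w) - F x\<bar> \<partial>lborel)
    \<le> (\<integral>\<^sup>+x. (\<integral>\<^sup>+\<theta>. indicator {0..1} \<theta> * (ennreal (\<bar>s\<bar> * \<bar>G (x + \<theta> *\<^sub>R w)\<bar>) * indicator (ball y r) x) \<partial>lborel) \<partial>lborel)"
  proof (rule nn_integral_mono_AE)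
    show "AE x in lborel. ennreal \<bar>F (x + w) - F x\<bar> * indicator (ball y r) x
      \<le> (\<integral>\<^sup>+\<theta>. indicator {0..1} \<theta> * (ennreal (\<bar>s\<bar> * \<bar>G (x + \<theta> *\<^sub>R w)\<bar>) * indicator (ball y r) x) \<partial>lborel)"
      using diff
    proof eventually_elim
      fix x assume eq: "F (x + w) - F x = (\<integral>\<theta>. indicator {0..1} \<theta> * (s * G (x + \<theta> *\<^sub>R w)) \<partial>lborel)"
      let ?k = "\<lambda>\<theta>. indicator {0..1} \<theta> * (s * G (x + \<theta> *\<^sub>R w))"
      have "ennreal (norm (\<integral>\<theta>. ?k \<theta> \<partial>lborel)) \<le> (\<integral>\<^sup>+\<theta>. ennreal (norm (?k \<theta>)) \<partial>lborel)"
      \<comment> \<open>On segments where the integral does not exist it is 0 by convention, and the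
        bound is trivial.\<close>
      proof (cases "integrable lborel ?k")
        case True
        then show ?thesis by (rule integral_norm_bound_ennreal)
      qed (simp add: not_integrable_integral_eq)
      also have "\<dots> = (\<integral>\<^sup>+\<theta>. indicator {0..1} \<theta> * ennreal (\<bar>s\<bar> * \<bar>G (x + \<theta> *\<^sub>R w)\<bar>) \<partial>lborel)"
        by (intro nn_integral_cong) (auto simp: indicator_def abs_mult)
      finally show "ennreal \<bar>F (x + w) - F x\<bar> * indicator (ball y r) x
        \<le> (\<integral>\<^sup>+\<theta>. indicator {0..1} \<theta> * (ennreal (\<bar>s\<bar> * \<bar>G (x + \<theta> *\<^sub>R w)\<bar>) * indicator (ball y r) x) \<partial>lborel)"
        unfolding eq by (cases "x \<in> ball y r") auto
    qed
  qed
  also have "\<dots> = (\<integral>\<^sup>+\<theta>. (\<integral>\<^sup>+x. indicator {0..1} \<theta> * (ennreal (\<bar>s\<bar> * \<bar>G (x + \<theta> *\<^sub>R w)\<bar>) * indicator (ball y r) x) \<partial>lborel) \<partial>lborel)"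
    by (rule lborel_pair.Fubini'[symmetric]) measurable
  also have "\<dots> \<le> (\<integral>\<^sup>+\<theta>. indicator {0..1} \<theta> * (ennreal \<bar>s\<bar> * (\<integral>\<^sup>+x\<in>ball z R. ennreal (h x) \<partial>lborel)) \<partial>(lborel :: real measure))"
  proof (rule nn_integral_mono)
    fix \<theta> :: real
    show "(\<integral>\<^sup>+x. indicator {0..1} \<theta> * (ennreal (\<bar>s\<bar> * \<bar>G (x + \<theta> *\<^sub>R w)\<bar>) * indicator (ball y r) x) \<partial>lborel)
      \<le> indicator {0..1} \<theta> * (ennreal \<bar>s\<bar> * (\<integral>\<^sup>+x\<in>ball z R. ennreal (h x) \<partial>lborel))"
    proof (cases "\<theta> \<in> {0..1}")
      case True
      let ?c = "\<theta> *\<^sub>R w"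
      have nw: "norm ?c \<le> norm w" using True by (simp add: mult_left_le_one_le)
      have "(\<integral>\<^sup>+x. ennreal (\<bar>s\<bar> * \<bar>G (x + ?c)\<bar>) * indicator (ball y r) x \<partial>lborel)
        = (\<integral>\<^sup>+x. ennreal (\<bar>s\<bar> * \<bar>G x\<bar>) * indicator (ball (y + ?c) r) x \<partial>lborel)"
      proof -
        have [measurable]: "ball (y + ?c) r \<in> sets borel" by simp
        have "(\<integral>\<^sup>+x. ennreal (\<bar>s\<bar> * \<bar>G (x + ?c)\<bar>) * indicator (ball (y + ?c) r) (x + ?c) \<partial>lborel)
          = (\<integral>\<^sup>+x. ennreal (\<bar>s\<bar> * \<bar>G x\<bar>) * indicator (ball (y + ?c) r) x \<partial>lborel)"
          by (rule nn_integral_lborel_shift) measurable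
        moreover have "indicator (ball (y + ?c) r) (x + ?c) = (indicator (ball y r) x :: ennreal)" for x
          by (simp add: indicator_def dist_norm)
        ultimately show ?thesis by simp
      qed
      also have "\<dots> \<le> (\<integral>\<^sup>+x. ennreal \<bar>s\<bar> * (ennreal (h x) * indicator (ball z R) x) \<partial>lborel)"
      proof (rule nn_integral_mono_AE)
        show "AE x in lborel. ennreal (\<bar>s\<bar> * \<bar>G x\<bar>) * indicator (ball (y + ?c) r) x
          \<le> ennreal \<bar>s\<bar> * (ennreal (h x) * indicator (ball z R) x)"
          using Gh
        proof eventually_elim
          fix x assume gh: "\<bar>G x\<bar> \<le> h x"
          show "ennreal (\<bar>s\<bar> * \<bar>G x\<bar>) * indicator (ball (y + ?c) r) x
            \<le> ennreal \<bar>s\<bar> * (ennreal (h x) * indicator (ball z R) x)"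
          proof (cases "x \<in> ball (y + ?c) r")
            case True
            have "dist z x \<le> dist z y + dist y (y + ?c) + dist (y + ?c) x"
              by (meson add_mono dist_triangle order_refl order_trans)
            then have "dist z x < R" using True nw R by (simp add: dist_norm norm_minus_commute)
            moreover have "\<bar>s\<bar> * \<bar>G x\<bar> \<le> \<bar>s\<bar> * h x" using gh by (intro mult_left_mono) auto
            ultimately show ?thesis using True by (simp add: ennreal_mult'[symmetric] ennreal_leI)
          qed simp
        qed
      qed
      also have "\<dots> = ennreal \<bar>s\<bar> * (\<integral>\<^sup>+x\<in>ball z R. ennreal (h x) \<partial>lborel)"
        by (rule nn_integral_cmult) measurable
      finally show ?thesis using True by simp
    qed simp
  qed
  also have "\<dots> = ennreal \<bar>s\<bar> * (\<integral>\<^sup>+x\<in>ball z R. ennreal (h x) \<partial>lborel)"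
    by (simp add: nn_integral_multc)
  finally show ?thesis .
qed

text \<open>The points \<open>x + P I\<close> follow a path of axis-parallel steps from
  \<open>x\<close> to \<open>x + v\<close>. Each partial sum has norm at most \<open>norm v\<close>,
  and so has each step; these two displacements make up \<open>2 * norm v\<close> in the
  radius.\<close>

lemma nn_integral_translate_le:
  fixes F h :: "real ^ 'n \<Rightarrow> real"
  assumes F [measurable]: "F \<in> borel_measurable borel" and h [measurable]: "h \<in> borel_measurable borel"
    and step: "\<And>j s y z r R. dist y z + \<bar>s\<bar> + r \<le> R \<Longrightarrow>
      (\<integral>\<^sup>+x\<in>ball y r. ennreal \<bar>F (x + s *\<^sub>R axis j 1) - F x\<bar> \<partial>lborel) \<le> ennreal \<bar>s\<bar> * (\<integral>\<^sup>+x\<in>ball z R. ennreal (h x) \<partial>lborel)"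
  shows "(\<integral>\<^sup>+x\<in>ball z r. ennreal \<bar>F (x + v) - F x\<bar> \<partial>lborel)
    \<le> ennreal (real CARD('n) * norm v) * (\<integral>\<^sup>+x\<in>ball z (r + 2 * norm v). ennreal (h x) \<partial>lborel)"
proof -
  define P :: "'n set \<Rightarrow> real ^ 'n" where "P I = (\<Sum>i\<in>I. (v $ i) *\<^sub>R axis i 1)" for I
  let ?J = "\<integral>\<^sup>+x\<in>ball z (r + 2 * norm v). ennreal (h x) \<partial>lborel"
  have P_nth: "P I $ i = (if i \<in> I then v $ i else 0)" for I i
    by (simp add: P_def axis_def if_distrib[of "\<lambda>x. _ * x"] cong: if_cong)
  have Pn: "norm (P I) \<le> norm v" for I
    by (rule norm_le_componentwise_cart) (simp add: P_nth)
  have PU: "P UNIV = v" by (simp add: vec_eq_iff P_nth)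
  have "(\<integral>\<^sup>+x\<in>ball z r. ennreal \<bar>F (x + P I) - F x\<bar> \<partial>lborel) \<le> ennreal (real (card I) * norm v) * ?J"
    if "finite I" for I
    using that
  proof (induction I)
    case empty
    then show ?case by (simp add: P_def)
  next
    case (insert j I)
    have [measurable]: "ball z r \<in> sets borel" "ball (z + P I) r \<in> sets borel" by simp_all
    let ?w = "(v $ j) *\<^sub>R (axis j 1 :: real ^ 'n)"
    have Pi: "P (insert j I) = P I + ?w" using insert by (simp add: P_def add.commute)
    have "(\<integral>\<^sup>+x\<in>ball z r. ennreal \<bar>F (x + P (insert j I)) - F x\<bar> \<partial>lborel)
      \<le> (\<integral>\<^sup>+x. ennreal \<bar>F (x + P I + ?w) - F (x + P I)\<bar> * indicator (ball z r) x
          + ennreal \<bar>F (x + P I) - F x\<bar> * indicator (ball z r) x \<partial>lborel)"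
    proof (rule nn_integral_mono)
      fix x
      have "\<bar>F (x + P (insert j I)) - F x\<bar> \<le> \<bar>F (x + P I + ?w) - F (x + P I)\<bar> + \<bar>F (x + P I) - F x\<bar>"
        unfolding Pi by (simp add: add.assoc[symmetric])
      then show "ennreal \<bar>F (x + P (insert j I)) - F x\<bar> * indicator (ball z r) x
        \<le> ennreal \<bar>F (x + P I + ?w) - F (x + P I)\<bar> * indicator (ball z r) x
          + ennreal \<bar>F (x + P I) - F x\<bar> * indicator (ball z r) x"
        by (cases "x \<in> ball z r") (auto simp: ennreal_plus[symmetric] simp del: ennreal_plus intro!: ennreal_leI)
    qed
    also have "\<dots> = (\<integral>\<^sup>+x\<in>ball z r. ennreal \<bar>F (x + P I + ?w) - F (x + P I)\<bar> \<partial>lborel)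
        + (\<integral>\<^sup>+x\<in>ball z r. ennreal \<bar>F (x + P I) - F x\<bar> \<partial>lborel)"
      by (rule nn_integral_add) measurable
    also have "\<dots> \<le> ennreal (norm v) * ?J + ennreal (real (card I) * norm v) * ?J"
    proof (rule add_mono)
      have "(\<integral>\<^sup>+x. ennreal \<bar>F (x + P I + ?w) - F (x + P I)\<bar> * indicator (ball (z + P I) r) (x + P I) \<partial>lborel)
        = (\<integral>\<^sup>+x\<in>ball (z + P I) r. ennreal \<bar>F (x + ?w) - F x\<bar> \<partial>lborel)"
        by (rule nn_integral_lborel_shift) measurable
      also have "\<dots> \<le> ennreal \<bar>v $ j\<bar> * ?J"
        using Pn[of I] component_le_norm_cart[of v j] by (intro step) (simp add: dist_norm)
      also have "\<dots> \<le> ennreal (norm v) * ?J"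
        using component_le_norm_cart[of v j] by (intro mult_right_mono ennreal_leI) auto
      finally have *: "(\<integral>\<^sup>+x. ennreal \<bar>F (x + P I + ?w) - F (x + P I)\<bar> * indicator (ball (z + P I) r) (x + P I) \<partial>lborel) \<le> ennreal (norm v) * ?J" .
      have "indicator (ball (z + P I) r) (x + P I) = (indicator (ball z r) x :: ennreal)" for x
        by (simp add: indicator_def dist_norm)
      with * show "(\<integral>\<^sup>+x\<in>ball z r. ennreal \<bar>F (x + P I + ?w) - F (x + P I)\<bar> \<partial>lborel) \<le> ennreal (norm v) * ?J" by simp
    qed (rule insert.IH)
    also have "\<dots> = ennreal (real (card (insert j I)) * norm v) * ?J"
      using insert.hyps by (simp add: distrib_right[symmetric] ennreal_plus[symmetric] del: ennreal_plus)
        (simp add: algebra_simps)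
    finally show ?case .
  qed
  from this[of UNIV] show ?thesis by (simp add: PU)
qed

text \<open>With x = y + v, two points of the ball differ by \<open>norm v < 2 * r\<close>.
  Integrating over \<open>y\<close> first leaves a translation estimate, whose radius
  \<open>r + 2 * norm v\<close> is below \<open>5 * r\<close>.\<close>

lemma nn_integral_pairs_le:
  fixes F h :: "real ^ 'n \<Rightarrow> real"
  assumes F [measurable]: "F \<in> borel_measurable borel" and h [measurable]: "h \<in> borel_measurable borel" and r: "0 < r"
    and translate: "\<And>v. (\<integral>\<^sup>+x\<in>ball z r. ennreal \<bar>F (x + v) - F x\<bar> \<partial>lborel)
      \<le> ennreal (real CARD('n) * norm v) * (\<integral>\<^sup>+x\<in>ball z (r + 2 * norm v). ennreal (h x) \<partial>lborel)"
  shows "(\<integral>\<^sup>+y\<in>ball z r. (\<integral>\<^sup>+x\<in>ball z r. ennreal \<bar>F x - F y\<bar> \<partial>lborel) \<partial>lborel)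
    \<le> emeasure lborel (ball (0 :: real ^ 'n) (2 * r)) * (ennreal (real CARD('n) * (2 * r)) * (\<integral>\<^sup>+x\<in>ball z (5 * r). ennreal (h x) \<partial>lborel))"
proof -
  have [measurable]: "ball z r \<in> sets borel" "ball (0 :: real ^ 'n) (2 * r) \<in> sets borel" by simp_all
  have "(\<integral>\<^sup>+y\<in>ball z r. (\<integral>\<^sup>+x\<in>ball z r. ennreal \<bar>F x - F y\<bar> \<partial>lborel) \<partial>lborel)
    \<le> (\<integral>\<^sup>+y. (\<integral>\<^sup>+v. (ennreal \<bar>F (y + v) - F y\<bar> * indicator (ball z r) y) * indicator (ball 0 (2 * r)) v \<partial>lborel) \<partial>lborel)"
  proof (rule nn_integral_mono)
    fix y
    have "(\<integral>\<^sup>+x\<in>ball z r. ennreal \<bar>F x - F y\<bar> \<partial>lborel) = (\<integral>\<^sup>+v. ennreal \<bar>F (v + y) - F y\<bar> * indicator (ball z r) (v + y) \<partial>lborel)"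
      by (rule nn_integral_lborel_shift[symmetric]) measurable
    moreover have "\<dots> \<le> (\<integral>\<^sup>+v. ennreal \<bar>F (y + v) - F y\<bar> * indicator (ball 0 (2 * r)) v \<partial>lborel)" if y: "y \<in> ball z r"
    proof (rule nn_integral_mono)
      fix v
      have "v \<in> ball 0 (2 * r)" if "v + y \<in> ball z r"
      proof -
        have "norm v = dist (v + y) y" by (simp add: dist_norm)
        also have "\<dots> \<le> dist (v + y) z + dist z y" by (rule dist_triangle)
        finally show ?thesis using that y by (simp add: dist_commute)
      qed
      then show "ennreal \<bar>F (v + y) - F y\<bar> * indicator (ball z r) (v + y) \<le> ennreal \<bar>F (y + v) - F y\<bar> * indicator (ball 0 (2 * r)) v"
        by (cases "v + y \<in> ball z r") (auto simp: add.commute)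
    qed
    ultimately show "(\<integral>\<^sup>+x\<in>ball z r. ennreal \<bar>F x - F y\<bar> \<partial>lborel) * indicator (ball z r) y
      \<le> (\<integral>\<^sup>+v. (ennreal \<bar>F (y + v) - F y\<bar> * indicator (ball z r) y) * indicator (ball 0 (2 * r)) v \<partial>lborel)"
      by (cases "y \<in> ball z r") auto
  qed
  also have "\<dots> = (\<integral>\<^sup>+v. (\<integral>\<^sup>+y. (ennreal \<bar>F (y + v) - F y\<bar> * indicator (ball z r) y) * indicator (ball 0 (2 * r)) v \<partial>lborel) \<partial>lborel)"
    by (rule lborel_pair.Fubini'[symmetric]) measurable
  also have "\<dots> \<le> (\<integral>\<^sup>+v. (ennreal (real CARD('n) * (2 * r)) * (\<integral>\<^sup>+x\<in>ball z (5 * r). ennreal (h x) \<partial>lborel)) * indicator (ball 0 (2 * r)) v \<partial>(lborel :: (real ^ 'n) measure))"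
  proof (rule nn_integral_mono)
    fix v :: "real ^ 'n"
    show "(\<integral>\<^sup>+y. (ennreal \<bar>F (y + v) - F y\<bar> * indicator (ball z r) y) * indicator (ball 0 (2 * r)) v \<partial>lborel)
      \<le> (ennreal (real CARD('n) * (2 * r)) * (\<integral>\<^sup>+x\<in>ball z (5 * r). ennreal (h x) \<partial>lborel)) * indicator (ball 0 (2 * r)) v"
    proof (cases "v \<in> ball 0 (2 * r)")
      case True
      have "(\<integral>\<^sup>+y\<in>ball z r. ennreal \<bar>F (y + v) - F y\<bar> \<partial>lborel)
        \<le> ennreal (real CARD('n) * norm v) * (\<integral>\<^sup>+x\<in>ball z (r + 2 * norm v). ennreal (h x) \<partial>lborel)"
        by (rule translate)
      also have "\<dots> \<le> ennreal (real CARD('n) * (2 * r)) * (\<integral>\<^sup>+x\<in>ball z (5 * r). ennreal (h x) \<partial>lborel)"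
      proof (rule mult_mono)
        show "ennreal (real CARD('n) * norm v) \<le> ennreal (real CARD('n) * (2 * r))"
          using True by (intro ennreal_leI mult_left_mono) auto
        show "(\<integral>\<^sup>+x\<in>ball z (r + 2 * norm v). ennreal (h x) \<partial>lborel) \<le> (\<integral>\<^sup>+x\<in>ball z (5 * r). ennreal (h x) \<partial>lborel)"
        proof (rule nn_integral_mono)
          fix x
          show "ennreal (h x) * indicator (ball z (r + 2 * norm v)) x \<le> ennreal (h x) * indicator (ball z (5 * r)) x"
            using True by (auto simp: indicator_def)
        qed
      qed auto
      finally show ?thesis using True by simp
    qed simp
  qed
  also have "\<dots> = emeasure lborel (ball (0 :: real ^ 'n) (2 * r)) * (ennreal (real CARD('n) * (2 * r)) * (\<integral>\<^sup>+x\<in>ball z (5 * r). ennreal (h x) \<partial>lborel))"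
    by (subst nn_integral_cmult_indicator) (auto simp: mult.commute)
  finally show ?thesis .
qed

text \<open>Borel representatives are required because translations and Tonelli are applied to
  \<open>lborel\<close>. The component of the gradient is represented separately for each direction
  inside the proof; only the common bound \<open>h\<close> for the length of the gradient is
  kept.\<close>

lemma weak_gradient_representatives:
  fixes f :: "real ^ 'n \<Rightarrow> real"
  assumes wg: "weak_gradient f g"
  obtains F h where "F \<in> borel_measurable borel" "h \<in> borel_measurable borel" "\<And>x. 0 \<le> h x"
    "AE x in lborel. f x = F x" "AE x in lborel. norm (g x) = h x"
    "\<And>j s y z r R. dist y z + \<bar>s\<bar> + r \<le> R \<Longrightarrow>
      (\<integral>\<^sup>+x\<in>ball y r. ennreal \<bar>F (x + s *\<^sub>R axis j 1) - F x\<bar> \<partial>lborel) \<le> ennreal \<bar>s\<bar> * (\<integral>\<^sup>+x\<in>ball z R. ennreal (h x) \<partial>lborel)"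
proof -
  have fl: "locally_integrable lebesgue f" and gl: "locally_integrable lebesgue g"
    and ibp: "\<And>\<phi> i. test_function \<phi> \<Longrightarrow>
        (LINT x|lebesgue. f x * partial_deriv i \<phi> x) = - (LINT x|lebesgue. g x $ i * \<phi> x)"
    using wg by (auto simp: weak_gradient_def)
  have fm: "f \<in> borel_measurable lebesgue" and gm [measurable]: "g \<in> borel_measurable lebesgue"
    using fl gl by (auto simp: locally_integrable_def)
  obtain F where F [measurable]: "F \<in> borel_measurable borel" and fF: "AE x in lborel. f x = F x"
    using completion_ex_borel_measurable_real[OF fm] by auto
  have "(\<lambda>x. norm (g x)) \<in> borel_measurable lebesgue" using gm by measurable
  then obtain h0 where h0: "h0 \<in> borel_measurable borel" "AE x in lborel. norm (g x) = h0 x"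
    using completion_ex_borel_measurable_real[of "\<lambda>x. norm (g x)" lborel] by auto
  define h where "h x = max 0 (h0 x)" for x
  have h [measurable]: "h \<in> borel_measurable borel" unfolding h_def using h0(1) by measurable
  have gh: "AE x in lborel. norm (g x) = h x"
    using h0(2) by eventually_elim (metis h_def max.absorb2 norm_ge_zero)
  have transfer: "integrable lborel (\<lambda>x. indicator (cball 0 R) x * U x)"
    if U [measurable]: "U \<in> borel_measurable borel" and uU: "AE x in lborel. u x = U x" and ul: "set_integrable lebesgue (cball 0 R) u"
    for u U :: "real ^ 'n \<Rightarrow> real" and R
  proof -
    have [measurable]: "cball (0 :: real ^ 'n) R \<in> sets borel" by simp
    have m: "(\<lambda>x. indicator (cball 0 R) x * U x) \<in> borel_measurable lborel" by measurable
    have "integrable lebesgue (\<lambda>x. indicator (cball 0 R) x * U x)"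
    proof (rule integrable_cong_AE_imp[OF ul[unfolded set_integrable_def]])
      show "AE x in lebesgue. indicator (cball 0 R) x *\<^sub>R u x = indicator (cball 0 R) x * U x"
        using AE_completion[OF uU] by eventually_elim simp
    qed (use measurable_completion[OF m] in simp)
    then show ?thesis using integrable_completion[OF m] by simp
  qed
  have Fi: "integrable lborel (\<lambda>x. indicator (cball 0 R) x * F x)" for R
    using fl by (intro transfer[OF F fF]) (simp add: locally_integrable_def)
  have diff: "(\<integral>\<^sup>+x\<in>ball y r. ennreal \<bar>F (x + s *\<^sub>R axis j 1) - F x\<bar> \<partial>lborel) \<le> ennreal \<bar>s\<bar> * (\<integral>\<^sup>+x\<in>ball z R. ennreal (h x) \<partial>lborel)"
    if R: "dist y z + \<bar>s\<bar> + r \<le> R" for j s y z r R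
  proof -
    have gjm: "(\<lambda>x. g x $ j) \<in> borel_measurable lebesgue"
      using gm by (rule measurable_compose) (intro borel_measurable_continuous_onI continuous_intros)
    then obtain G where G [measurable]: "G \<in> borel_measurable borel" and gG: "AE x in lborel. g x $ j = G x"
      using completion_ex_borel_measurable_real[of "\<lambda>x. g x $ j" lborel] by auto
    have "set_integrable lebesgue (cball 0 R) (\<lambda>x. g x $ j)" for R
    proof -
      have "integrable lebesgue (\<lambda>x. indicator (cball 0 R) x *\<^sub>R g x)"
        using gl by (simp add: locally_integrable_def set_integrable_def)
      from integrable_bounded_linear[OF bounded_linear_vec_nth[of j] this]
      show ?thesis by (simp add: set_integrable_def)
    qed
    then have Gi: "integrable lborel (\<lambda>x. indicator (cball 0 R) x * G x)" for R
      by (intro transfer[OF G gG])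
    have weak: "(\<integral>x. F x * (\<Prod>i\<in>UNIV. (k(j := d)) i (x $ i)) \<partial>lborel) = - (\<integral>x. G x * (\<Prod>i\<in>UNIV. k i (x $ i)) \<partial>lborel)"
      if k: "\<And>i. smooth1 (k i)" "\<And>i t. t \<notin> {a i..b i} \<Longrightarrow> k i t = 0"
        "\<And>t. (k j has_real_derivative d t) (at t)" "smooth1 d" for k d a b
    proof -
      let ?\<phi> = "\<lambda>x. \<Prod>i\<in>UNIV. k i (x $ i)" and ?d\<phi> = "\<lambda>x. \<Prod>i\<in>UNIV. (k(j := d)) i (x $ i)"
      have prodm: "(\<lambda>x :: real ^ 'n. \<Prod>i\<in>UNIV. e i (x $ i)) \<in> borel_measurable borel" if "\<And>i. smooth1 (e i)" for e
      proof (rule borel_measurable_prod)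
        fix i
        have "(\<lambda>x :: real ^ 'n. x $ i) \<in> borel_measurable borel"
          by (intro borel_measurable_continuous_onI continuous_intros)
        then show "(\<lambda>x :: real ^ 'n. e i (x $ i)) \<in> borel_measurable borel"
          by (rule measurable_compose[OF _ smooth1_measurable[OF that]])
      qed
      have kd: "smooth1 ((k(j := d)) i)" for i using k(1,4) by simp
      have [measurable]: "?\<phi> \<in> borel_measurable borel" "?d\<phi> \<in> borel_measurable borel"
        by (rule prodm[OF k(1)], rule prodm[OF kd])
      have tf: "test_function ?\<phi>" by (rule test_function_tensor) (rule k(1), rule k(2))
      have pd: "partial_deriv j ?\<phi> = ?d\<phi>" by (rule partial_deriv_tensor) (rule k(1), rule k(3))
      have ibp': "(LINT x|lebesgue. f x * ?d\<phi> x) = - (LINT x|lebesgue. g x $ j * ?\<phi> x)"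
        using ibp[OF tf, of j] unfolding pd .
      have "(LINT x|lebesgue. u x * e x) = (LINT x|lborel. U x * e x)"
        if [measurable]: "U \<in> borel_measurable borel" "e \<in> borel_measurable borel"
          and uU: "AE x in lborel. u x = U x" and u: "u \<in> borel_measurable lebesgue"
        for u U e :: "real ^ 'n \<Rightarrow> real"
      proof -
        have m: "(\<lambda>x. U x * e x) \<in> borel_measurable lborel" by measurable
        have e: "e \<in> borel_measurable lebesgue" by (rule measurable_completion) measurable
        have "(LINT x|lebesgue. u x * e x) = (LINT x|lebesgue. U x * e x)"
        proof (rule integral_cong_AE)
          show "AE x in lebesgue. u x * e x = U x * e x" using AE_completion[OF uU] by eventually_elim simp
        qed (use u e measurable_completion[OF m] in auto)
        then show ?thesis using integral_completion[OF m] by simp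
      qed
      note eq = this
      have "(LINT x|lebesgue. f x * ?d\<phi> x) = (LINT x|lborel. F x * ?d\<phi> x)"
        by (rule eq[OF F _ fF fm]) measurable
      moreover have "(LINT x|lebesgue. g x $ j * ?\<phi> x) = (LINT x|lborel. G x * ?\<phi> x)"
        by (rule eq[OF G _ gG gjm]) measurable
      ultimately show ?thesis using ibp' by simp
    qed
    show ?thesis
    proof (rule nn_integral_difference_le[where G = G])
      show "AE x in lborel. \<bar>G x\<bar> \<le> h x"
        using gG gh by eventually_elim (metis component_le_norm_cart)
      show "AE x in lborel. F (x + s *\<^sub>R axis j 1) - F x
        = (\<integral>\<theta>. indicator {0..1} \<theta> * (s * G (x + \<theta> *\<^sub>R s *\<^sub>R axis j 1)) \<partial>lborel)"
        by (rule weak_derivative_difference[OF F Fi G Gi weak])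
    qed (use R in auto)
  qed
  show ?thesis by (rule that[OF F h _ fF gh diff]) (simp_all add: h_def)
qed

section \<open>Poincare inequality\<close>

text \<open>The free constant \<open>c\<close> is later taken to be the value \<open>F y\<close> and
  integrated over \<open>y\<close>, which brings in the double integral over pairs.\<close>

lemma mean_osc_ball_le:
  fixes f :: "real ^ 'n \<Rightarrow> real"
  assumes f: "locally_integrable lebesgue f" and [measurable]: "F \<in> borel_measurable borel"
    and fF: "AE x in lborel. f x = F x" and r: "0 < r"
  shows "ennreal (mean_osc f (ball z r) * measure lebesgue (ball z r) / 2) \<le> (\<integral>\<^sup>+x\<in>ball z r. ennreal \<bar>F x - c\<bar> \<partial>lborel)"
proof -
  let ?B = "ball z r"
  have [measurable]: "?B \<in> sets borel" by simp
  have m: "0 < measure lebesgue ?B" using r by simp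
  have Bl: "?B \<in> sets lebesgue" by simp
  have "mean_osc f ?B \<le> 2 / measure lebesgue ?B * (LINT y:?B|lebesgue. \<bar>f y - c\<bar>)"
    by (rule mean_osc_le_integral[OF f bounded_ball Bl m])
  then have "mean_osc f ?B * measure lebesgue ?B / 2 \<le> (LINT y:?B|lebesgue. \<bar>f y - c\<bar>)"
    using m by (simp add: field_simps)
  then have "ennreal (mean_osc f ?B * measure lebesgue ?B / 2) \<le> ennreal (LINT y:?B|lebesgue. \<bar>f y - c\<bar>)"
    by (rule ennreal_leI)
  also have "\<dots> = (\<integral>\<^sup>+y. ennreal (indicator ?B y *\<^sub>R \<bar>f y - c\<bar>) \<partial>lebesgue)"
  proof -
    have "set_integrable lebesgue ?B (\<lambda>y. c)" by (rule set_integrable_const) simp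
    then have "set_integrable lebesgue ?B (\<lambda>y. \<bar>f y - c\<bar>)"
      using locally_integrable_set_integrable[OF f bounded_ball Bl] by (intro set_integrable_abs set_integral_diff)
    then show ?thesis
      unfolding set_lebesgue_integral_def set_integrable_def by (intro nn_integral_eq_integral[symmetric]) auto
  qed
  also have "\<dots> = (\<integral>\<^sup>+x\<in>?B. ennreal \<bar>F x - c\<bar> \<partial>lborel)"
    unfolding nn_integral_completion
  proof (rule nn_integral_cong_AE)
    show "AE y in lborel. ennreal (indicator ?B y *\<^sub>R \<bar>f y - c\<bar>) = ennreal \<bar>F y - c\<bar> * indicator ?B y"
      using fF by eventually_elim (simp add: indicator_def)
  qed
  finally show ?thesis .
qed

theorem weak_Lp_norm_m_fun_le:
  assumes lb: "doubling_radon (lborel :: (real ^ 'n) measure)" and p: "1 < p"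
  shows "\<exists>C>0. \<forall>(f :: real ^ 'n \<Rightarrow> real) g. f \<in> homogeneous_Sobolev p \<and> weak_gradient f g \<longrightarrow>
        weak_Lp_norm lborel p p (m_fun f) \<le> ennreal C * Lp_norm lebesgue p g"
proof -
  interpret doubling_radon "lborel :: (real ^ 'n) measure" by (rule lb)
  have p0: "p \<noteq> 0" "(0::real) < 5" using p by auto
  obtain A where A: "0 < A" "\<And>(h :: real ^ 'n \<Rightarrow> real) s S. h \<in> borel_measurable borel \<Longrightarrow> (\<And>y. 0 \<le> h y) \<Longrightarrow> 0 < s \<Longrightarrow>
    (\<And>z. z \<in> S \<Longrightarrow> 0 < snd z \<and>
       ennreal (s * snd z powr (- p / p)) < avg (\<lambda>y. ennreal (h y)) (fst z) (5 * snd z)) \<Longrightarrow>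
    ennreal (s powr p) * emeasure (nu_measure lborel p) S \<le> ennreal A * (\<integral>\<^sup>+y. ennreal (h y powr p) \<partial>lborel)"
    using nu_le_truncation[OF p0(1) p p0(2)] by blast
  define n where "n = CARD('n)"
  have n: "0 < n" by (simp add: n_def)
  define v where "v = unit_ball_vol (real n)"
  have v: "0 < v" by (simp add: v_def)
  have ball: "emeasure lborel (ball x t) = ennreal (v * t ^ n)" "measure lebesgue (ball x t) = v * t ^ n"
    if "0 < t" for x :: "real ^ 'n" and t
    using measure_ball_lebesgue[of t x] that by (simp_all add: v_def n_def)
  \<comment> \<open>The 4 is the 2 of \<open>mean_osc_ball_le\<close> times the 2 in
    \<open>2 * r\<close>; 2^n compares the volumes of balls of radii 2r and r, 5^n renormalises to
    the ball of radius 5r, and n counts the coordinate steps.\<close>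
  define K where "K = 4 * 2 ^ n * 5 ^ n * real n"
  have K: "0 < K" using n by (simp add: K_def)
  show ?thesis
  proof (intro exI[of _ "(A * K powr p) powr (1 / p)"] conjI allI impI)
    show "0 < (A * K powr p) powr (1 / p)" using A K by simp
    fix f :: "real ^ 'n \<Rightarrow> real" and g
    assume "f \<in> homogeneous_Sobolev p \<and> weak_gradient f g"
    then have wg: "weak_gradient f g" by simp
    then have f: "locally_integrable lebesgue f" by (simp add: weak_gradient_def)
    obtain F h where F [measurable]: "F \<in> borel_measurable borel" and h [measurable]: "h \<in> borel_measurable borel"
      and h0: "\<And>x. 0 \<le> h x" and fF: "AE x in lborel. f x = F x" and gh: "AE x in lborel. norm (g x) = h x"
      and step: "\<And>j s y z r R. dist y z + \<bar>s\<bar> + r \<le> R \<Longrightarrow>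
      (\<integral>\<^sup>+x\<in>ball y r. ennreal \<bar>F (x + s *\<^sub>R axis j 1) - F x\<bar> \<partial>lborel) \<le> ennreal \<bar>s\<bar> * (\<integral>\<^sup>+x\<in>ball z R. ennreal (h x) \<partial>lborel)"
      using weak_gradient_representatives[OF wg] by blast
    have Lp: "Lp_norm lebesgue p g = enn_powr (\<integral>\<^sup>+y. ennreal (h y powr p) \<partial>lborel) (1 / p)"
    proof -
      have "(\<integral>\<^sup>+ x. ennreal (norm (g x) powr p) \<partial>lebesgue) = (\<integral>\<^sup>+y. ennreal (h y powr p) \<partial>lborel)"
        unfolding nn_integral_completion
      proof (rule nn_integral_cong_AE)
        show "AE x in lborel. ennreal (norm (g x) powr p) = ennreal (h x powr p)"
          using gh by eventually_elim simp
      qed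
      then show ?thesis by (simp add: Lp_norm_def)
    qed
    have poincare: "ennreal (mean_osc f (ball z r)) \<le> ennreal (K * r) * avg (\<lambda>y. ennreal (h y)) z (5 * r)"
      if r: "0 < r" for z r
    proof -
      let ?J = "\<integral>\<^sup>+x\<in>ball z (5 * r). ennreal (h x) \<partial>lborel" and ?O = "mean_osc f (ball z r)"
      define m where "m = v * r ^ n"
      have m: "0 < m" using v r by (simp add: m_def)
      have mB: "emeasure lborel (ball z r) = ennreal m" "measure lebesgue (ball z r) = m"
        using ball[OF r] by (simp_all add: m_def)
      have O: "0 \<le> ?O" by (rule mean_osc_nonneg)
      \<comment> \<open>The bound by \<open>F y\<close> holds for every \<open>y\<close>;
        integrating it over the ball multiplies the left side by the volume
        \<open>m\<close>.\<close>
      have "ennreal (?O * m / 2) * ennreal m = (\<integral>\<^sup>+y\<in>ball z r. ennreal (?O * m / 2) \<partial>lborel)"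
        by (subst nn_integral_cmult_indicator) (auto simp: mB)
      also have "\<dots> \<le> (\<integral>\<^sup>+y\<in>ball z r. (\<integral>\<^sup>+x\<in>ball z r. ennreal \<bar>F x - F y\<bar> \<partial>lborel) \<partial>lborel)"
        using mean_osc_ball_le[OF f F fF r, of z, unfolded mB] by (intro nn_integral_mono mult_right_mono) auto
      also have "\<dots> \<le> emeasure lborel (ball (0 :: real ^ 'n) (2 * r)) * (ennreal (real CARD('n) * (2 * r)) * ?J)"
        by (rule nn_integral_pairs_le[OF F h r nn_integral_translate_le[OF F h step]])
      also have "emeasure lborel (ball (0 :: real ^ 'n) (2 * r)) = ennreal (2 ^ n * m)"
        using r by (simp add: ball m_def power_mult_distrib mult_ac)
      finally have le: "ennreal (?O * m / 2) * ennreal m \<le> ennreal (2 ^ n * m) * (ennreal (real n * (2 * r)) * ?J)"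
        by (simp add: n_def)
      have m5: "emeasure lborel (ball z (5 * r)) = ennreal (5 ^ n * m)"
        using r by (simp add: ball m_def power_mult_distrib mult_ac)
      have "ennreal ?O = ennreal (2 / (m * m)) * (ennreal (?O * m / 2) * ennreal m)"
        using m O by (simp add: ennreal_mult[symmetric])
      also have "\<dots> \<le> ennreal (2 / (m * m)) * (ennreal (2 ^ n * m) * (ennreal (real n * (2 * r)) * ?J))"
        using le by (intro mult_left_mono) auto
      also have "\<dots> = ennreal (2 / (m * m) * (2 ^ n * m) * (real n * (2 * r))) * ?J"
      proof -
        have nn: "0 \<le> 2 / (m * m)" "0 \<le> 2 ^ n * m" "0 \<le> real n * (2 * r)" "0 \<le> 2 / (m * m) * (2 ^ n * m)"
          using m r by auto
        show ?thesis unfolding ennreal_mult[OF nn(4,3)] ennreal_mult[OF nn(1,2)] by (simp only: mult.assoc)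
      qed
      also have "2 / (m * m) * (2 ^ n * m) * (real n * (2 * r)) = K * r * (1 / (5 ^ n * m))"
        using m by (simp add: K_def field_simps)
      also have "ennreal (K * r * (1 / (5 ^ n * m))) * ?J = ennreal (K * r) * (?J * ennreal (1 / (5 ^ n * m)))"
        using K r m by (subst ennreal_mult) (auto simp: mult_ac)
      also have "?J * ennreal (1 / (5 ^ n * m)) = avg (\<lambda>y. ennreal (h y)) z (5 * r)"
        unfolding avg_def m5 using m by (simp add: divide_ennreal_def inverse_ennreal inverse_eq_divide)
      finally show ?thesis .
    qed
    show "weak_Lp_norm lborel p p (m_fun f) \<le> ennreal ((A * K powr p) powr (1 / p)) * Lp_norm lebesgue p g"
      unfolding Lp
    proof (rule weak_Lp_norm_le)
      fix s :: real assume s: "0 < s"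
      let ?S = "{z. 0 < snd z \<and> s < \<bar>m_fun f z\<bar>}"
      \<comment> \<open>With \<gamma> = p the weight \<open>t powr (\<gamma> / p)\<close> is t
        itself, the factor in the Poincare inequality. So \<open>?S\<close> satisfies the level
        condition for the averages of \<open>h\<close> over radius 5t, at level
        \<open>s / K\<close>.\<close>
      have "ennreal ((s / K) powr p) * emeasure (nu_measure lborel p) ?S \<le> ennreal A * (\<integral>\<^sup>+y. ennreal (h y powr p) \<partial>lborel)"
      proof (rule A(2)[OF h h0])
        show "0 < s / K" using s K by simp
        fix z assume "z \<in> ?S"
        then have z: "0 < snd z" "s < mean_osc f (ball (fst z) (snd z))"
          by (auto simp: m_fun_def case_prod_beta mean_osc_nonneg)
        have "ennreal s < ennreal (mean_osc f (ball (fst z) (snd z)))"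
          using z(2) s by (simp add: ennreal_less_iff)
        also note poincare[OF z(1)]
        finally have lt: "ennreal s < ennreal (K * snd z) * avg (\<lambda>y. ennreal (h y)) (fst z) (5 * snd z)" .
        have "ennreal (s * (K * snd z) powr - 1) < avg (\<lambda>y. ennreal (h y)) (fst z) (5 * snd z)"
          using lt s K z(1) ennreal_less_powr_mult_iff[of "K * snd z" s 1] by simp
        moreover have "s * (K * snd z) powr - 1 = s / K * snd z powr (- p / p)"
          using K z(1) p by (simp add: powr_minus_divide)
        ultimately show "0 < snd z \<and> ennreal (s / K * snd z powr (- p / p)) < avg (\<lambda>y. ennreal (h y)) (fst z) (5 * snd z)"
          using z(1) by simp
      qed
      then have "ennreal (K powr p) * (ennreal ((s / K) powr p) * emeasure (nu_measure lborel p) ?S)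
        \<le> ennreal (K powr p) * (ennreal A * (\<integral>\<^sup>+y. ennreal (h y powr p) \<partial>lborel))"
        by (intro mult_left_mono) auto
      moreover have "ennreal (K powr p) * ennreal ((s / K) powr p) = ennreal (s powr p)"
        using K s by (simp add: ennreal_mult[symmetric] powr_mult[symmetric])
      moreover have "ennreal (K powr p) * ennreal A = ennreal (A * K powr p)"
        using A(1) by (simp add: ennreal_mult[symmetric] mult.commute)
      ultimately show "distr_term lborel p p (m_fun f) s \<le> ennreal (A * K powr p) * (\<integral>\<^sup>+y. ennreal (h y powr p) \<partial>lborel)"
        unfolding distr_term_def by (simp add: mult.assoc[symmetric])
    qed (use A K p in auto)
  qed
qed

theorem corollary6p3:
  fixes \<mu> :: "(real ^ 'n) measure" and \<gamma> p :: real
  assumes "radon_measure \<mu>" and "doubling \<mu>" and "\<gamma> \<noteq> 0" and "1 \<le> p"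
  shows
    "(\<gamma> < 0 \<or> (\<exists>d. 0 < d \<and> d < \<gamma> \<and> dyadic_regular \<mu> d) \<or> (0 < \<gamma> \<and> 1 < p) \<longrightarrow>
      (\<exists>C>0. \<forall>f. locally_integrable (completion \<mu>) f \<and> (AE x in \<mu>. 0 \<le> f x) \<longrightarrow>
        weak_Lp_norm \<mu> \<gamma> p (a_fun \<mu> \<gamma> p f) \<le> ennreal C * Lp_norm (completion \<mu>) p f))
    \<and>
    (0 < \<gamma> \<or> \<gamma> < 0 \<longrightarrow>
      (\<exists>C>0. \<forall>f. locally_integrable (completion \<mu>) f \<and> (AE x in \<mu>. 0 \<le> f x) \<longrightarrow>
        Lp_norm (completion \<mu>) p f \<le> ennreal C * weak_Lp_limit \<mu> \<gamma> p (a_fun \<mu> \<gamma> p f)))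
    \<and>
    (\<mu> = lborel \<and> \<gamma> \<notin> {0..real CARD('n)} \<longrightarrow>
      (\<exists>C>0. \<forall>f. locally_integrable lebesgue f \<longrightarrow>
        weak_Lp_norm \<mu> \<gamma> p (b_fun \<gamma> p f) \<le> ennreal C * JN_norm p f))
    \<and>
    (\<mu> = lborel \<and> 1 < p \<longrightarrow>
      (\<exists>C>0. \<forall>f g. f \<in> homogeneous_Sobolev p \<and> weak_gradient f g \<longrightarrow>
        weak_Lp_norm \<mu> p p (m_fun f) \<le> ennreal C * Lp_norm lebesgue p g))"
proof -
  have dr: "doubling_radon \<mu>" by unfold_locales (use assms in auto)
  show ?thesis
  proof (intro conjI impI)
    assume "\<gamma> < 0 \<or> (\<exists>d. 0 < d \<and> d < \<gamma> \<and> dyadic_regular \<mu> d) \<or> (0 < \<gamma> \<and> 1 < p)"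
    then show "\<exists>C>0. \<forall>f. locally_integrable (completion \<mu>) f \<and> (AE x in \<mu>. 0 \<le> f x) \<longrightarrow>
        weak_Lp_norm \<mu> \<gamma> p (a_fun \<mu> \<gamma> p f) \<le> ennreal C * Lp_norm (completion \<mu>) p f"
      using doubling_radon.weak_Lp_norm_a_fun_le[OF dr] assms(4) by blast
  next
    show "\<exists>C>0. \<forall>f. locally_integrable (completion \<mu>) f \<and> (AE x in \<mu>. 0 \<le> f x) \<longrightarrow>
        Lp_norm (completion \<mu>) p f \<le> ennreal C * weak_Lp_limit \<mu> \<gamma> p (a_fun \<mu> \<gamma> p f)"
      by (rule doubling_radon.Lp_norm_le_weak_Lp_limit_a_fun[OF dr assms(3,4)])
  next
    assume "\<mu> = lborel \<and> \<gamma> \<notin> {0..real CARD('n)}"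
    then have "\<mu> = lborel" "\<gamma> \<notin> {0..real CARD('n)}" by auto
    with weak_Lp_norm_b_fun_le[OF dr[unfolded \<open>\<mu> = lborel\<close>] this(2) assms(4)]
    show "\<exists>C>0. \<forall>f. locally_integrable lebesgue f \<longrightarrow>
        weak_Lp_norm \<mu> \<gamma> p (b_fun \<gamma> p f) \<le> ennreal C * JN_norm p f" by simp
  next
    assume "\<mu> = lborel \<and> 1 < p"
    then have "\<mu> = lborel" "1 < p" by auto
    with weak_Lp_norm_m_fun_le[OF dr[unfolded \<open>\<mu> = lborel\<close>] this(2)]
    show "\<exists>C>0. \<forall>f g. f \<in> homogeneous_Sobolev p \<and> weak_gradient f g \<longrightarrow>
        weak_Lp_norm \<mu> p p (m_fun f) \<le> ennreal C * Lp_norm lebesgue p g" by simp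
  qed
qed

end
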